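(* Let $X_1,\dots,X_n$ be i.i.d. with density $f_0\in\mathcal{C}^s$ on $[0,1]$, $0<s\le1$, with $c_-\le f_0\le c_+$ for some $c_-,c_+>0$. Let $a\in\mathcal{C}^\gamma$ on $[0,1]$ for some $\gamma>0$, let $\hat\Psi_0=\mathbb{P}_n[\pi_p[a]]$ and $\sigma^2=\int(a-\int af_0)^2f_0$, and assume $\sigma^2>0$. Assume $p\gg n^{\frac1{2(\gamma+s)}}$. 1. Let $\Pi$ be the Haar series prior $\Pi(d\theta)\propto\prod_{0\le j\le J,\,1\le k\le2^j}\exp(-H(\theta^{jk}/\sigma_j))d\theta^{jk}$ with $\sigma_j>0$, $p\ll n/\ln n$, $H:\mathbb{R}\to\mathbb{R}$ twice differentiable with $\|H'\|_\infty<\infty$ and $\|H''\|_\infty<\infty$, $$\sum_{j=0}^J\sigma_j^{-2}\sum_{k=1}^{2^j}\langle\psi_{jk}|a\rangle_2^2\ll n\quad\text{and}\quad\sum_{j=0}^J\sigma_j^{-1}2^{j/2}\le c\sqrt{np\ln n}$$ for a fixed constant $c>0$. Then $$d_{BL}\left(\Pi_n\circ Z_n^{-1},\mathcal{N}(0,\sigma^2)\right)=O_p\left(p^{-(\gamma\wedge s)}+\sqrt{\frac{p\ln n}n}+\frac1n\sum_{j=0}^J\sigma_j^{-2}\sum_{k=1}^{2^j}\langle\psi_{jk}|a\rangle_2^2\right)=o_p(1),$$ where $$Z_n:=\sqrt n\left(\int af+\frac1n\sum_{j=0}^J\sigma_j^{-1}\sum_{k=1}^{2^j}H'\left(\sigma_j^{-1}\langle\psi_{jk}|\ln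 f\rangle_2\right)\langle\psi_{jk}|a\rangle_2-\hat\Psi_0\right).$$ In particular the BvM phenomenon with centring $\hat\Psi_0$ and asymptotic variance $\sigma^2$ holds for the functional $f\mapsto\int af+\frac1n\sum_{j=0}^J\sigma_j^{-1}\sum_{k=1}^{2^j}H'(\sigma_j^{-1}\langle\psi_{jk}|\ln f\rangle_2)\langle\psi_{jk}|a\rangle_2$ whenever, in the setting of this item, $\sum_{j=0}^J\sigma_j^{-2}\sum_{k=1}^{2^j}\langle\psi_{jk}|a\rangle_2^2\ll n$, $\gamma+s>1/2$ and $n^{\frac1{2(\gamma+s)}}\ll p\ll n/\ln n$. 2. Let $\Pi$ be the Dirichlet prior with parameter $m\in(0,\infty)^p$ on $\omega$, with $p\ll n/\ln n$ and $\|m\|_\infty=O(1)$. Then $$d_{BL}\left(\Pi_n\circ Z_n^{-1},\mathcal{N}(0,\sigma^2)\right)=O_p\left(p^{-(\gamma\wedge s)}+\sqrt{\frac{p\ln n}n}\right)=o_p(1),$$ where $$Z_n:=\sqrt n\left(\int af-\frac{\|m\|_1}n\langle a|h_{\bar m}-f\rangle_2-\hat\Psi_0\right),\qquad\bar m:=m/\|m\|_1.$$ In particular the BvM phenomenon with centring $\hat\Psi_0$ and asymptotic variance $\sigma^2$ holds for the functional $f\mapsto\int af-\frac{\|m\|_1}n\langle a|h_{\bar m}-f\rangle_2$ whenever $\|m\|_\infty=O(1)$, $\gamma+s>1/2$ and $n^{\frac1{2(\gamma+s)}}\ll p\ll n/\ln n$.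
   Context: Histogram model. $p=2^{J+1}$, $J\ge0$; $I_\mu=[\frac{\mu-1}p,\frac\mu p)$ for $1\le\mu\le p-1$, $I_p=[\frac{p-1}p,1]$. $\mathcal{F}_p=\mathrm{span}\{\mathbf{1}_{I_\mu}\}$, with $L^2[0,1]$-orthonormal basis $\{1\}\cup\{\psi_{jk}:0\le j\le J,1\le k\le2^j\}$, where $\psi_{jk}$ are the $L^2$-normalised Haar wavelets on $[0,1]$ ($\psi_{jk}=2^{j/2}$ on the left half and $-2^{j/2}$ on the right half of the $k$-th dyadic interval of length $2^{-j}$, and $0$ elsewhere). $\pi_p$ is the $L^2[0,1]$-orthogonal projection onto $\mathcal{F}_p$, $\langle\cdot|\cdot\rangle_2$ the $L^2[0,1]$ inner product. The model is the set of strictly positive histogram densities in $\mathcal{F}_p$, parametrised either by $\theta=(\theta^{jk})\in\mathbb{R}^{p-1}$, $f_\theta=\exp(\sum_{j,k}\theta^{jk}\psi_{jk}-\psi(\theta))$ with $\psi(\theta)$ the log-normaliser (so $\theta^{jk}=\langle\psi_{jk}|\ln f_\theta\rangle_2$), or by bin probabilities $\omega$, $h_\omega=p\sum_{\mu=1}^p\omega_\mu\mathbf{1}_{I_\mu}$, $\omega_\mu>0$, $\sum_\mu\omega_\mu=1$. The Dirichlet prior with parameter $m$ has density proportional to $\prod_{\mu=1}^p\omega_\mu^{m_\mu-1}$ in $(\omega_1,\dots,\omega_{p-1})$. Posterior: $\Pi_n(df)\propto\prod_{i=1}^nf(X_i)\,\Pi(df)$, assumed well-defined (finite normalising constant). $f$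 denotes a generic histogram distributed according to $\Pi_n$, and $\Pi_n\circ Z_n^{-1}$ is the law of $Z_n(f)$ with data fixed. $\mathbb{P}_n=\frac1n\sum_{i=1}^n\delta_{X_i}$ and $\mathbb{P}_n[g]=\int g\,d\mathbb{P}_n$. Asymptotics: $n\to\infty$ with $p=p_n$, and $\sigma_j$, $m$ allowed to depend on $n$ ($f_0,a,H,s,\gamma$ fixed); $a_n\ll b_n$ (equivalently $b_n\gg a_n$) means $a_n/b_n\to0$; $O_p,o_p$ are under $X^n\sim f_0^{\otimes n}$. $\mathcal{C}^s$ is the classical Hölder space on $[0,1]$. For probability measures $\mu,\nu$ on $\mathbb{R}$, $d_{BL}(\mu,\nu)=\sup\{|\int h\,d(\mu-\nu)|:\ h:\mathbb{R}\to[-1,1],\ |h(x)-h(y)|\le|x-y|\}$. The BvM phenomenon with centring $\hat\Psi_0$ and asymptotic variance $\sigma^2>0$ holds for functionals $\Phi_n$ if $d_{BL}(\Pi_n\circ(\sqrt n(\Phi_n-\hat\Psi_0))^{-1},\mathcal{N}(0,\sigma^2))=o_p(1)$. *)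

theory Defs
  imports "HOL-Probability.Probability" "HOL-Library.Landau_Symbols"
begin

definition inner2 :: "(real \<Rightarrow> real) \<Rightarrow> (real \<Rightarrow> real) \<Rightarrow> real" where
  "inner2 g h = (LINT x:{0..1}|lborel. g x * h x)"

(* Hoelder space on [0,1]. The number of derivatives is the largest natural number strictly below
   \<gamma>, so for integer \<gamma> the top derivative is Lipschitz; the exponent \<gamma> - k lies in (0,1].
   Boundedness of all derivatives is automatic on [0,1]. *)
definition holder_space :: "real \<Rightarrow> (real \<Rightarrow> real) set" where
  "holder_space \<gamma> = {g. \<exists>k D L. k = nat \<lceil>\<gamma>\<rceil> - 1
     \<and> (\<forall>x\<in>{0..1}. D 0 x = g x)
     \<and> (\<forall>i<k. \<forall>x\<in>{0..1}. (D i has_real_derivative D (Suc i) x) (at x within {0..1}))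
     \<and> (\<forall>x\<in>{0..1}. \<forall>y\<in>{0..1}. \<bar>D k x - D k y\<bar> \<le> L * \<bar>x - y\<bar> powr (\<gamma> - real k))}"

definition bin :: "nat \<Rightarrow> nat \<Rightarrow> real set" where
  "bin p \<mu> = (if \<mu> = p then {(real p - 1) / real p .. 1}
              else {(real \<mu> - 1) / real p ..< real \<mu> / real p})"

definition histogram :: "nat \<Rightarrow> (nat \<Rightarrow> real) \<Rightarrow> real \<Rightarrow> real" where
  "histogram p \<omega> x = real p * (\<Sum>\<mu>=1..p. \<omega> \<mu> * indicator (bin p \<mu>) x)"

(* The linear span of the bin indicators. *)
definition hist_space :: "nat \<Rightarrow> (real \<Rightarrow> real) set" where
  "hist_space p = range (\<lambda>c x. \<Sum>\<mu>=1..p. c \<mu> * indicator (bin p \<mu>) x)"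

(* L2 orthogonal projection. The representative is unique as a function, because elements of
   hist_space are determined pointwise by their coefficients. *)
definition hist_proj :: "nat \<Rightarrow> (real \<Rightarrow> real) \<Rightarrow> real \<Rightarrow> real" where
  "hist_proj p g = (THE h. h \<in> hist_space p \<and> (\<forall>e\<in>hist_space p. inner2 (\<lambda>x. g x - h x) e = 0))"

(* The halves of the k-th dyadic interval of length 2^-j are the bins 2k-1 and 2k among 2^(j+1). *)
definition haar :: "nat \<Rightarrow> nat \<Rightarrow> real \<Rightarrow> real" where
  "haar j k x = 2 powr (real j / 2) *
     (indicator (bin (2 ^ (j + 1)) (2 * k - 1)) x - indicator (bin (2 ^ (j + 1)) (2 * k)) x)"

definition haar_index :: "nat \<Rightarrow> (nat \<times> nat) set" where
  "haar_index J = (SIGMA j:{0..J}. {1..2 ^ j})"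

definition haar_sum :: "nat \<Rightarrow> (nat \<times> nat \<Rightarrow> real) \<Rightarrow> real \<Rightarrow> real" where
  "haar_sum J \<theta> x = (\<Sum>(j, k)\<in>haar_index J. \<theta> (j, k) * haar j k x)"

definition log_normaliser :: "nat \<Rightarrow> (nat \<times> nat \<Rightarrow> real) \<Rightarrow> real" where
  "log_normaliser J \<theta> = ln (LINT x:{0..1}|lborel. exp (haar_sum J \<theta> x))"

definition haar_density :: "nat \<Rightarrow> (nat \<times> nat \<Rightarrow> real) \<Rightarrow> real \<Rightarrow> real" where
  "haar_density J \<theta> x = exp (haar_sum J \<theta> x - log_normaliser J \<theta>)"

(* Priors are measures on the parameter space, given up to a multiplicative constant and not
   necessarily finite; the posterior does not depend on the constant. *)
definition haar_prior :: "nat \<Rightarrow> (nat \<Rightarrow> real) \<Rightarrow> (real \<Rightarrow> real) \<Rightarrow> (nat \<times> nat \<Rightarrow> real) measure" where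
  "haar_prior J \<sigma> H = density (PiM (haar_index J) (\<lambda>_. lborel))
     (\<lambda>\<theta>. ennreal (\<Prod>(j, k)\<in>haar_index J. exp (- H (\<theta> (j, k) / \<sigma> j))))"

(* The Dirichlet prior lives on the first p - 1 bin probabilities; this restores the last one. *)
definition bin_probs :: "nat \<Rightarrow> (nat \<Rightarrow> real) \<Rightarrow> nat \<Rightarrow> real" where
  "bin_probs p w \<mu> = (if \<mu> = p then 1 - (\<Sum>\<nu>=1..<p. w \<nu>) else w \<mu>)"

definition dirichlet_prior :: "nat \<Rightarrow> (nat \<Rightarrow> real) \<Rightarrow> (nat \<Rightarrow> real) measure" where
  "dirichlet_prior p m = density (PiM {1..<p} (\<lambda>_. lborel))
     (\<lambda>w. ennreal (if \<forall>\<mu>\<in>{1..p}. 0 < bin_probs p w \<mu>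
                   then \<Prod>\<mu>=1..p. bin_probs p w \<mu> powr (m \<mu> - 1) else 0))"

definition dirichlet_density :: "nat \<Rightarrow> (nat \<Rightarrow> real) \<Rightarrow> real \<Rightarrow> real" where
  "dirichlet_density p w = histogram p (bin_probs p w)"

(* In the following, R is a prior on the parameter space, F maps parameters to densities on [0,1],
   and X 1, ..., X n are the observations. *)
definition unnorm_posterior ::
    "'t measure \<Rightarrow> ('t \<Rightarrow> real \<Rightarrow> real) \<Rightarrow> nat \<Rightarrow> (nat \<Rightarrow> real) \<Rightarrow> 't measure" where
  "unnorm_posterior R F n X = density R (\<lambda>t. ennreal (\<Prod>i=1..n. F t (X i)))"

definition norm_const ::
    "'t measure \<Rightarrow> ('t \<Rightarrow> real \<Rightarrow> real) \<Rightarrow> nat \<Rightarrow> (nat \<Rightarrow> real) \<Rightarrow> ennreal" where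
  "norm_const R F n X = emeasure (unnorm_posterior R F n X) (space R)"

definition posterior ::
    "'t measure \<Rightarrow> ('t \<Rightarrow> real \<Rightarrow> real) \<Rightarrow> nat \<Rightarrow> (nat \<Rightarrow> real) \<Rightarrow> 't measure" where
  "posterior R F n X = scale_measure (inverse (norm_const R F n X)) (unnorm_posterior R F n X)"

(* Law of Z(f) for f distributed according to the posterior, for fixed data X. *)
definition posterior_law ::
    "'t measure \<Rightarrow> ('t \<Rightarrow> real \<Rightarrow> real) \<Rightarrow> nat \<Rightarrow> (nat \<Rightarrow> real) \<Rightarrow> ((real \<Rightarrow> real) \<Rightarrow> real) \<Rightarrow> real measure"
  where
  "posterior_law R F n X Z = distr (posterior R F n X) borel (\<lambda>t. Z (F t))"

definition sample_law :: "(real \<Rightarrow> real) \<Rightarrow> nat \<Rightarrow> (nat \<Rightarrow> real) measure" where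
  "sample_law f0 n = PiM {1..n} (\<lambda>_. density lborel (\<lambda>x. ennreal (f0 x * indicator {0..1} x)))"

definition empirical :: "nat \<Rightarrow> (nat \<Rightarrow> real) \<Rightarrow> (real \<Rightarrow> real) \<Rightarrow> real" where
  "empirical n X g = (\<Sum>i=1..n. g (X i)) / real n"

definition centring :: "nat \<Rightarrow> (real \<Rightarrow> real) \<Rightarrow> nat \<Rightarrow> (nat \<Rightarrow> real) \<Rightarrow> real" where
  "centring p a n X = empirical n X (hist_proj p a)"

definition asymp_var :: "(real \<Rightarrow> real) \<Rightarrow> (real \<Rightarrow> real) \<Rightarrow> real" where
  "asymp_var f0 a =
     (LINT x:{0..1}|lborel. (a x - (LINT y:{0..1}|lborel. a y * f0 y))\<^sup>2 * f0 x)"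

definition gaussian :: "real \<Rightarrow> real measure" where
  "gaussian v = density lborel (\<lambda>x. ennreal (normal_density 0 (sqrt v) x))"

definition d_BL :: "real measure \<Rightarrow> real measure \<Rightarrow> real" where
  "d_BL \<mu> \<nu> = (SUP h\<in>{h :: real \<Rightarrow> real. (\<forall>x. \<bar>h x\<bar> \<le> 1) \<and> (\<forall>x y. \<bar>h x - h y\<bar> \<le> \<bar>x - y\<bar>)}.
     \<bar>(\<integral>x. h x \<partial>\<mu>) - (\<integral>x. h x \<partial>\<nu>)\<bar>)"

(* Outer measures are used because the measure of a non-measurable set is 0 by convention,
   which would make the bounds below trivially true for non-measurable Y. *)
definition O_prob :: "(nat \<Rightarrow> 'd measure) \<Rightarrow> (nat \<Rightarrow> 'd \<Rightarrow> real) \<Rightarrow> (nat \<Rightarrow> real) \<Rightarrow> bool" where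
  "O_prob P Y r \<longleftrightarrow> (\<forall>\<epsilon>>0. \<exists>C>0. \<forall>\<^sub>F n in sequentially.
     outer_measure_of (P n) {x \<in> space (P n). \<bar>Y n x\<bar> > C * r n} \<le> ennreal \<epsilon>)"

definition o_prob_1 :: "(nat \<Rightarrow> 'd measure) \<Rightarrow> (nat \<Rightarrow> 'd \<Rightarrow> real) \<Rightarrow> bool" where
  "o_prob_1 P Y \<longleftrightarrow> (\<forall>\<delta>>0.
     (\<lambda>n. outer_measure_of (P n) {x \<in> space (P n). \<bar>Y n x\<bar> > \<delta>}) \<longlonglongrightarrow> 0)"

(* The posterior normalising constant is finite with probability tending to one; in particular
   this holds if it is finite for (almost) all data. *)
definition posterior_wd ::
    "(nat \<Rightarrow> (nat \<Rightarrow> real) measure) \<Rightarrow> (nat \<Rightarrow> 't measure) \<Rightarrow> (nat \<Rightarrow> 't \<Rightarrow> real \<Rightarrow> real) \<Rightarrow> bool" where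
  "posterior_wd P R F \<longleftrightarrow>
     (\<lambda>n. outer_measure_of (P n) {X \<in> space (P n). norm_const (R n) (F n) n X = \<infinity>}) \<longlonglongrightarrow> 0"

(* Bounded Lipschitz distance between the posterior law of sqrt n * (\<Phi>_n(f) - centring) and N(0,v). *)
definition BvM_dist ::
    "(nat \<Rightarrow> 't measure) \<Rightarrow> (nat \<Rightarrow> 't \<Rightarrow> real \<Rightarrow> real) \<Rightarrow> (nat \<Rightarrow> (real \<Rightarrow> real) \<Rightarrow> real)
     \<Rightarrow> (nat \<Rightarrow> (nat \<Rightarrow> real) \<Rightarrow> real) \<Rightarrow> real \<Rightarrow> nat \<Rightarrow> (nat \<Rightarrow> real) \<Rightarrow> real" where
  "BvM_dist R F \<Phi> \<Psi> v n X =
     d_BL (posterior_law (R n) (F n) n X (\<lambda>f. sqrt (real n) * (\<Phi> n f - \<Psi> n X))) (gaussian v)"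

definition BvM ::
    "(nat \<Rightarrow> (nat \<Rightarrow> real) measure) \<Rightarrow> (nat \<Rightarrow> 't measure) \<Rightarrow> (nat \<Rightarrow> 't \<Rightarrow> real \<Rightarrow> real)
     \<Rightarrow> (nat \<Rightarrow> (real \<Rightarrow> real) \<Rightarrow> real) \<Rightarrow> (nat \<Rightarrow> (nat \<Rightarrow> real) \<Rightarrow> real) \<Rightarrow> real \<Rightarrow> bool" where
  "BvM P R F \<Phi> \<Psi> v \<longleftrightarrow> o_prob_1 P (BvM_dist R F \<Phi> \<Psi> v)"

definition haar_energy :: "nat \<Rightarrow> (nat \<Rightarrow> real) \<Rightarrow> (real \<Rightarrow> real) \<Rightarrow> real" where
  "haar_energy J \<sigma> a = (\<Sum>j=0..J. 1 / (\<sigma> j)\<^sup>2 * (\<Sum>k=1..2 ^ j. (inner2 (haar j k) a)\<^sup>2))"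

definition haar_functional ::
    "nat \<Rightarrow> (nat \<Rightarrow> real) \<Rightarrow> (real \<Rightarrow> real) \<Rightarrow> (real \<Rightarrow> real) \<Rightarrow> nat \<Rightarrow> (real \<Rightarrow> real) \<Rightarrow> real" where
  "haar_functional J \<sigma> H' a n f = inner2 a f + 1 / real n *
     (\<Sum>j=0..J. 1 / \<sigma> j *
        (\<Sum>k=1..2 ^ j. H' (1 / \<sigma> j * inner2 (haar j k) (\<lambda>x. ln (f x))) * inner2 (haar j k) a))"

definition dirichlet_functional ::
    "nat \<Rightarrow> (nat \<Rightarrow> real) \<Rightarrow> (real \<Rightarrow> real) \<Rightarrow> nat \<Rightarrow> (real \<Rightarrow> real) \<Rightarrow> real" where
  "dirichlet_functional p m a n f = inner2 a f - (\<Sum>\<mu>=1..p. m \<mu>) / real n *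
     inner2 a (\<lambda>x. histogram p (\<lambda>\<mu>. m \<mu> / (\<Sum>\<nu>=1..p. m \<nu>)) x - f x)"

end

theory Submission
  imports Defs
begin

text \<open>
  The statistic \<open>Z\<close> is \<open>- 1 / sqrt n\<close> times the derivative of the log posterior density along the flow
  \<open>f \<mapsto> f e\<^sup>t\<^sup>a / \<integral> f e\<^sup>t\<^sup>a\<close>, which is a translation of \<open>\<theta>\<close> for the Haar series prior and preserves
  \<open>\<Prod> d\<omega>\<^sub>\<mu> / \<omega>\<^sub>\<mu>\<close> on the simplex for the Dirichlet prior. Integration by parts along this flow gives
  \<open>E [Z q(Z)] = E [q'(Z) T]\<close> under the posterior, where \<open>T\<close> is \<open>Var\<^sub>f (\<pi>\<^sub>p a)\<close> up to a small curvature
  term of the prior, so Stein's method bounds the bounded Lipschitz distance by \<open>4 / \<sigma>\<^sup>2 E \<bar>T - \<sigma>\<^sup>2\<bar>\<close>.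
  No posterior contraction theorem is needed for the last expectation: the same identity with
  \<open>q(z) = z\<close>, applied to \<open>\<pi>\<^sub>p a\<close> and to \<open>(\<pi>\<^sub>p a)\<^sup>2\<close>, bounds \<open>E [Z\<^sup>2] = E [T]\<close> and thereby compares the
  posterior moments of these two functions with their empirical moments, which Hoeffding's inequality
  compares with the moments under \<open>f\<^sub>0\<close>.
\<close>

section \<open>Stein's method\<close>

text \<open>The danger is circularity: \<open>T\<close> is a variance under the random density
  \<open>f\<close>, and its closeness to \<sigma>^2 seems to presuppose that the posterior
  concentrates. A deterministic bound \<open>K\<close> on \<open>T\<close> breaks the circle:
  \<open>E[Z^2] = E[T]\<close> is at most \<open>K\<close> before anything is known about
  \<open>f\<close>, so posterior and empirical means of a bounded histogram function differ by a
  prior shift plus a term of order sqrt(K/n). For the Haar prior only \<open>a\<close> comes with an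
  energy hypothesis, the squared projection does not; its shift and curvature are bounded through S,
  the sum of 2^(j/2)/\<sigma>_j, and S \<le> c sqrt(n p ln n) turns both S/n and sqrt((1 + S^2/n)/n)
  into the rate sqrt(p ln n / n). For the Dirichlet prior the shift is of order ||m||_1/n = O(p/n).
  Since the flow moves along the projection of \<open>a\<close>, the centring is its empirical mean
  and carries no bias; p^-(\<gamma> \<and> s) arises only when the variance of the projection under
  \<open>f0\<close> is replaced by that of \<open>a\<close>. The simplex has no translations, so the
  invariance needed there is lifted to the orthant, where the flow is a diagonal scaling.\<close>

lemma abs_integral_le:
  fixes f g :: "'a \<Rightarrow> real"
  assumes "integrable M f" "integrable M g" "\<And>x. x \<in> space M \<Longrightarrow> \<bar>f x\<bar> \<le> g x"
  shows "\<bar>\<integral>x. f x \<partial>M\<bar> \<le> (\<integral>x. g x \<partial>M)"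
proof -
  have "\<bar>\<integral>x. f x \<partial>M\<bar> \<le> (\<integral>x. \<bar>f x\<bar> \<partial>M)"
    using integral_norm_bound [of M f] by simp
  also have "\<dots> \<le> (\<integral>x. g x \<partial>M)"
    using assms by (intro integral_mono) auto
  finally show ?thesis .
qed

section \<open>Gaussian tails and the Stein equation\<close>

lemma DERIV_normal_density:
  assumes "v > 0"
  shows "(normal_density 0 (sqrt v) has_real_derivative (- (x / v) * normal_density 0 (sqrt v) x)) (at x)"
proof -
  have "((\<lambda>x. 1 / sqrt (2 * pi * v) * exp (- (x - 0)\<^sup>2 / (2 * v)))
      has_real_derivative (1 / sqrt (2 * pi * v) * (exp (- (x - 0)\<^sup>2 / (2 * v)) * (- (x / v))))) (at x)"
    by (rule derivative_eq_intros refl | use assms in \<open>simp add: field_simps\<close>)+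
  then show ?thesis
    using assms by (simp add: normal_density_def [abs_def] mult_ac)
qed

lemma normal_density_tendsto_0:
  assumes "v > 0"
  shows "(normal_density 0 (sqrt v) \<longlongrightarrow> 0) at_top"
proof -
  have "((\<lambda>x::real. 1 / sqrt (2 * pi * v) * exp (- (x - 0)\<^sup>2 / (2 * v))) \<longlongrightarrow> 0) at_top"
    using assms by real_asymp
  then show ?thesis
    using assms by (simp add: normal_density_def [abs_def])
qed

text \<open>On the half-line the factor \<open>y / x\<close> is at least 1, and \<open>y\<close>
  times the density has the primitive \<open>- v\<close> times the density. This is the classical
  Mills ratio bound.\<close>

lemma normal_tail_le:
  assumes v: "v > 0" and x: "x > 0"
  shows "(\<integral>y. indicator {x..} y * normal_density 0 (sqrt v) y \<partial>lborel)
           \<le> v * normal_density 0 (sqrt v) x / x"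
proof -
  let ?\<phi> = "normal_density 0 (sqrt v)"
  have int: "integrable lborel ?\<phi>"
    using v by (simp add: integrable_normal_density)
  have "(\<integral>\<^sup>+y. ennreal (y * ?\<phi> y) * indicator {x..} y \<partial>lborel) = ennreal (0 - (- v * ?\<phi> x))"
  proof (rule nn_integral_FTC_atLeast)
    show "((\<lambda>y. - v * ?\<phi> y) has_real_derivative y * ?\<phi> y) (at y)" for y
      using DERIV_cmult [OF DERIV_normal_density [OF v], of "- v" y] v by simp
    show "((\<lambda>y. - v * ?\<phi> y) \<longlongrightarrow> 0) at_top"
      using tendsto_mult [OF tendsto_const normal_density_tendsto_0 [OF v], of "- v"] by simp
  qed (use x in auto)
  moreover have "(\<integral>\<^sup>+y. ennreal (indicator {x..} y * ?\<phi> y) \<partial>lborel)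
      \<le> (\<integral>\<^sup>+y. ennreal (1 / x) * (ennreal (y * ?\<phi> y) * indicator {x..} y) \<partial>lborel)"
    using x by (intro nn_integral_mono) (auto split: split_indicator simp flip: ennreal_mult'
        intro!: ennreal_leI simp: field_simps mult_right_mono)
  ultimately have "(\<integral>\<^sup>+y. ennreal (indicator {x..} y * ?\<phi> y) \<partial>lborel) \<le> ennreal (v * ?\<phi> x / x)"
    using x v by (simp add: nn_integral_cmult flip: ennreal_mult')
  moreover have "integrable lborel (\<lambda>y. indicator {x..} y * ?\<phi> y)"
    using integrable_mult_indicator [OF _ int, of "{x..}"] by simp
  ultimately show ?thesis
    using x v by (subst (asm) nn_integral_eq_integral) (auto simp: ennreal_le_iff)
qed

lemma normal_lower_tail_le:
  assumes v: "v > 0" and x: "x < 0"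
  shows "(\<integral>y. indicator {..x} y * normal_density 0 (sqrt v) y \<partial>lborel)
           \<le> v * normal_density 0 (sqrt v) x / (- x)"
proof -
  let ?\<phi> = "normal_density 0 (sqrt v)"
  have sym: "?\<phi> (- y) = ?\<phi> y" for y
    by (simp add: normal_density_def)
  have "(\<integral>y. indicator {..x} y * ?\<phi> y \<partial>lborel) = (\<integral>y. indicator {..x} (- y) * ?\<phi> (- y) \<partial>lborel)"
    using lborel_integral_real_affine [of "- 1" "\<lambda>y. indicator {..x} y * ?\<phi> y" 0] by simp
  also have "\<dots> = (\<integral>y. indicator {- x..} y * ?\<phi> y \<partial>lborel)"
    by (intro Bochner_Integration.integral_cong) (auto simp: sym split: split_indicator)
  also have "\<dots> \<le> v * ?\<phi> x / (- x)"
    using normal_tail_le [OF v, of "- x"] x by (simp add: sym)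
  finally show ?thesis .
qed

text \<open>The fundamental theorem lives on compact intervals, so the half-line integral is split
  at a fixed point \<open>- R\<close> left of \<open>x\<close>. The second claim lets the Stein
  solution be estimated by whichever tail is convenient.\<close>

lemma integral_lborel_tails:
  fixes f :: "real \<Rightarrow> real"
  assumes cont: "continuous_on UNIV f" and int: "integrable lborel f"
  defines "I \<equiv> \<lambda>x. (\<integral>y. indicator {..x} y * f y \<partial>lborel)"
  shows "(I has_real_derivative f x) (at x)"
    and "I x + (\<integral>y. indicator {x..} y * f y \<partial>lborel) = (\<integral>y. f y \<partial>lborel)"
proof -
  have int': "integrable lborel (\<lambda>y. indicator A y * f y)" if "A \<in> sets borel" for A
    using integrable_mult_indicator [OF _ int, of A] that by simp
  \<comment> \<open>The added 1 puts \<open>x\<close> into the interior of \<open>{- R..R}\<close>,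
    where the derivative within the interval is the full derivative.\<close>
  define R where "R = \<bar>x\<bar> + 1"
  have split: "I y = I (- R) + integral {- R..y} f" if "- R \<le> y" for y
  proof -
    have AE: "AE z in lborel. z \<noteq> - R"
      by (rule AE_lborel_singleton)
    have "I y = (\<integral>z. indicator {..- R} z * f z + indicator {- R..y} z * f z \<partial>lborel)"
      unfolding I_def using AE that
      by (intro integral_cong_AE) (use int in \<open>auto split: split_indicator\<close>)
    also have "\<dots> = I (- R) + (\<integral>z. indicator {- R..y} z * f z \<partial>lborel)"
      unfolding I_def by (intro Bochner_Integration.integral_add int') auto
    also have "(\<integral>z. indicator {- R..y} z * f z \<partial>lborel) = integral {- R..y} f"
      using set_borel_integral_eq_integral(2) [of "{- R..y}" f] int' [of "{- R..y}"]
      by (simp add: set_integrable_def set_lebesgue_integral_def)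
    finally show ?thesis .
  qed
  have "((\<lambda>u. integral {- R..u} f) has_vector_derivative f x) (at x within {- R..R})"
    by (rule integral_has_vector_derivative) (use cont in \<open>auto simp: R_def intro: continuous_on_subset\<close>)
  then have "((\<lambda>u. integral {- R..u} f) has_real_derivative f x) (at x within {- R..R})"
    by (simp add: has_real_derivative_iff_has_vector_derivative)
  moreover have "at x within {- R..R} = at x"
    by (rule at_within_interior) (auto simp: R_def)
  ultimately have "((\<lambda>u. I (- R) + integral {- R..u} f) has_real_derivative f x) (at x)"
    by (auto intro!: derivative_eq_intros)
  moreover have "\<forall>\<^sub>F u in nhds x. I (- R) + integral {- R..u} f = I u"
  proof (rule eventually_mono [OF eventually_nhds_in_open [of "{- R<..}" x]])
    show "I (- R) + integral {- R..u} f = I u" if "u \<in> {- R<..}" for u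
      using split [of u] that by simp
  qed (auto simp: R_def)
  ultimately show "(I has_real_derivative f x) (at x)"
    using DERIV_cong_ev [of x x "\<lambda>u. I (- R) + integral {- R..u} f" I "f x" "f x"] by simp
  have AE: "AE z in lborel. z \<noteq> x"
    by (rule AE_lborel_singleton)
  have "I x + (\<integral>y. indicator {x..} y * f y \<partial>lborel)
      = (\<integral>y. indicator {..x} y * f y + indicator {x..} y * f y \<partial>lborel)"
    unfolding I_def by (intro Bochner_Integration.integral_add [symmetric] int') auto
  also have "\<dots> = (\<integral>y. f y \<partial>lborel)"
    using AE by (intro integral_cong_AE) (use int in \<open>auto split: split_indicator\<close>)
  finally show "I x + (\<integral>y. indicator {x..} y * f y \<partial>lborel) = (\<integral>y. f y \<partial>lborel)" .
qed

lemma integral_gaussian: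
  assumes "f \<in> borel_measurable borel"
  shows "(\<integral>x. f x \<partial>gaussian v) = (\<integral>x. f x * normal_density 0 (sqrt v) x \<partial>lborel)"
  unfolding gaussian_def using assms
  by (subst integral_density) (auto simp: mult.commute)

text \<open>The Gaussian density is the integrating factor of this linear equation, which gives the
  solution \<open>I x / (v * \<phi> x)\<close> with \<open>I\<close> the lower partial integral of
  the centred test function against \<open>\<phi>\<close>. The constant 4 is 2 + 2: both
  \<open>k\<close> and \<open>x * q x\<close> are bounded by 2.\<close>

lemma stein_equation:
  fixes h :: "real \<Rightarrow> real"
  assumes v: "v > 0" and h: "continuous_on UNIV h" "\<And>x. \<bar>h x\<bar> \<le> 1"
  obtains q q' where
    "\<And>x. (q has_real_derivative q' x) (at x)" "continuous_on UNIV q'" "\<And>x. \<bar>q' x\<bar> \<le> 4 / v"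
    "\<And>x. v * q' x - x * q x = h x - (\<integral>y. h y \<partial>gaussian v)"
proof -
  define \<phi> where "\<phi> = normal_density 0 (sqrt v)"
  define c where "c = (\<integral>y. h y \<partial>gaussian v)"
  have [measurable]: "h \<in> borel_measurable borel" "\<phi> \<in> borel_measurable borel"
    using h(1) borel_measurable_continuous_onI by (auto simp: \<phi>_def)
  have \<phi>_pos: "\<phi> x > 0" for x
    using v by (simp add: \<phi>_def normal_density_pos)
  have \<phi>_cont: "continuous_on UNIV \<phi>"
    unfolding \<phi>_def using DERIV_normal_density [OF v]
    by (meson DERIV_isCont continuous_at_imp_continuous_on)
  have \<phi>_int: "integrable lborel \<phi>"
    using v by (simp add: \<phi>_def integrable_normal_density)
  have \<phi>_1: "(\<integral>y. \<phi> y \<partial>lborel) = 1"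
    using v by (simp add: \<phi>_def integral_normal_density)
  have h_int: "integrable lborel (\<lambda>y. h y * \<phi> y)"
    by (rule Bochner_Integration.integrable_bound [OF \<phi>_int])
       (use h(2) \<phi>_pos in \<open>auto simp: abs_mult less_imp_le mult_left_le_one_le\<close>)
  have c: "c = (\<integral>y. h y * \<phi> y \<partial>lborel)"
    by (simp add: c_def integral_gaussian \<phi>_def)
  have "\<bar>c\<bar> \<le> (\<integral>y. \<phi> y \<partial>lborel)"
    unfolding c by (rule abs_integral_le [OF h_int \<phi>_int])
       (use h(2) \<phi>_pos in \<open>auto simp: abs_mult less_imp_le mult_left_le_one_le\<close>)
  then have c_le: "\<bar>c\<bar> \<le> 1"
    by (simp add: \<phi>_1)
  define k where "k = (\<lambda>y. h y - c)"
  have k_le: "\<bar>k y\<bar> \<le> 2" for y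
    using h(2) [of y] c_le by (simp add: k_def)
  have k_cont: "continuous_on UNIV k"
    unfolding k_def by (intro continuous_intros h)
  have k_int: "integrable lborel (\<lambda>y. k y * \<phi> y)"
    using h_int \<phi>_int by (simp add: k_def left_diff_distrib)
  have k_0: "(\<integral>y. k y * \<phi> y \<partial>lborel) = 0"
    using h_int \<phi>_int \<phi>_1 c by (simp add: k_def left_diff_distrib)
  define I where "I = (\<lambda>x. \<integral>y. indicator {..x} y * (k y * \<phi> y) \<partial>lborel)"
  note tails = integral_lborel_tails [OF continuous_on_mult [OF k_cont \<phi>_cont] k_int, folded I_def]
  have tail_le: "\<bar>\<integral>y. indicator A y * (k y * \<phi> y) \<partial>lborel\<bar> \<le> 2 * (\<integral>y. indicator A y * \<phi> y \<partial>lborel)"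
    if [measurable]: "A \<in> sets borel" for A
  proof -
    have "\<bar>\<integral>y. indicator A y * (k y * \<phi> y) \<partial>lborel\<bar> \<le> (\<integral>y. 2 * (indicator A y * \<phi> y) \<partial>lborel)"
    proof (rule abs_integral_le)
      show "integrable lborel (\<lambda>y. indicator A y * (k y * \<phi> y))"
        using integrable_mult_indicator [OF _ k_int, of A] by simp
      show "integrable lborel (\<lambda>y. 2 * (indicator A y * \<phi> y))"
        using integrable_mult_indicator [OF _ \<phi>_int, of A] by simp
      show "\<bar>indicator A y * (k y * \<phi> y)\<bar> \<le> 2 * (indicator A y * \<phi> y)" for y
        using k_le [of y] \<phi>_pos [of y] by (auto simp: abs_mult split: split_indicator)
    qed
    then show ?thesis by simp
  qed
  \<comment> \<open>The Mills bound fits the tail that avoids 0. For positive \<open>x\<close> the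
    lower integral is minus the upper one, because \<open>k\<close> has Gaussian mean zero.\<close>
  have xI: "\<bar>x * I x\<bar> \<le> 2 * v * \<phi> x" for x
  proof (cases x "0::real" rule: linorder_cases)
    case less
    have "\<bar>I x\<bar> \<le> 2 * (v * \<phi> x / (- x))"
      using tail_le [of "{..x}"] normal_lower_tail_le [OF v less] by (simp add: I_def \<phi>_def)
    then show ?thesis
      using less by (simp add: abs_mult field_simps)
  next
    case equal
    then show ?thesis using v \<phi>_pos [of x] by simp
  next
    case greater
    have "\<bar>I x\<bar> \<le> 2 * (v * \<phi> x / x)"
      using tail_le [of "{x..}"] normal_tail_le [OF v greater] tails(2) [of x] k_0
      by (simp add: \<phi>_def I_def)
    then show ?thesis
      using greater by (simp add: abs_mult field_simps)
  qed
  define q where "q = (\<lambda>x. I x / (v * \<phi> x))"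
  \<comment> \<open>Read off from the equation instead of the quotient rule, so that continuity and
    the bound are immediate.\<close>
  define q' where "q' = (\<lambda>x. (x * q x + k x) / v)"
  have q_deriv: "(q has_real_derivative q' x) (at x)" for x
  proof -
    have "(q has_real_derivative ((k x * \<phi> x) * (v * \<phi> x) - I x * (v * (- (x / v) * \<phi> x))) / ((v * \<phi> x) * (v * \<phi> x))) (at x)"
      unfolding q_def using DERIV_normal_density [OF v, folded \<phi>_def] \<phi>_pos [of x] v
      by (intro DERIV_divide tails(1) DERIV_cmult) auto
    also have "((k x * \<phi> x) * (v * \<phi> x) - I x * (v * (- (x / v) * \<phi> x))) / ((v * \<phi> x) * (v * \<phi> x)) = q' x"
      using \<phi>_pos [of x] v by (simp add: q'_def q_def field_simps)
    finally show ?thesis .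
  qed
  have "continuous_on UNIV q"
    using q_deriv DERIV_isCont continuous_at_imp_continuous_on by blast
  then have "continuous_on UNIV q'"
    unfolding q'_def using v k_cont by (intro continuous_intros) auto
  moreover have "\<bar>q' x\<bar> \<le> 4 / v" for x
  proof -
    have "\<bar>x * q x\<bar> \<le> 2"
      using xI [of x] v \<phi>_pos [of x] by (simp add: q_def abs_mult field_simps)
    then have "\<bar>x * q x + k x\<bar> \<le> 4"
      using k_le [of x] by simp
    then show ?thesis
      using v by (simp add: q'_def abs_divide divide_right_mono)
  qed
  moreover have "v * q' x - x * q x = h x - c" for x
    using v by (simp add: q'_def k_def)
  ultimately show ?thesis
    using that q_deriv unfolding c_def by blast
qed

text \<open>
  The identity that characterises a centred normal variable \<open>Z\<close> of variance \<open>T\<close>, here with a random \<open>T\<close>.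
\<close>

definition stein_pair :: "'a measure \<Rightarrow> ('a \<Rightarrow> real) \<Rightarrow> ('a \<Rightarrow> real) \<Rightarrow> bool" where
  "stein_pair M Z T \<longleftrightarrow> Z \<in> borel_measurable M \<and> T \<in> borel_measurable M
     \<and> (\<exists>K. AE x in M. \<bar>Z x\<bar> \<le> K \<and> \<bar>T x\<bar> \<le> K)
     \<and> (\<forall>q q'. (\<forall>x. (q has_real_derivative q' x) (at x)) \<longrightarrow> continuous_on UNIV q' \<longrightarrow>
          (\<integral>x. q (Z x) * Z x \<partial>M) = (\<integral>x. q' (Z x) * T x \<partial>M))"

lemma (in prob_space) integrable_AE_bounded:
  fixes f :: "'a \<Rightarrow> real"
  assumes "f \<in> borel_measurable M" "AE x in M. \<bar>f x\<bar> \<le> K"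
  shows "integrable M f"
  by (rule integrable_const_bound [where B = K]) (use assms in auto)

lemma (in prob_space) stein_pair_integrable:
  assumes "stein_pair M Z T"
  shows "integrable M Z" "integrable M T" "integrable M (\<lambda>x. \<bar>T x - v\<bar>)" "integrable M (\<lambda>x. (Z x)\<^sup>2)"
proof -
  from assms obtain K where meas [measurable]: "Z \<in> borel_measurable M" "T \<in> borel_measurable M"
    and K: "AE x in M. \<bar>Z x\<bar> \<le> K \<and> \<bar>T x\<bar> \<le> K"
    unfolding stein_pair_def by blast
  show "integrable M Z" "integrable M T"
    using K by (auto intro!: integrable_AE_bounded [where K = K])
  then show "integrable M (\<lambda>x. \<bar>T x - v\<bar>)" by simp
  have "AE x in M. \<bar>(Z x)\<^sup>2\<bar> \<le> K\<^sup>2"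
    using K by eventually_elim (auto simp: abs_le_square_iff [symmetric])
  then show "integrable M (\<lambda>x. (Z x)\<^sup>2)"
    by (intro integrable_AE_bounded [where K = "K\<^sup>2"]) auto
qed

text \<open>The test function is \<open>q z = z\<close>; it is admissible although unbounded because
  \<open>Z\<close> is almost surely bounded.\<close>

lemma (in prob_space) stein_pair_second_moment:
  assumes "stein_pair M Z T"
  shows "expectation (\<lambda>x. (Z x)\<^sup>2) = expectation T"
proof -
  have "expectation (\<lambda>x. id (Z x) * Z x) = expectation (\<lambda>x. 1 * T x)"
    using assms unfolding stein_pair_def
    by (elim conjE allE [where x = id] allE [where x = "\<lambda>_. 1"] impE)
       (auto intro!: derivative_eq_intros simp: id_def)
  then show ?thesis by (simp add: power2_eq_square)
qed

section \<open>From Stein identities to the bounded Lipschitz distance\<close>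

lemma BL_test_continuous:
  fixes h :: "real \<Rightarrow> real"
  assumes "\<forall>x y. \<bar>h x - h y\<bar> \<le> \<bar>x - y\<bar>"
  shows "continuous_on UNIV h"
  using assms by (auto simp: continuous_on_iff dist_real_def intro!: exI)
    (metis le_less_trans)

lemma (in prob_space) abs_integral_le_1:
  fixes h :: "'a \<Rightarrow> real"
  assumes "\<And>x. \<bar>h x\<bar> \<le> 1"
  shows "\<bar>\<integral>x. h x \<partial>M\<bar> \<le> 1"
proof (cases "integrable M h")
  case True
  then have "\<bar>\<integral>x. h x \<partial>M\<bar> \<le> (\<integral>x. 1 \<partial>M)"
    by (rule abs_integral_le) (use assms in auto)
  then show ?thesis by (simp add: prob_space)
qed (simp add: not_integrable_integral_eq)

text \<open>A supremum of reals is meaningful only over a bounded set; here 2 is a bound, and the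
  zero test function supplies the lower estimate. It is needed because the stochastic orders are
  stated for absolute values.\<close>

lemma d_BL_nonneg:
  assumes "prob_space M" "prob_space N"
  shows "0 \<le> d_BL M N"
proof -
  have "\<bar>(\<integral>x. h x \<partial>M) - (\<integral>x. h x \<partial>N)\<bar> \<le> 2" if "\<forall>x. \<bar>h x\<bar> \<le> 1" for h :: "real \<Rightarrow> real"
    using prob_space.abs_integral_le_1 [OF assms(1), of h] prob_space.abs_integral_le_1 [OF assms(2), of h]
      that by force
  then have "bdd_above ((\<lambda>h. \<bar>(\<integral>x. h x \<partial>M) - (\<integral>x. h x \<partial>N)\<bar>) `
      {h :: real \<Rightarrow> real. (\<forall>x. \<bar>h x\<bar> \<le> 1) \<and> (\<forall>x y. \<bar>h x - h y\<bar> \<le> \<bar>x - y\<bar>)})"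
    by (intro bdd_aboveI [where M = 2]) auto
  then have "\<bar>(\<integral>x. 0 \<partial>M) - (\<integral>x. 0 \<partial>N)\<bar> \<le> d_BL M N"
    unfolding d_BL_def by (rule cSUP_upper2 [where x = "\<lambda>_. 0"]) auto
  then show ?thesis by simp
qed

text \<open>Inserting the Stein solution turns the difference of the two expectations of a test
  function into the expectation of \<open>(v - T x) * q' (Z x)\<close>, and \<open>q'\<close> is at
  most \<open>4 / v\<close> in absolute value.\<close>

lemma (in prob_space) d_BL_stein_pair:
  assumes SP: "stein_pair M Z T" and v: "v > 0"
  shows "\<bar>d_BL (distr M borel Z) (gaussian v)\<bar> \<le> 4 / v * expectation (\<lambda>x. \<bar>T x - v\<bar>)"
proof -
  from SP obtain K where [measurable]: "Z \<in> borel_measurable M" "T \<in> borel_measurable M"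
    and K: "AE x in M. \<bar>Z x\<bar> \<le> K \<and> \<bar>T x\<bar> \<le> K"
    unfolding stein_pair_def by blast
  have "\<bar>(\<integral>x. h x \<partial>distr M borel Z) - (\<integral>x. h x \<partial>gaussian v)\<bar> \<le> 4 / v * expectation (\<lambda>x. \<bar>T x - v\<bar>)"
    if h: "\<forall>x. \<bar>h x\<bar> \<le> 1" "\<forall>x y. \<bar>h x - h y\<bar> \<le> \<bar>x - y\<bar>" for h :: "real \<Rightarrow> real"
  proof -
    have cont: "continuous_on UNIV h"
      by (rule BL_test_continuous [OF h(2)])
    then have [measurable]: "h \<in> borel_measurable borel"
      by (rule borel_measurable_continuous_onI)
    obtain q q' where q: "\<And>x. (q has_real_derivative q' x) (at x)" "continuous_on UNIV q'"
      "\<And>x. \<bar>q' x\<bar> \<le> 4 / v" "\<And>x. v * q' x - x * q x = h x - (\<integral>y. h y \<partial>gaussian v)"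
      using stein_equation [OF v cont] h(1) by metis
    have [measurable]: "q' \<in> borel_measurable borel"
      using q(2) by (rule borel_measurable_continuous_onI)
    have int_h: "integrable M (\<lambda>x. h (Z x))"
      using h(1) by (intro integrable_AE_bounded [where K = 1]) auto
    have int_q': "integrable M (\<lambda>x. q' (Z x))"
      using q(3) by (intro integrable_AE_bounded [where K = "4 / v"]) auto
    have int_T: "integrable M (\<lambda>x. q' (Z x) * T x)"
    proof (intro integrable_AE_bounded)
      show "AE x in M. \<bar>q' (Z x) * T x\<bar> \<le> 4 / v * K"
        using K
      proof eventually_elim
        case (elim x)
        then have "\<bar>q' (Z x)\<bar> * \<bar>T x\<bar> \<le> 4 / v * K"
          by (intro mult_mono q(3)) (use v in auto)
        then show ?case by (simp add: abs_mult)
      qed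
    qed measurable
    have "expectation (\<lambda>x. q (Z x) * Z x) = expectation (\<lambda>x. q' (Z x) * T x)"
      using SP q unfolding stein_pair_def by blast
    moreover have "q (Z x) * Z x = v * q' (Z x) - (h (Z x) - (\<integral>y. h y \<partial>gaussian v))" for x
      using q(4) [of "Z x"] by (simp add: algebra_simps)
    ultimately have "expectation (\<lambda>x. v * q' (Z x) - (h (Z x) - (\<integral>y. h y \<partial>gaussian v)))
        = expectation (\<lambda>x. q' (Z x) * T x)"
      by simp
    then have "expectation (\<lambda>x. h (Z x)) - (\<integral>y. h y \<partial>gaussian v) = expectation (\<lambda>x. v * q' (Z x) - q' (Z x) * T x)"
      using int_h int_q' int_T by (simp add: prob_space)
    also have "\<bar>\<dots>\<bar> \<le> expectation (\<lambda>x. 4 / v * \<bar>T x - v\<bar>)"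
    proof (rule abs_integral_le)
      show "\<bar>v * q' (Z x) - q' (Z x) * T x\<bar> \<le> 4 / v * \<bar>T x - v\<bar>" for x
        using mult_right_mono [OF q(3) [of "Z x"], of "\<bar>T x - v\<bar>"]
        by (simp add: abs_mult [symmetric] algebra_simps abs_minus_commute)
    qed (use int_q' int_T stein_pair_integrable [OF SP] in auto)
    finally show ?thesis
      by (simp add: integral_distr)
  qed
  then have "d_BL (distr M borel Z) (gaussian v) \<le> 4 / v * expectation (\<lambda>x. \<bar>T x - v\<bar>)"
    unfolding d_BL_def by (intro cSUP_least) (auto intro: exI [of _ "\<lambda>_. 0"])
  moreover have "prob_space (gaussian v)"
    unfolding gaussian_def using v by (intro prob_space_normal_density) simp
  then have "0 \<le> d_BL (distr M borel Z) (gaussian v)"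
    by (intro d_BL_nonneg prob_space_distr) auto
  ultimately show ?thesis by simp
qed

text \<open>The weight \<open>exp (L t x)\<close> compensates the displacement by
  \<open>\<phi> t\<close>, so the expectation of \<open>q (Z (\<phi> t x)) * exp (L t x)\<close>
  does not depend on \<open>t\<close>. Its derivative at 0 is \<open>r\<close> times the expectation
  of \<open>q' (Z x) * T x - q (Z x) * Z x\<close>. The bound \<open>K\<close> justifies
  differentiation under the integral, and \<open>S\<close> is an invariant set of full measure on
  which the derivative formulas hold.\<close>

lemma (in prob_space) stein_pair_from_flow:
  fixes Z T :: "'a \<Rightarrow> real" and L :: "real \<Rightarrow> 'a \<Rightarrow> real" and \<phi> :: "real \<Rightarrow> 'a \<Rightarrow> 'a"
  assumes Z [measurable]: "Z \<in> borel_measurable M"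
    and \<phi> [measurable]: "\<And>t. \<phi> t \<in> measurable M M" and L [measurable]: "\<And>t. L t \<in> borel_measurable M"
    and r: "r > 0"
    and inv: "\<And>t. distr (density M (\<lambda>x. ennreal (exp (L t x)))) M (\<phi> t) = M"
    and S: "S \<in> sets M" "AE x in M. x \<in> S"
    and \<phi>_S: "\<And>t x. x \<in> S \<Longrightarrow> \<phi> t x \<in> S"
    and \<phi>_0: "\<And>x. x \<in> S \<Longrightarrow> \<phi> 0 x = x" and L_0: "\<And>x. x \<in> S \<Longrightarrow> L 0 x = 0"
    and dZ: "\<And>t x. x \<in> S \<Longrightarrow> ((\<lambda>t. Z (\<phi> t x)) has_real_derivative r * T (\<phi> t x)) (at t)"
    and dL: "\<And>t x. x \<in> S \<Longrightarrow> ((\<lambda>t. L t x) has_real_derivative - r * Z (\<phi> t x)) (at t)"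
    and bound: "\<And>x. x \<in> S \<Longrightarrow> \<bar>Z x\<bar> \<le> K \<and> \<bar>T x\<bar> \<le> K"
    and T: "T \<in> borel_measurable M"
  shows "stein_pair M Z T"
  unfolding stein_pair_def
proof (intro conjI allI impI)
  note T [measurable]
  show "Z \<in> borel_measurable M" "T \<in> borel_measurable M" by fact+
  show "\<exists>K. AE x in M. \<bar>Z x\<bar> \<le> K \<and> \<bar>T x\<bar> \<le> K"
    using S(2) bound by (intro exI [of _ K]) auto
  fix q q' :: "real \<Rightarrow> real"
  assume q: "\<forall>x. (q has_real_derivative q' x) (at x)" and q': "continuous_on UNIV q'"
  have q_cont: "continuous_on UNIV q"
    using q DERIV_isCont continuous_at_imp_continuous_on by blast
  have [measurable]: "q \<in> borel_measurable borel" "q' \<in> borel_measurable borel"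
    using q_cont q' by (auto intro: borel_measurable_continuous_onI)
  have K0: "0 \<le> K"
  proof -
    have "S \<noteq> {}"
      using S(2) by (metis AE_False empty_iff eventually_mono)
    then show ?thesis using bound by fastforce
  qed
  have "bounded (q ` {- K..K})" "bounded (q' ` {- K..K})"
    using q_cont q' by (auto intro!: compact_imp_bounded compact_continuous_image intro: continuous_on_subset)
  then obtain B1 B2 where "\<forall>z\<in>{- K..K}. \<bar>q z\<bar> \<le> B1" "\<forall>z\<in>{- K..K}. \<bar>q' z\<bar> \<le> B2"
    unfolding bounded_iff by auto
  then obtain B where B: "\<And>z. \<bar>z\<bar> \<le> K \<Longrightarrow> \<bar>q z\<bar> \<le> B" "\<And>z. \<bar>z\<bar> \<le> K \<Longrightarrow> \<bar>q' z\<bar> \<le> B"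
    by (intro that [of "max B1 B2"]) (auto simp: abs_le_iff le_max_iff_disj)
  have B0: "0 \<le> B"
    using B(1) [of 0] K0 by simp
  define u where "u = (\<lambda>t x. q (Z (\<phi> t x)) * exp (L t x))"
  define du where "du = (\<lambda>t x. (q' (Z (\<phi> t x)) * (r * T (\<phi> t x)) - q (Z (\<phi> t x)) * (r * Z (\<phi> t x))) * exp (L t x))"
  have [measurable]: "u t \<in> borel_measurable M" for t
    unfolding u_def by measurable
  have u_deriv: "((\<lambda>t. u t x) has_real_derivative du t x) (at t)" if "x \<in> S" for t x
  proof -
    have "((\<lambda>t. q (Z (\<phi> t x))) has_real_derivative q' (Z (\<phi> t x)) * (r * T (\<phi> t x))) (at t)"
      using DERIV_chain2 [OF _ dZ [OF that]] q by blast
    then have "((\<lambda>t. q (Z (\<phi> t x)) * exp (L t x)) has_real_derivative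
        q' (Z (\<phi> t x)) * (r * T (\<phi> t x)) * exp (L t x) + exp (L t x) * (- r * Z (\<phi> t x)) * q (Z (\<phi> t x))) (at t)"
      by (intro DERIV_mult DERIV_fun_exp [OF dL [OF that]])
    moreover have "q' (Z (\<phi> t x)) * (r * T (\<phi> t x)) * exp (L t x) + exp (L t x) * (- r * Z (\<phi> t x)) * q (Z (\<phi> t x)) = du t x"
      by (simp add: du_def algebra_simps)
    ultimately show ?thesis
      by (simp add: u_def)
  qed
  \<comment> \<open>For \<open>0 \<le> t \<le> 1\<close> each of the two terms in \<open>du\<close>
    is at most \<open>B * (r * K)\<close>, and \<open>L\<close> starts at 0 with slope at most
    \<open>r * K\<close>, so the exponential factor is at most \<open>exp (r * K)\<close>.\<close>
  define C where "C = 2 * (B * (r * K)) * exp (r * K)"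
  have L_le: "\<bar>L t x\<bar> \<le> r * K" if "x \<in> S" "0 \<le> t" "t \<le> 1" for t x
  proof (cases "t = 0")
    case False
    then have "0 < t" using that by simp
    with MVT2 [of 0 t "\<lambda>t. L t x" "\<lambda>t. - r * Z (\<phi> t x)"] dL [OF that(1)]
    obtain z where "L t x - L 0 x = (t - 0) * (- r * Z (\<phi> z x))"
      by blast
    then have "L t x = t * (- r * Z (\<phi> z x))"
      using L_0 [OF that(1)] by simp
    then have "\<bar>L t x\<bar> = t * r * \<bar>Z (\<phi> z x)\<bar>"
      using that r by (simp add: abs_mult)
    also have "\<dots> \<le> 1 * r * K"
      using bound [OF \<phi>_S [OF that(1)], of z] that r by (intro mult_mono) auto
    finally show ?thesis by simp
  qed (use L_0 that r K0 in auto)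
  have du_le: "\<bar>du t x\<bar> \<le> C" if "x \<in> S" "0 \<le> t" "t \<le> 1" for t x
  proof -
    have b: "\<bar>Z (\<phi> t x)\<bar> \<le> K" "\<bar>T (\<phi> t x)\<bar> \<le> K"
      using bound [OF \<phi>_S [OF that(1)]] by auto
    have "\<bar>q' (Z (\<phi> t x)) * (r * T (\<phi> t x))\<bar> \<le> B * (r * K)"
      "\<bar>q (Z (\<phi> t x)) * (r * Z (\<phi> t x))\<bar> \<le> B * (r * K)"
      using b B r B0 K0 by (auto simp: abs_mult intro!: mult_mono)
    then have "\<bar>q' (Z (\<phi> t x)) * (r * T (\<phi> t x)) - q (Z (\<phi> t x)) * (r * Z (\<phi> t x))\<bar> \<le> 2 * (B * (r * K))"
      by linarith
    then show ?thesis
      using L_le [OF that] B0 K0 r unfolding du_def C_def abs_mult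
      by (intro mult_mono) auto
  qed
  have u_le: "\<bar>u t x - u 0 x\<bar> \<le> C * t" if x: "x \<in> S" and t: "0 < t" "t \<le> 1" for t x
  proof -
    obtain z where "0 < z" "z < t" "u t x - u 0 x = (t - 0) * du z x"
      using MVT2 [of 0 t "\<lambda>t. u t x" "\<lambda>t. du t x"] u_deriv [OF x] t by auto
    then show ?thesis
      using du_le [OF x, of z] t by (auto simp: abs_mult mult.commute intro: mult_left_mono)
  qed
  have u0: "u 0 x = q (Z x)" if "x \<in> S" for x
    using that by (simp add: u_def \<phi>_0 L_0)
  have int_u0: "integrable M (u 0)"
    using S(2) by (intro integrable_AE_bounded [where K = B]) (auto simp: u0 B(1) bound elim!: eventually_mono)
  have int_u: "integrable M (u t)" if "0 < t" "t \<le> 1" for t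
  proof (intro integrable_AE_bounded)
    show "AE x in M. \<bar>u t x\<bar> \<le> B + C * t"
      using S(2)
    proof eventually_elim
      case (elim x)
      then show ?case
        using u_le [OF elim that] u0 [OF elim] B(1) [of "Z x"] bound [OF elim] by linarith
    qed
  qed measurable
  \<comment> \<open>\<open>inv\<close> read as a change of variables: weighting by
    \<open>exp (L t x)\<close> and moving by \<open>\<phi> t\<close> restores
    \<open>M\<close>.\<close>
  have u_const: "expectation (u t) = expectation (\<lambda>x. q (Z x))" for t
  proof -
    have "expectation (\<lambda>x. q (Z x)) = (\<integral>x. q (Z x) \<partial>distr (density M (\<lambda>x. ennreal (exp (L t x)))) M (\<phi> t))"
      by (simp add: inv)
    also have "\<dots> = (\<integral>x. q (Z (\<phi> t x)) \<partial>density M (\<lambda>x. ennreal (exp (L t x))))"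
      by (subst integral_distr) auto
    also have "\<dots> = (\<integral>x. exp (L t x) *\<^sub>R q (Z (\<phi> t x)) \<partial>M)"
      by (subst integral_density) auto
    finally show ?thesis by (simp add: u_def mult.commute)
  qed
  \<comment> \<open>Dominated convergence is applied along the sequence 1/(k+1), which stays in
    (0,1], where the difference quotients are bounded by \<open>C\<close>.\<close>
  define e where "e = (\<lambda>k::nat. inverse (real (Suc k)))"
  have e: "0 < e k" "e k \<le> 1" for k
    by (auto simp: e_def field_simps)
  have e_lim: "filterlim e (at 0) sequentially"
    unfolding filterlim_at using e LIMSEQ_inverse_real_of_nat by (auto simp: e_def [abs_def])
  have "(\<lambda>k. expectation (\<lambda>x. (u (e k) x - u 0 x) / e k)) \<longlonglongrightarrow> expectation (\<lambda>x. du 0 x)"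
  proof (rule integral_dominated_convergence [where w = "\<lambda>_. C"])
    show "AE x in M. (\<lambda>k. (u (e k) x - u 0 x) / e k) \<longlonglongrightarrow> du 0 x"
      using S(2)
    proof eventually_elim
      case (elim x)
      have "((\<lambda>h. (u (0 + h) x - u 0 x) / h) \<longlongrightarrow> du 0 x) (at 0)"
        using u_deriv [OF elim, of 0] by (simp add: DERIV_def)
      from filterlim_compose [OF this e_lim] show ?case by simp
    qed
    show "AE x in M. norm ((u (e k) x - u 0 x) / e k) \<le> C" for k
      using S(2)
    proof eventually_elim
      case (elim x)
      then show ?case
        using u_le [OF elim e] e(1) [of k] by (simp add: field_simps)
    qed
    show "du 0 \<in> borel_measurable M" unfolding du_def by measurable
  qed auto
  moreover have "expectation (\<lambda>x. (u (e k) x - u 0 x) / e k) = 0" for k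
    using int_u [OF e] int_u0 by (simp add: u_const)
  ultimately have "(\<lambda>k::nat. 0) \<longlonglongrightarrow> expectation (\<lambda>x. du 0 x)"
    by (simp only:)
  then have "expectation (\<lambda>x. du 0 x) = 0"
    by (simp only: LIMSEQ_const_iff)
  moreover have "expectation (\<lambda>x. du 0 x) = expectation (\<lambda>x. r * (q' (Z x) * T x) - r * (q (Z x) * Z x))"
    using S(2) by (intro integral_cong_AE) (auto simp: du_def \<phi>_0 L_0 elim!: eventually_mono simp: algebra_simps)
  moreover have "integrable M (\<lambda>x. q' (Z x) * T x)" "integrable M (\<lambda>x. q (Z x) * Z x)"
    using S(2) B bound B0
    by (auto intro!: integrable_AE_bounded [where K = "B * K"] mult_mono elim!: eventually_mono simp: abs_mult)
  ultimately show "expectation (\<lambda>x. q (Z x) * Z x) = expectation (\<lambda>x. q' (Z x) * T x)"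
    using r by simp
qed

section \<open>Flows on the simplex\<close>

text \<open>A product measure is determined by its values on boxes, and there both sides factor into
  one-dimensional affine substitutions. Translations will serve the Haar series prior, scalings the
  Dirichlet prior.\<close>

lemma distr_PiM_affine:
  fixes c t :: "'i \<Rightarrow> real"
  assumes I: "finite I" and c: "\<And>i. i \<in> I \<Longrightarrow> c i > 0"
  shows "PiM I (\<lambda>_. lborel) = density (distr (PiM I (\<lambda>_. lborel)) (PiM I (\<lambda>_. lborel))
           (\<lambda>x. \<lambda>i\<in>I. t i + c i * x i)) (\<lambda>_. ennreal (\<Prod>i\<in>I. c i))"
proof -
  interpret product_sigma_finite "\<lambda>_. lborel :: real measure" ..
  let ?\<pi> = "PiM I (\<lambda>_. lborel :: real measure)" and ?f = "\<lambda>x. \<lambda>i\<in>I. t i + c i * x i"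
  have [measurable]: "?f \<in> measurable ?\<pi> ?\<pi>"
    by (rule measurable_restrict) measurable
  show ?thesis
  proof (rule PiM_eqI [OF I, symmetric])
    fix A assume A: "\<And>i. i \<in> I \<Longrightarrow> A i \<in> sets (lborel :: real measure)"
    let ?B = "\<lambda>i. (\<lambda>x. t i + c i * x) -` A i"
    have B: "?B i \<in> sets borel" if "i \<in> I" for i
      using A [OF that] measurable_sets [of "\<lambda>x. t i + c i * x" borel borel "A i"] by simp
    have PA: "Pi\<^sub>E I A \<in> sets ?\<pi>"
      using A by (intro sets_PiM_I_finite I) auto
    have "?f -` Pi\<^sub>E I A \<inter> space ?\<pi> = Pi\<^sub>E I ?B"
      by (auto simp: space_PiM PiE_iff extensional_def)
    then have "emeasure (density (distr ?\<pi> ?\<pi> ?f) (\<lambda>_. ennreal (prod c I))) (Pi\<^sub>E I A)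
        = ennreal (prod c I) * emeasure ?\<pi> (Pi\<^sub>E I ?B)"
      using PA by (simp add: emeasure_density_const emeasure_distr)
    also have "emeasure ?\<pi> (Pi\<^sub>E I ?B) = (\<Prod>i\<in>I. emeasure lborel (?B i))"
      using B by (intro emeasure_PiM I) auto
    also have "ennreal (prod c I) * (\<Prod>i\<in>I. emeasure lborel (?B i))
        = (\<Prod>i\<in>I. ennreal (c i)) * (\<Prod>i\<in>I. emeasure lborel (?B i))"
      using c by (subst prod_ennreal) (auto intro: less_imp_le)
    also have "\<dots> = (\<Prod>i\<in>I. emeasure lborel (A i))"
      unfolding prod.distrib [symmetric]
    proof (rule prod.cong [OF refl])
      fix i assume i: "i \<in> I"
      have "(\<integral>\<^sup>+x. indicator (A i) x \<partial>lborel) = ennreal \<bar>c i\<bar> * (\<integral>\<^sup>+x. indicator (A i) (t i + c i * x) \<partial>lborel)"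
        using A [OF i] c [OF i] by (intro nn_integral_real_affine) auto
      also have "(\<lambda>x. indicator (A i) (t i + c i * x) :: ennreal) = indicator (?B i)"
        by (auto simp: indicator_def)
      finally show "ennreal (c i) * emeasure lborel (?B i) = emeasure lborel (A i)"
        using A [OF i] B [OF i] c [OF i] by (simp add: abs_of_pos)
    qed
    finally show "emeasure (density (distr ?\<pi> ?\<pi> ?f) (\<lambda>_. ennreal (prod c I))) (Pi\<^sub>E I A)
        = (\<Prod>i\<in>I. emeasure lborel (A i))" .
  qed simp
qed

lemma distr_PiM_translation:
  fixes t :: "'i \<Rightarrow> real"
  assumes "finite I"
  shows "distr (PiM I (\<lambda>_. lborel)) (PiM I (\<lambda>_. lborel)) (\<lambda>x. \<lambda>i\<in>I. x i + t i) = PiM I (\<lambda>_. lborel)"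
  using distr_PiM_affine [OF assms, of "\<lambda>_. 1" t] by (simp add: density_1 add.commute)

lemma nn_integral_PiM_scale:
  fixes c :: "'i \<Rightarrow> real"
  assumes I: "finite I" and c: "\<And>i. i \<in> I \<Longrightarrow> c i > 0"
    and F [measurable]: "F \<in> borel_measurable (PiM I (\<lambda>_. lborel))"
  shows "(\<integral>\<^sup>+x. F x \<partial>PiM I (\<lambda>_. lborel))
       = ennreal (\<Prod>i\<in>I. c i) * (\<integral>\<^sup>+x. F (\<lambda>i\<in>I. c i * x i) \<partial>PiM I (\<lambda>_. lborel))"
proof -
  have [measurable]: "(\<lambda>x. \<lambda>i\<in>I. c i * x i) \<in> measurable (PiM I (\<lambda>_. lborel)) (PiM I (\<lambda>_. lborel))"
    by (rule measurable_restrict) measurable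
  show ?thesis
    by (subst distr_PiM_affine [OF I c, where t = "\<lambda>_. 0"])
       (simp_all add: nn_integral_density nn_integral_distr nn_integral_cmult)
qed

text \<open>These are the coordinates \<open>y = S * \<omega>\<close> with \<open>S\<close> the sum
  of the coordinates. Once the last coordinate has been traded for \<open>S\<close>, scaling the
  remaining \<open>p - 1\<close> free coordinates by \<open>S\<close> produces the Jacobian
  \<open>S ^ (p - 1)\<close>.\<close>

lemma nn_integral_orthant_polar:
  fixes F :: "(nat \<Rightarrow> real) \<Rightarrow> ennreal"
  assumes p: "p \<ge> 1"
    and F [measurable]: "F \<in> borel_measurable (PiM {1..p} (\<lambda>_. lborel))"
    and supp: "\<And>y \<mu>. \<mu> \<in> {1..p} \<Longrightarrow> y \<mu> \<le> 0 \<Longrightarrow> F y = 0"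
  shows "(\<integral>\<^sup>+y. F y \<partial>PiM {1..p} (\<lambda>_. lborel))
       = (\<integral>\<^sup>+S. ennreal (S ^ (p - 1)) * indicator {0<..} S *
            (\<integral>\<^sup>+w. F (\<lambda>\<mu>\<in>{1..p}. S * bin_probs p w \<mu>) \<partial>PiM {1..<p} (\<lambda>_. lborel)) \<partial>lborel)"
proof -
  interpret product_sigma_finite "\<lambda>_. lborel :: real measure" ..
  let ?P = "PiM {1..<p} (\<lambda>_. lborel :: real measure)"
  have ins: "{1..p} = insert p {1..<p}" using p by auto
  have sig: "sigma_finite_measure ?P"
    by (rule sigma_finite) simp
  interpret pair: pair_sigma_finite ?P "lborel :: real measure"
    using sig by (simp add: pair_sigma_finite_def sigma_finite_lborel)
  have F' [measurable]: "F \<in> borel_measurable (PiM (insert p {1..<p}) (\<lambda>_. lborel))"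
    using F unfolding ins .
  have upd [measurable]: "(\<lambda>(x, S). x(p := S - (\<Sum>\<nu>=1..<p. x \<nu>)))
      \<in> measurable (?P \<Otimes>\<^sub>M lborel) (PiM (insert p {1..<p}) (\<lambda>_. lborel))"
    unfolding split_beta by (rule measurable_fun_upd [where J = "{1..<p}"]) auto
  have "(\<integral>\<^sup>+y. F y \<partial>PiM {1..p} (\<lambda>_. lborel)) = (\<integral>\<^sup>+x. (\<integral>\<^sup>+y. F (x(p := y)) \<partial>lborel) \<partial>?P)"
    unfolding ins by (rule product_nn_integral_insert [OF _ _ F']) auto
  \<comment> \<open>For fixed other coordinates, the last one is translated by their sum, which
    makes the total the new variable.\<close>
  also have "\<dots> = (\<integral>\<^sup>+x. (\<integral>\<^sup>+S. F (x(p := S - (\<Sum>\<nu>=1..<p. x \<nu>))) \<partial>lborel) \<partial>?P)"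
  proof (rule nn_integral_cong)
    fix x assume "x \<in> space ?P"
    then have "(\<lambda>y. x(p := y)) \<in> measurable lborel (PiM (insert p {1..<p}) (\<lambda>_. lborel))"
      by (intro measurable_fun_upd [where J = "{1..<p}"]) auto
    then have "(\<lambda>y. F (x(p := y))) \<in> borel_measurable borel"
      using measurable_compose F' by simp
    from nn_integral_real_affine [OF this, of 1 "- (\<Sum>\<nu>=1..<p. x \<nu>)"]
    show "(\<integral>\<^sup>+y. F (x(p := y)) \<partial>lborel) = (\<integral>\<^sup>+S. F (x(p := S - (\<Sum>\<nu>=1..<p. x \<nu>))) \<partial>lborel)"
      by simp
  qed
  also have "\<dots> = (\<integral>\<^sup>+S. (\<integral>\<^sup>+x. F (x(p := S - (\<Sum>\<nu>=1..<p. x \<nu>))) \<partial>?P) \<partial>lborel)"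
    by (rule pair.Fubini' [symmetric]) measurable
  also have "\<dots> = (\<integral>\<^sup>+S. ennreal (S ^ (p - 1)) * indicator {0<..} S *
            (\<integral>\<^sup>+w. F (\<lambda>\<mu>\<in>{1..p}. S * bin_probs p w \<mu>) \<partial>?P) \<partial>lborel)"
  proof (rule nn_integral_cong)
    fix S :: real
    show "(\<integral>\<^sup>+x. F (x(p := S - (\<Sum>\<nu>=1..<p. x \<nu>))) \<partial>?P) = ennreal (S ^ (p - 1)) * indicator {0<..} S *
            (\<integral>\<^sup>+w. F (\<lambda>\<mu>\<in>{1..p}. S * bin_probs p w \<mu>) \<partial>?P)"
    proof (cases "S > 0")
      case True
      have "(\<lambda>x. F (x(p := S - (\<Sum>\<nu>=1..<p. x \<nu>)))) \<in> borel_measurable ?P"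
        using measurable_compose [OF measurable_Pair2' [of S lborel ?P] measurable_compose [OF upd F']]
        by simp
      then have "(\<integral>\<^sup>+x. F (x(p := S - (\<Sum>\<nu>=1..<p. x \<nu>))) \<partial>?P)
          = ennreal (\<Prod>i\<in>{1..<p}. S) * (\<integral>\<^sup>+x. F ((\<lambda>i\<in>{1..<p}. S * x i)
              (p := S - (\<Sum>\<nu>=1..<p. (\<lambda>i\<in>{1..<p}. S * x i) \<nu>))) \<partial>?P)"
        using True by (intro nn_integral_PiM_scale) auto
      also have "\<dots> = ennreal (S ^ (p - 1)) * (\<integral>\<^sup>+w. F (\<lambda>\<mu>\<in>{1..p}. S * bin_probs p w \<mu>) \<partial>?P)"
      proof (intro arg_cong2 [where f = "(*)"] nn_integral_cong arg_cong [where f = F])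
        fix x
        show "(\<lambda>i\<in>{1..<p}. S * x i)(p := S - (\<Sum>\<nu>=1..<p. (\<lambda>i\<in>{1..<p}. S * x i) \<nu>))
            = (\<lambda>\<mu>\<in>{1..p}. S * bin_probs p x \<mu>)"
          using p by (auto simp: fun_eq_iff bin_probs_def algebra_simps sum_distrib_left)
      qed simp
      finally show ?thesis using True by simp
    next
      case False
      \<comment> \<open>A nonpositive total forces some coordinate to be nonpositive, and there the
        support condition makes the integrand vanish.\<close>
      have "F (x(p := S - (\<Sum>\<nu>=1..<p. x \<nu>))) = 0" for x
      proof (cases "\<exists>\<nu>\<in>{1..<p}. x \<nu> \<le> 0")
        case True
        then obtain \<nu> where "\<nu> \<in> {1..<p}" "x \<nu> \<le> 0" by blast
        then show ?thesis by (intro supp [of \<nu>]) auto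
      next
        case F: False
        then have "0 \<le> (\<Sum>\<nu>=1..<p. x \<nu>)"
          by (intro sum_nonneg) (auto simp: not_le less_imp_le)
        then show ?thesis
          using False p by (intro supp [of p]) auto
      qed
      then show ?thesis using False by simp
    qed
  qed
  finally show ?thesis .
qed

text \<open>dS/S is the Haar measure of the multiplicative group of positive reals, hence invariant
  under the substitution of \<open>C * S\<close> for \<open>S\<close>.\<close>

lemma nn_integral_inverse_scale:
  assumes "C > 0"
  shows "(\<integral>\<^sup>+S. ennreal (1 / S) * indicator {1..exp 1} (S * C) * indicator {0<..} S \<partial>lborel)
       = (\<integral>\<^sup>+S. ennreal (1 / S) * indicator {1..exp 1} S * indicator {0<..} S \<partial>lborel)"
    (is "?l = ?r")
proof -
  have "?r = ennreal \<bar>C\<bar> * (\<integral>\<^sup>+S. ennreal (1 / (0 + C * S)) * indicator {1..exp 1} (0 + C * S) * indicator {0<..} (0 + C * S) \<partial>lborel)"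
    by (rule nn_integral_real_affine) (use assms in auto)
  also have "\<dots> = (\<integral>\<^sup>+S. ennreal C * (ennreal (1 / (C * S)) * indicator {1..exp 1} (C * S) * indicator {0<..} (C * S)) \<partial>lborel)"
    using assms by (subst nn_integral_cmult) (auto simp: abs_of_pos)
  also have "\<dots> = ?l"
  proof (rule nn_integral_cong)
    fix S :: real
    have "S > 0 \<longleftrightarrow> C * S > 0"
      using assms by (simp add: zero_less_mult_iff)
    then show "ennreal C * (ennreal (1 / (C * S)) * indicator {1..exp 1} (C * S) * indicator {0<..} (C * S))
        = ennreal (1 / S) * indicator {1..exp 1} (S * C) * indicator {0<..} S"
      using assms by (auto simp: indicator_def mult.commute simp flip: ennreal_mult')
  qed
  finally show ?thesis ..
qed

text \<open>The endpoint \<open>exp 1\<close> is chosen to give the window logarithmic length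
  1.\<close>

lemma nn_integral_inverse_window:
  "(\<integral>\<^sup>+S. ennreal (1 / S) * indicator {1..exp 1} S * indicator {0<..} S \<partial>lborel) = 1"
proof -
  have "(\<integral>\<^sup>+S. ennreal (1 / S) * indicator {1..exp 1} S * indicator {0<..} S \<partial>lborel)
      = (\<integral>\<^sup>+S. ennreal (1 / S) * indicator {1..exp 1} S \<partial>lborel)"
    by (intro nn_integral_cong) (auto split: split_indicator)
  also have "\<dots> = ennreal (ln (exp 1) - ln 1)"
    by (rule nn_integral_FTC_Icc) (auto intro!: derivative_eq_intros simp: divide_inverse)
  finally show ?thesis by simp
qed

section \<open>The tilting flow on the simplex and its invariant measure\<close>

definition bin_simplex :: "nat \<Rightarrow> (nat \<Rightarrow> real) set" where
  "bin_simplex p = {w \<in> space (PiM {1..<p} (\<lambda>_. lborel)). \<forall>\<mu>\<in>{1..p}. 0 < bin_probs p w \<mu>}"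

text \<open>If \<open>\<omega>\<close> are the bin probabilities of \<open>f\<close>, then these are the ones of \<open>f e\<^sup>t\<^sup>b / \<integral> f e\<^sup>t\<^sup>b\<close>.\<close>

definition tilt :: "nat \<Rightarrow> (nat \<Rightarrow> real) \<Rightarrow> real \<Rightarrow> (nat \<Rightarrow> real) \<Rightarrow> nat \<Rightarrow> real" where
  "tilt p b t \<omega> \<mu> = \<omega> \<mu> * exp (t * b \<mu>) / (\<Sum>\<nu>=1..p. \<omega> \<nu> * exp (t * b \<nu>))"

definition simplex_flow :: "nat \<Rightarrow> (nat \<Rightarrow> real) \<Rightarrow> real \<Rightarrow> (nat \<Rightarrow> real) \<Rightarrow> nat \<Rightarrow> real" where
  "simplex_flow p b t w = (\<lambda>\<mu>\<in>{1..<p}. tilt p b t (bin_probs p w) \<mu>)"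

lemma sum_bin_probs: "p \<ge> 1 \<Longrightarrow> (\<Sum>\<mu>=1..p. bin_probs p w \<mu>) = 1"
proof -
  assume "p \<ge> 1"
  then have "{1..p} = insert p {1..<p}" by auto
  then show ?thesis by (simp add: bin_probs_def)
qed

lemma sum_tilt_weights_pos:
  fixes p :: nat and \<omega> b :: "nat \<Rightarrow> real"
  assumes "p \<ge> 1" "\<And>\<mu>. \<mu> \<in> {1..p} \<Longrightarrow> 0 < \<omega> \<mu>"
  shows "0 < (\<Sum>\<nu>=1..p. \<omega> \<nu> * exp (t * b \<nu>))"
  using assms by (intro sum_pos) auto

lemma tilt_pos:
  assumes "\<mu> \<in> {1..p}" "\<And>\<mu>. \<mu> \<in> {1..p} \<Longrightarrow> 0 < \<omega> \<mu>"
  shows "0 < tilt p b t \<omega> \<mu>"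
  using assms sum_tilt_weights_pos [of p \<omega> t b] by (simp add: tilt_def)

lemma sum_tilt:
  assumes "p \<ge> 1" "\<And>\<mu>. \<mu> \<in> {1..p} \<Longrightarrow> 0 < \<omega> \<mu>"
  shows "(\<Sum>\<mu>=1..p. tilt p b t \<omega> \<mu>) = 1"
proof -
  have "0 < (\<Sum>\<nu>=1..p. \<omega> \<nu> * exp (t * b \<nu>))"
    by (rule sum_tilt_weights_pos) (use assms in auto)
  then show ?thesis unfolding tilt_def by (simp flip: sum_divide_distrib)
qed

text \<open>Only the last bin needs an argument: \<open>bin_probs\<close> restores it from the
  total, and the tilted probabilities still sum to 1.\<close>

lemma bin_probs_simplex_flow:
  assumes p: "p \<ge> 1" and w: "w \<in> bin_simplex p" and \<mu>: "\<mu> \<in> {1..p}"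
  shows "bin_probs p (simplex_flow p b t w) \<mu> = tilt p b t (bin_probs p w) \<mu>"
proof (cases "\<mu> = p")
  case True
  have "(\<Sum>\<nu>=1..p. tilt p b t (bin_probs p w) \<nu>) = 1"
    using w p by (intro sum_tilt) (auto simp: bin_simplex_def)
  moreover have "{1..p} = insert p {1..<p}" using p by auto
  ultimately show ?thesis
    using True by (simp add: bin_probs_def simplex_flow_def)
qed (use \<mu> in \<open>auto simp: bin_probs_def simplex_flow_def\<close>)

lemma simplex_flow_in_bin_simplex:
  assumes "p \<ge> 1" "w \<in> bin_simplex p"
  shows "simplex_flow p b t w \<in> bin_simplex p"
proof -
  have "0 < bin_probs p (simplex_flow p b t w) \<mu>" if "\<mu> \<in> {1..p}" for \<mu>
    unfolding bin_probs_simplex_flow [OF assms that]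
    using assms(2) by (intro tilt_pos that) (auto simp: bin_simplex_def)
  then show ?thesis
    by (auto simp: bin_simplex_def simplex_flow_def space_PiM)
qed

lemma measurable_bin_probs [measurable]:
  assumes "\<mu> \<in> {1..p}"
  shows "(\<lambda>w. bin_probs p w \<mu>) \<in> borel_measurable (PiM {1..<p} (\<lambda>_. lborel))"
proof (cases "\<mu> = p")
  case True
  then show ?thesis unfolding bin_probs_def by simp
next
  case False
  then show ?thesis using assms unfolding bin_probs_def by simp
qed

lemma sets_bin_simplex [measurable]: "bin_simplex p \<in> sets (PiM {1..<p} (\<lambda>_. lborel))"
  unfolding bin_simplex_def by measurable

lemma measurable_simplex_flow [measurable]:
  "simplex_flow p b t \<in> measurable (PiM {1..<p} (\<lambda>_. lborel)) (PiM {1..<p} (\<lambda>_. lborel))"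
  unfolding simplex_flow_def tilt_def by (rule measurable_restrict) measurable

text \<open>
  The radial weight \<open>1 / S\<close> on \<open>[1, e]\<close> has mass one, and by scale invariance keeps it when the radius is
  stretched by a factor \<open>C w\<close> depending on the direction; so \<open>C\<close> does not appear on the right hand side.
\<close>

lemma nn_integral_cone:
  fixes \<Phi> :: "(nat \<Rightarrow> real) \<Rightarrow> ennreal" and C :: "(nat \<Rightarrow> real) \<Rightarrow> real"
  assumes p: "p \<ge> 1"
    and \<Phi> [measurable]: "\<Phi> \<in> borel_measurable (PiM {1..<p} (\<lambda>_. lborel))"
    and C [measurable]: "C \<in> borel_measurable (PiM {1..<p} (\<lambda>_. lborel))"
    and C_pos: "\<And>w. w \<in> bin_simplex p \<Longrightarrow> C w > 0"
  defines "\<pi> \<equiv> \<lambda>y. \<lambda>\<mu>\<in>{1..<p}. y \<mu> / (\<Sum>\<nu>=1..p. y \<nu>)"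
  shows "(\<integral>\<^sup>+y. (if \<forall>\<mu>\<in>{1..p}. 0 < y \<mu> then ennreal (\<Prod>\<mu>=1..p. 1 / y \<mu>) * \<Phi> (\<pi> y)
              * indicator {1..exp 1} ((\<Sum>\<nu>=1..p. y \<nu>) * C (\<pi> y)) else 0) \<partial>PiM {1..p} (\<lambda>_. lborel))
       = (\<integral>\<^sup>+w. indicator (bin_simplex p) w * ennreal (\<Prod>\<mu>=1..p. 1 / bin_probs p w \<mu>) * \<Phi> w \<partial>PiM {1..<p} (\<lambda>_. lborel))"
    (is "(\<integral>\<^sup>+y. ?F y \<partial>_) = _")
proof -
  let ?P = "PiM {1..<p} (\<lambda>_. lborel :: real measure)"
  interpret product_sigma_finite "\<lambda>_. lborel :: real measure" ..
  interpret pair: pair_sigma_finite ?P "lborel :: real measure"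
    by (simp add: pair_sigma_finite_def sigma_finite_lborel sigma_finite)
  have \<pi> [measurable]: "\<pi> \<in> measurable (PiM {1..p} (\<lambda>_. lborel)) ?P"
    unfolding \<pi>_def by (rule measurable_restrict) measurable
  define w0 where "w0 = (\<lambda>w. indicator (bin_simplex p) w * ennreal (\<Prod>\<mu>=1..p. 1 / bin_probs p w \<mu>) * \<Phi> w)"
  have w0 [measurable]: "w0 \<in> borel_measurable ?P"
    unfolding w0_def by measurable
  have "(\<integral>\<^sup>+y. ?F y \<partial>PiM {1..p} (\<lambda>_. lborel)) = (\<integral>\<^sup>+S. ennreal (S ^ (p - 1)) * indicator {0<..} S *
            (\<integral>\<^sup>+w. ?F (\<lambda>\<mu>\<in>{1..p}. S * bin_probs p w \<mu>) \<partial>?P) \<partial>lborel)"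
    by (rule nn_integral_orthant_polar [OF p]) (measurable, force)
  also have "\<dots> = (\<integral>\<^sup>+S. (\<integral>\<^sup>+w. w0 w * (ennreal (1 / S) * indicator {1..exp 1} (S * C w) * indicator {0<..} S) \<partial>?P) \<partial>lborel)"
  proof (rule nn_integral_cong)
    fix S :: real
    show "ennreal (S ^ (p - 1)) * indicator {0<..} S *
            (\<integral>\<^sup>+w. ?F (\<lambda>\<mu>\<in>{1..p}. S * bin_probs p w \<mu>) \<partial>?P)
        = (\<integral>\<^sup>+w. w0 w * (ennreal (1 / S) * indicator {1..exp 1} (S * C w) * indicator {0<..} S) \<partial>?P)"
    proof (cases "S > 0")
      case S: True
      have "?F (\<lambda>\<mu>\<in>{1..p}. S * bin_probs p w \<mu>)
          = ennreal (1 / S ^ p) * (w0 w * indicator {1..exp 1} (S * C w))" if w: "w \<in> space ?P" for w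
      proof -
        have sum: "(\<Sum>\<nu>=1..p. (\<lambda>\<mu>\<in>{1..p}. S * bin_probs p w \<mu>) \<nu>) = S"
          using sum_bin_probs [OF p, of w] by (simp flip: sum_distrib_left)
        have "\<pi> (\<lambda>\<mu>\<in>{1..p}. S * bin_probs p w \<mu>) = w"
          using w S unfolding \<pi>_def sum
          by (auto simp: fun_eq_iff space_PiM bin_probs_def extensional_def)
        moreover have "ennreal (\<Prod>\<mu>=1..p. 1 / (\<lambda>\<mu>\<in>{1..p}. S * bin_probs p w \<mu>) \<mu>)
            = ennreal (1 / S ^ p) * ennreal (\<Prod>\<mu>=1..p. 1 / bin_probs p w \<mu>)"
          using S by (simp add: prod_dividef prod.distrib flip: ennreal_mult')
        moreover have "(\<forall>\<mu>\<in>{1..p}. 0 < (\<lambda>\<mu>\<in>{1..p}. S * bin_probs p w \<mu>) \<mu>) \<longleftrightarrow> w \<in> bin_simplex p"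
          using S w by (auto simp: bin_simplex_def zero_less_mult_iff)
        ultimately show ?thesis
          unfolding sum using S by (simp add: w0_def mult_ac)
      qed
      then have "(\<integral>\<^sup>+w. ?F (\<lambda>\<mu>\<in>{1..p}. S * bin_probs p w \<mu>) \<partial>?P)
          = (\<integral>\<^sup>+w. ennreal (1 / S ^ p) * (w0 w * indicator {1..exp 1} (S * C w)) \<partial>?P)"
        by (rule nn_integral_cong)
      then have "ennreal (S ^ (p - 1)) * indicator {0<..} S *
            (\<integral>\<^sup>+w. ?F (\<lambda>\<mu>\<in>{1..p}. S * bin_probs p w \<mu>) \<partial>?P)
          = ennreal (S ^ (p - 1)) * (\<integral>\<^sup>+w. ennreal (1 / S ^ p) * (w0 w * indicator {1..exp 1} (S * C w)) \<partial>?P)"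
        using S by (simp only:) simp
      also have "\<dots> = ennreal (S ^ (p - 1)) * ennreal (1 / S ^ p) * (\<integral>\<^sup>+w. w0 w * indicator {1..exp 1} (S * C w) \<partial>?P)"
        by (subst nn_integral_cmult) (measurable, simp only: mult.assoc)
      \<comment> \<open>The Jacobian \<open>S ^ (p - 1)\<close> meets the \<open>p\<close>
        reciprocals \<open>1 / y \<mu>\<close>, each contributing \<open>1 / S\<close>. What is left
        is exactly the scale-invariant radial weight.\<close>
      also have "ennreal (S ^ (p - 1)) * ennreal (1 / S ^ p) = ennreal (1 / S)"
        using S p by (simp add: power_diff flip: ennreal_mult')
      also have "ennreal (1 / S) * (\<integral>\<^sup>+w. w0 w * indicator {1..exp 1} (S * C w) \<partial>?P)
          = (\<integral>\<^sup>+w. w0 w * (ennreal (1 / S) * indicator {1..exp 1} (S * C w) * indicator {0<..} S) \<partial>?P)"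
        using S by (subst nn_integral_cmult [symmetric]) (measurable, simp add: mult_ac)
      finally show ?thesis .
    qed simp
  qed
  also have "\<dots> = (\<integral>\<^sup>+w. (\<integral>\<^sup>+S. w0 w * (ennreal (1 / S) * indicator {1..exp 1} (S * C w) * indicator {0<..} S) \<partial>lborel) \<partial>?P)"
    by (rule pair.Fubini') measurable
  also have "\<dots> = (\<integral>\<^sup>+w. w0 w \<partial>?P)"
  proof (rule nn_integral_cong)
    fix w
    have "(\<integral>\<^sup>+S. w0 w * (ennreal (1 / S) * indicator {1..exp 1} (S * C w) * indicator {0<..} S) \<partial>lborel)
        = w0 w * (\<integral>\<^sup>+S. (ennreal (1 / S) * indicator {1..exp 1} (S * C w) * indicator {0<..} S) \<partial>lborel)"
      by (rule nn_integral_cmult) measurable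
    \<comment> \<open>On the simplex the radial integral equals 1 for every positive value of
      \<open>C w\<close>; off the simplex \<open>w0\<close> vanishes.\<close>
    also have "\<dots> = w0 w"
    proof (cases "w \<in> bin_simplex p")
      case True
      then show ?thesis
        using nn_integral_inverse_scale [OF C_pos [OF True]] nn_integral_inverse_window by simp
    qed (simp add: w0_def)
    finally show "(\<integral>\<^sup>+S. w0 w * (ennreal (1 / S) * indicator {1..exp 1} (S * C w) * indicator {0<..} S) \<partial>lborel) = w0 w" .
  qed
  finally show ?thesis unfolding w0_def .
qed

text \<open>Seen from the orthant, the flow is the diagonal scaling of \<open>y \<mu>\<close> by
  \<open>exp (t * b \<mu>)\<close> followed by normalisation, and the product of the dy/y is
  invariant under that scaling. The scaling changes the coordinate sum by a factor that depends on
  the direction, which is why \<open>nn_integral_cone\<close> allows for \<open>C\<close>.\<close>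

lemma nn_integral_simplex_flow:
  fixes \<Phi> :: "(nat \<Rightarrow> real) \<Rightarrow> ennreal"
  assumes p: "p \<ge> 1"
    and \<Phi> [measurable]: "\<Phi> \<in> borel_measurable (PiM {1..<p} (\<lambda>_. lborel))"
  shows "(\<integral>\<^sup>+w. indicator (bin_simplex p) w * ennreal (\<Prod>\<mu>=1..p. 1 / bin_probs p w \<mu>) * \<Phi> (simplex_flow p b t w) \<partial>PiM {1..<p} (\<lambda>_. lborel))
       = (\<integral>\<^sup>+w. indicator (bin_simplex p) w * ennreal (\<Prod>\<mu>=1..p. 1 / bin_probs p w \<mu>) * \<Phi> w \<partial>PiM {1..<p} (\<lambda>_. lborel))"
proof -
  let ?P = "PiM {1..<p} (\<lambda>_. lborel :: real measure)"
  define \<pi> where "\<pi> = (\<lambda>y. \<lambda>\<mu>\<in>{1..<p}. y \<mu> / (\<Sum>\<nu>=1..p. y \<nu>) :: real)"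
  \<comment> \<open>The factor by which the scaling stretches the coordinate sum in direction
    \<open>w\<close>. Accordingly \<open>F\<close> below carries the plain radial window and
    \<open>G\<close> the stretched one.\<close>
  define C where "C = (\<lambda>w. \<Sum>\<nu>=1..p. bin_probs p w \<nu> * exp (t * b \<nu>))"
  define F where "F = (\<lambda>y. if \<forall>\<mu>\<in>{1..p}. 0 < y \<mu> then ennreal (\<Prod>\<mu>=1..p. 1 / y \<mu>) * \<Phi> (\<pi> y)
              * indicator {1..exp 1} ((\<Sum>\<nu>=1..p. y \<nu>) * 1) else 0)"
  define G where "G = (\<lambda>y. if \<forall>\<mu>\<in>{1..p}. 0 < y \<mu> then ennreal (\<Prod>\<mu>=1..p. 1 / y \<mu>) * \<Phi> (simplex_flow p b t (\<pi> y))
              * indicator {1..exp 1} ((\<Sum>\<nu>=1..p. y \<nu>) * C (\<pi> y)) else 0)"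
  have \<pi> [measurable]: "\<pi> \<in> measurable (PiM {1..p} (\<lambda>_. lborel)) ?P"
    unfolding \<pi>_def by (rule measurable_restrict) measurable
  have C [measurable]: "C \<in> borel_measurable ?P"
    unfolding C_def by measurable
  have F [measurable]: "F \<in> borel_measurable (PiM {1..p} (\<lambda>_. lborel))"
    unfolding F_def by measurable
  have G [measurable]: "G \<in> borel_measurable (PiM {1..p} (\<lambda>_. lborel))"
    unfolding G_def by measurable
  let ?c = "\<lambda>\<mu>. exp (t * b \<mu>)"
  have scaled: "ennreal (\<Prod>i\<in>{1..p}. ?c i) * F (\<lambda>i\<in>{1..p}. ?c i * y i) = G y" for y
  proof (cases "\<forall>\<mu>\<in>{1..p}. 0 < y \<mu>")
    case True
    define S where "S = (\<Sum>\<nu>=1..p. y \<nu>)"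
    have S: "S > 0" unfolding S_def using True p by (intro sum_pos) auto
    have bp: "bin_probs p (\<pi> y) \<mu> = y \<mu> / S" if "\<mu> \<in> {1..p}" for \<mu>
    proof (cases "\<mu> = p")
      case True
      have "{1..p} = insert p {1..<p}" using p by auto
      then have "S = y p + (\<Sum>\<nu>=1..<p. y \<nu>)" by (simp add: S_def)
      then have "(\<Sum>\<nu>=1..<p. y \<nu> / S) = 1 - y p / S"
        using S by (simp add: field_simps flip: sum_divide_distrib)
      moreover have "sum y {Suc 0..p} = S"
        by (simp add: S_def)
      ultimately show ?thesis
        using True by (simp add: bin_probs_def \<pi>_def)
    qed (use that in \<open>auto simp: bin_probs_def \<pi>_def S_def\<close>)
    have C': "S * C (\<pi> y) = (\<Sum>\<nu>=1..p. ?c \<nu> * y \<nu>)"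
      unfolding C_def sum_distrib_left using S by (intro sum.cong) (auto simp: bp)
    have flow: "simplex_flow p b t (\<pi> y) = \<pi> (\<lambda>i\<in>{1..p}. ?c i * y i)"
    proof
      fix \<mu>
      have "tilt p b t (bin_probs p (\<pi> y)) \<mu> = ?c \<mu> * y \<mu> / (\<Sum>\<nu>=1..p. ?c \<nu> * y \<nu>)" if "\<mu> \<in> {1..<p}"
      proof -
        have "tilt p b t (bin_probs p (\<pi> y)) \<mu> = y \<mu> / S * ?c \<mu> / C (\<pi> y)"
          using that by (simp add: tilt_def bp C_def)
        also have "\<dots> = ?c \<mu> * y \<mu> / (S * C (\<pi> y))"
          by simp
        finally show ?thesis unfolding C' .
      qed
      then show "simplex_flow p b t (\<pi> y) \<mu> = \<pi> (\<lambda>i\<in>{1..p}. ?c i * y i) \<mu>"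
        by (auto simp: simplex_flow_def \<pi>_def)
    qed
    have "ennreal (\<Prod>i\<in>{1..p}. ?c i) * ennreal (\<Prod>\<mu>=1..p. 1 / (?c \<mu> * y \<mu>)) = ennreal (\<Prod>\<mu>=1..p. 1 / y \<mu>)"
      by (simp add: prod_nonneg flip: ennreal_mult' prod.distrib)
    then show ?thesis
      using True C' [unfolded S_def] flow by (simp add: F_def G_def mult.assoc [symmetric])
  next
    case False
    then show ?thesis
      by (auto simp: F_def G_def zero_less_mult_iff)
  qed
  have "(\<integral>\<^sup>+w. indicator (bin_simplex p) w * ennreal (\<Prod>\<mu>=1..p. 1 / bin_probs p w \<mu>) * \<Phi> w \<partial>?P)
      = (\<integral>\<^sup>+y. F y \<partial>PiM {1..p} (\<lambda>_. lborel))"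
    unfolding F_def \<pi>_def by (rule nn_integral_cone [symmetric, OF p \<Phi>]) auto
  also have "\<dots> = ennreal (\<Prod>i\<in>{1..p}. ?c i) * (\<integral>\<^sup>+y. F (\<lambda>i\<in>{1..p}. ?c i * y i) \<partial>PiM {1..p} (\<lambda>_. lborel))"
    by (rule nn_integral_PiM_scale [OF _ _ F]) auto
  also have "\<dots> = (\<integral>\<^sup>+y. G y \<partial>PiM {1..p} (\<lambda>_. lborel))"
  proof -
    have "(\<lambda>y. \<lambda>i\<in>{1..p}. ?c i * y i) \<in> measurable (PiM {1..p} (\<lambda>_. lborel)) (PiM {1..p} (\<lambda>_. lborel))"
      by (rule measurable_restrict) measurable
    then show ?thesis
      unfolding scaled [symmetric] by (intro nn_integral_cmult [symmetric]) (rule measurable_compose [OF _ F])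
  qed
  also have "\<dots> = (\<integral>\<^sup>+w. indicator (bin_simplex p) w * ennreal (\<Prod>\<mu>=1..p. 1 / bin_probs p w \<mu>) * \<Phi> (simplex_flow p b t w) \<partial>?P)"
    unfolding G_def \<pi>_def using sum_tilt_weights_pos [OF p]
    by (intro nn_integral_cone [OF p _ C]) (measurable, auto simp: C_def bin_simplex_def)
  finally show ?thesis ..
qed

text \<open>Both sides are the integral of \<open>\<Prod> y\<^sub>\<mu> powr (\<alpha>\<^sub>\<mu> - 1) e powr - y\<^sub>\<mu>\<close> over the orthant.\<close>

lemma dirichlet_integral:
  fixes \<alpha> :: "nat \<Rightarrow> real"
  assumes p: "p \<ge> 1" and \<alpha>: "\<And>\<mu>. \<mu> \<in> {1..p} \<Longrightarrow> 0 < \<alpha> \<mu>"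
  defines "D \<equiv> (\<integral>\<^sup>+w. indicator (bin_simplex p) w * ennreal (\<Prod>\<mu>=1..p. bin_probs p w \<mu> powr (\<alpha> \<mu> - 1)) \<partial>PiM {1..<p} (\<lambda>_. lborel))"
  shows "ennreal (Gamma (\<Sum>\<mu>=1..p. \<alpha> \<mu>)) * D = ennreal (\<Prod>\<mu>=1..p. Gamma (\<alpha> \<mu>))"
proof -
  let ?P = "PiM {1..<p} (\<lambda>_. lborel :: real measure)"
  let ?A = "\<Sum>\<mu>=1..p. \<alpha> \<mu>"
  interpret product_sigma_finite "\<lambda>_. lborel :: real measure" ..
  define g where "g = (\<lambda>\<alpha> t. indicator {0..} t * t powr (\<alpha> - 1) / exp t :: real)"
  have [measurable]: "g \<alpha> \<in> borel_measurable borel" for \<alpha>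
    unfolding g_def by measurable
  have g: "(\<integral>\<^sup>+t. ennreal (g \<alpha> t) \<partial>lborel) = ennreal (Gamma \<alpha>)" if "\<alpha> > 0" for \<alpha>
    unfolding g_def using Gamma_conv_nn_integral_real [OF that] by simp
  have g_pos: "g \<alpha> t = (if t > 0 then t powr (\<alpha> - 1) / exp t else 0)" for \<alpha> t
    by (auto simp: g_def)
  have A: "?A > 0" using p \<alpha> by (intro sum_pos) auto
  have "ennreal (\<Prod>\<mu>=1..p. Gamma (\<alpha> \<mu>)) = (\<Prod>\<mu>=1..p. ennreal (Gamma (\<alpha> \<mu>)))"
    using \<alpha> by (intro prod_ennreal [symmetric]) (auto intro!: less_imp_le Gamma_real_pos)
  also have "\<dots> = (\<Prod>\<mu>=1..p. (\<integral>\<^sup>+t. ennreal (g (\<alpha> \<mu>) t) \<partial>lborel))"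
    using \<alpha> by (intro prod.cong) (auto simp: g)
  also have "\<dots> = (\<integral>\<^sup>+y. (\<Prod>\<mu>=1..p. ennreal (g (\<alpha> \<mu>) (y \<mu>))) \<partial>PiM {1..p} (\<lambda>_. lborel))"
    by (rule product_nn_integral_prod [symmetric]) auto
  also have "\<dots> = (\<integral>\<^sup>+S. ennreal (S ^ (p - 1)) * indicator {0<..} S *
            (\<integral>\<^sup>+w. (\<Prod>\<mu>=1..p. ennreal (g (\<alpha> \<mu>) ((\<lambda>\<mu>\<in>{1..p}. S * bin_probs p w \<mu>) \<mu>))) \<partial>?P) \<partial>lborel)"
    by (rule nn_integral_orthant_polar [OF p]) (measurable, auto simp: g_pos prod_zero_iff not_less)
  also have "\<dots> = (\<integral>\<^sup>+S. ennreal (g ?A S) * D \<partial>lborel)"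
  proof (rule nn_integral_cong)
    fix S :: real
    show "ennreal (S ^ (p - 1)) * indicator {0<..} S *
            (\<integral>\<^sup>+w. (\<Prod>\<mu>=1..p. ennreal (g (\<alpha> \<mu>) ((\<lambda>\<mu>\<in>{1..p}. S * bin_probs p w \<mu>) \<mu>))) \<partial>?P)
        = ennreal (g ?A S) * D"
    proof (cases "S > 0")
      case S: True
      have "(\<Prod>\<mu>=1..p. ennreal (g (\<alpha> \<mu>) ((\<lambda>\<mu>\<in>{1..p}. S * bin_probs p w \<mu>) \<mu>)))
          = ennreal (S powr (?A - p) / exp S) * (indicator (bin_simplex p) w * ennreal (\<Prod>\<mu>=1..p. bin_probs p w \<mu> powr (\<alpha> \<mu> - 1)))"
        if w: "w \<in> space ?P" for w
      proof (cases "w \<in> bin_simplex p")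
        case True
        then have pos: "0 < bin_probs p w \<mu>" if "\<mu> \<in> {1..p}" for \<mu>
          using that by (auto simp: bin_simplex_def)
        have "(\<Prod>\<mu>=1..p. ennreal (g (\<alpha> \<mu>) ((\<lambda>\<mu>\<in>{1..p}. S * bin_probs p w \<mu>) \<mu>)))
            = (\<Prod>\<mu>=1..p. ennreal (S powr (\<alpha> \<mu> - 1) * bin_probs p w \<mu> powr (\<alpha> \<mu> - 1) * exp (- (S * bin_probs p w \<mu>))))"
          using S pos by (intro prod.cong) (auto simp: g_pos powr_mult less_imp_le exp_minus divide_inverse)
        also have "\<dots> = ennreal (\<Prod>\<mu>=1..p. S powr (\<alpha> \<mu> - 1) * bin_probs p w \<mu> powr (\<alpha> \<mu> - 1) * exp (- (S * bin_probs p w \<mu>)))"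
          by (rule prod_ennreal) simp
        also have "(\<Prod>\<mu>=1..p. S powr (\<alpha> \<mu> - 1) * bin_probs p w \<mu> powr (\<alpha> \<mu> - 1) * exp (- (S * bin_probs p w \<mu>)))
            = S powr (?A - p) / exp S * (\<Prod>\<mu>=1..p. bin_probs p w \<mu> powr (\<alpha> \<mu> - 1))"
        proof -
          \<comment> \<open>The exponentials see only the total \<open>S\<close>, because the bin
            probabilities sum to 1; this separates the radius from the direction.\<close>
          have exp_eq: "(\<Prod>\<mu>=1..p. exp (- (S * bin_probs p w \<mu>))) = exp (- S)"
            using sum_bin_probs [OF p, of w]
            by (simp add: sum_negf flip: exp_sum sum_distrib_left)
          have powr_eq: "(\<Prod>\<mu>=1..p. S powr (\<alpha> \<mu> - 1)) = S powr (?A - p)"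
            using S by (simp add: powr_sum [symmetric] sum_subtractf)
          show ?thesis
            unfolding prod.distrib exp_eq powr_eq by (simp add: exp_minus divide_inverse)
        qed
        also have "ennreal (S powr (?A - p) / exp S * (\<Prod>\<mu>=1..p. bin_probs p w \<mu> powr (\<alpha> \<mu> - 1)))
            = ennreal (S powr (?A - p) / exp S) * ennreal (\<Prod>\<mu>=1..p. bin_probs p w \<mu> powr (\<alpha> \<mu> - 1))"
          by (rule ennreal_mult') simp
        finally show ?thesis
          using True by simp
      next
        case False
        then obtain \<mu> where "\<mu> \<in> {1..p}" "bin_probs p w \<mu> \<le> 0"
          using w by (auto simp: bin_simplex_def not_less)
        then have "(\<Prod>\<mu>=1..p. ennreal (g (\<alpha> \<mu>) ((\<lambda>\<mu>\<in>{1..p}. S * bin_probs p w \<mu>) \<mu>))) = 0"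
          using S by (intro prod_zero) (auto simp: g_pos zero_less_mult_iff not_less intro!: bexI [of _ \<mu>])
        then show ?thesis using False by simp
      qed
      then have "(\<integral>\<^sup>+w. (\<Prod>\<mu>=1..p. ennreal (g (\<alpha> \<mu>) ((\<lambda>\<mu>\<in>{1..p}. S * bin_probs p w \<mu>) \<mu>))) \<partial>?P)
          = ennreal (S powr (?A - p) / exp S) * D"
        unfolding D_def by (subst nn_integral_cmult [symmetric]) (measurable, rule nn_integral_cong)
      \<comment> \<open>The Jacobian raises the exponent from \<open>?A - p\<close> to
        \<open>?A - 1\<close>, leaving the Gamma integrand with parameter \<open>?A\<close>.\<close>
      moreover have "S ^ (p - 1) * (S powr (?A - p) / exp S) = g ?A S"
        using S p by (simp add: g_pos of_nat_diff flip: powr_realpow powr_add)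
      ultimately show ?thesis
        using S by (simp add: mult.assoc [symmetric] flip: ennreal_mult')
    qed (simp add: g_pos)
  qed
  also have "\<dots> = ennreal (Gamma ?A) * D"
    by (subst nn_integral_multc) (measurable, simp only: g [OF A])
  finally show ?thesis ..
qed

text \<open>The density is split into \<open>V\<close>, whose measure the flow preserves, and a
  remainder \<open>D\<close>. Multiplication by \<open>exp (L x)\<close> turns \<open>D x\<close>
  into \<open>D (\<phi> x)\<close>, so that the whole integrand becomes a function of
  \<open>\<phi> x\<close> against the invariant measure. The factor \<open>r\<close> is the place of
  the posterior normalisation.\<close>

lemma flow_invariance_density:
  fixes W V D :: "'a \<Rightarrow> ennreal" and L :: "'a \<Rightarrow> real" and r :: ennreal
  assumes [measurable]: "W \<in> borel_measurable M" "V \<in> borel_measurable M" "D \<in> borel_measurable M"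
      "L \<in> borel_measurable M" "\<phi> \<in> measurable M M"
    and inv: "\<And>\<Phi>. \<Phi> \<in> borel_measurable M \<Longrightarrow> (\<integral>\<^sup>+x. V x * \<Phi> (\<phi> x) \<partial>M) = (\<integral>\<^sup>+x. V x * \<Phi> x \<partial>M)"
    and W: "\<And>x. x \<in> space M \<Longrightarrow> W x = V x * D x"
    and L: "\<And>x. x \<in> space M \<Longrightarrow> V x \<noteq> 0 \<Longrightarrow> D x * ennreal (exp (L x)) = D (\<phi> x)"
  defines "Q \<equiv> scale_measure r (density M W)"
  shows "distr (density Q (\<lambda>x. ennreal (exp (L x)))) Q \<phi> = Q"
proof (rule measure_eqI)
  fix A assume "A \<in> sets (distr (density Q (\<lambda>x. ennreal (exp (L x)))) Q \<phi>)"
  then have A [measurable]: "A \<in> sets M" by (simp add: Q_def)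
  have [simp]: "sets Q = sets M" "space Q = space M" by (simp_all add: Q_def space_scale_measure)
  have m: "measurable Q Q = measurable M M" "borel_measurable Q = (borel_measurable M :: ('a \<Rightarrow> ennreal) set)"
    "borel_measurable Q = (borel_measurable M :: ('a \<Rightarrow> real) set)"
    by (auto intro!: measurable_cong_sets)
  have pre: "\<phi> -` A \<inter> space M \<in> sets M" by measurable
  have "emeasure (distr (density Q (\<lambda>x. ennreal (exp (L x)))) Q \<phi>) A
      = emeasure (density Q (\<lambda>x. ennreal (exp (L x)))) (\<phi> -` A \<inter> space M)"
    by (subst emeasure_distr) (auto simp: m)
  also have "\<dots> = (\<integral>\<^sup>+x. ennreal (exp (L x)) * indicator (\<phi> -` A \<inter> space M) x \<partial>Q)"
    using pre by (intro emeasure_density) (auto simp: m)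
  also have "\<dots> = r * (\<integral>\<^sup>+x. W x * (ennreal (exp (L x)) * indicator (\<phi> -` A \<inter> space M) x) \<partial>M)"
    unfolding Q_def using pre by (simp add: nn_integral_scale_measure nn_integral_density)
  also have "(\<integral>\<^sup>+x. W x * (ennreal (exp (L x)) * indicator (\<phi> -` A \<inter> space M) x) \<partial>M)
      = (\<integral>\<^sup>+x. V x * (D (\<phi> x) * indicator A (\<phi> x)) \<partial>M)"
  proof (rule nn_integral_cong)
    fix x assume x: "x \<in> space M"
    show "W x * (ennreal (exp (L x)) * indicator (\<phi> -` A \<inter> space M) x) = V x * (D (\<phi> x) * indicator A (\<phi> x))"
    proof (cases "V x = 0")
      case False
      then show ?thesis
        using W [OF x] L [OF x, symmetric] x by (simp add: mult_ac indicator_def)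
    qed (simp add: W [OF x])
  qed
  also have "\<dots> = (\<integral>\<^sup>+x. V x * (D x * indicator A x) \<partial>M)"
    by (rule inv) measurable
  also have "\<dots> = (\<integral>\<^sup>+x. W x * indicator A x \<partial>M)"
    by (intro nn_integral_cong) (simp add: W mult.assoc)
  also have "r * \<dots> = emeasure Q A"
    by (simp add: Q_def emeasure_density)
  finally show "emeasure (distr (density Q (\<lambda>x. ennreal (exp (L x)))) Q \<phi>) A = emeasure Q A" .
qed simp

section \<open>Histograms and Haar wavelets\<close>

text \<open>The case \<open>x = 1\<close> is separate because the last bin is closed; elsewhere the
  floor counts from 0 and the bins from 1.\<close>

definition bin_of :: "nat \<Rightarrow> real \<Rightarrow> nat" where
  "bin_of q x = (if x = 1 then q else nat \<lfloor>real q * x\<rfloor> + 1)"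

text \<open>Parametrised by the values on the bins, whereas \<open>histogram\<close> takes bin
  probabilities and carries a factor \<open>p\<close>.\<close>

definition step_fun :: "nat \<Rightarrow> (nat \<Rightarrow> real) \<Rightarrow> real \<Rightarrow> real" where
  "step_fun q c x = (\<Sum>\<kappa>=1..q. c \<kappa> * indicator (bin q \<kappa>) x)"

text \<open>The factor \<open>real q\<close> is the reciprocal of the bin length. These averages are
  the coefficients of the L2 projection, by \<open>hist_proj_eq\<close>.\<close>

definition bin_avg :: "nat \<Rightarrow> (real \<Rightarrow> real) \<Rightarrow> nat \<Rightarrow> real" where
  "bin_avg q g \<kappa> = real q * inner2 g (indicator (bin q \<kappa>))"

lemma bin_of_range:
  assumes "q \<ge> 1" "x \<in> {0..1}"
  shows "bin_of q x \<in> {1..q}"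
proof (cases "x = 1")
  case False
  then have "real q * x < real q"
    using assms by simp
  then have "\<lfloor>real q * x\<rfloor> < int q"
    by (simp add: floor_less_iff)
  then show ?thesis using False assms by (auto simp: bin_of_def)
qed (use assms in \<open>simp add: bin_of_def\<close>)

lemma in_bin_iff:
  assumes "q \<ge> 1" "x \<in> {0..1}" "\<kappa> \<in> {1..q}"
  shows "x \<in> bin q \<kappa> \<longleftrightarrow> bin_of q x = \<kappa>"
proof -
  have q: "real q > 0" using assms by simp
  have *: "bin_of q x = \<kappa> \<longleftrightarrow> real \<kappa> - 1 \<le> real q * x \<and> real q * x < real \<kappa>" if "x \<noteq> 1"
  proof -
    have "0 \<le> \<lfloor>real q * x\<rfloor>" using assms by simp
    then have "bin_of q x = \<kappa> \<longleftrightarrow> \<lfloor>real q * x\<rfloor> = int \<kappa> - 1"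
      using that assms by (auto simp: bin_of_def)
    also have "\<dots> \<longleftrightarrow> real \<kappa> - 1 \<le> real q * x \<and> real q * x < real \<kappa>"
      by (simp add: floor_eq_iff)
    finally show ?thesis .
  qed
  show ?thesis
  proof (cases "x = 1")
    case True
    have "1 \<notin> bin q \<kappa>" if "\<kappa> \<noteq> q"
      using that assms q by (auto simp: bin_def field_simps)
    moreover have "1 \<in> bin q q"
      using q by (simp add: bin_def field_simps)
    ultimately show ?thesis using True by (auto simp: bin_of_def)
  next
    case False
    moreover have "real q * x < real q" using False assms q by simp
    ultimately show ?thesis
      using * q assms(2) by (auto simp: bin_def field_simps)
  qed
qed

lemma bin_subset:
  assumes "q \<ge> 1" "\<kappa> \<in> {1..q}"
  shows "bin q \<kappa> \<subseteq> {0..1}"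
proof
  fix x assume x: "x \<in> bin q \<kappa>"
  have q: "real q > 0" using assms by simp
  show "x \<in> {0..1}"
  proof (cases "\<kappa> = q")
    case True
    have "0 \<le> (real q - 1) / real q" using assms by simp
    also have "\<dots> \<le> x" using x True by (simp add: bin_def)
    finally show ?thesis using x True by (simp add: bin_def)
  next
    case False
    have "0 \<le> (real \<kappa> - 1) / real q" using assms by simp
    also have "\<dots> \<le> x" using x False by (simp add: bin_def)
    finally have "0 \<le> x" .
    have "x < real \<kappa> / real q" using x False by (simp add: bin_def)
    also have "\<dots> \<le> 1" using assms q by simp
    finally show ?thesis using \<open>0 \<le> x\<close> by simp
  qed
qed

text \<open>For indices counted from 0 this is the division law for floors, \<lfloor>q x\<rfloor> =
  \<lfloor>q r x\<rfloor> div r; the shifts by 1 translate it to indices counted from 1. The closed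
  right endpoint is checked by hand.\<close>

lemma bin_of_nested:
  assumes "q \<ge> 1" "r \<ge> 1" "x \<in> {0..1}"
  shows "bin_of q x = (bin_of (q * r) x - 1) div r + 1"
proof (cases "x = 1")
  case True
  have "(q * r - 1) div r = q - 1"
  proof -
    obtain q' r' where "q = Suc q'" "r = Suc r'"
      using assms by (metis Suc_le_D One_nat_def)
    then have "q * r - 1 = r' + q' * r" "r' < r" by simp_all
    then show ?thesis using \<open>q = Suc q'\<close> by simp
  qed
  then show ?thesis using True assms by (simp add: bin_of_def)
next
  case False
  have "\<lfloor>real q * x\<rfloor> = \<lfloor>real (q * r) * x / real_of_int (int r)\<rfloor>"
    using assms by (simp add: field_simps)
  also have "\<dots> = \<lfloor>real (q * r) * x\<rfloor> div int r"
    by (rule floor_divide_real_eq_div) simp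
  finally show ?thesis
    using False assms by (simp add: bin_of_def nat_div_distrib)
qed

lemma bin_sets [measurable]: "bin q \<kappa> \<in> sets borel"
  by (simp add: bin_def)

lemma measure_bin:
  assumes "q \<ge> 1"
  shows "measure lborel (bin q \<kappa>) = 1 / real q" "emeasure lborel (bin q \<kappa>) < \<infinity>"
proof -
  have "measure lborel (bin q \<kappa>) = 1 / real q \<and> emeasure lborel (bin q \<kappa>) < \<infinity>"
  proof (cases "\<kappa> = q")
    case True
    have "(real q - 1) / real q \<le> 1" "1 - (real q - 1) / real q = 1 / real q"
      using assms by (auto simp: field_simps)
    then show ?thesis using True by (simp add: bin_def)
  next
    case False
    have "(real \<kappa> - 1) / real q \<le> real \<kappa> / real q" "real \<kappa> / real q - (real \<kappa> - 1) / real q = 1 / real q"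
      using assms by (auto simp: field_simps)
    then show ?thesis using False by (simp add: bin_def)
  qed
  then show "measure lborel (bin q \<kappa>) = 1 / real q" "emeasure lborel (bin q \<kappa>) < \<infinity>"
    by auto
qed

lemma step_eq:
  assumes "q \<ge> 1" "x \<in> {0..1}"
  shows "step_fun q c x = c (bin_of q x)"
proof -
  have "step_fun q c x = (\<Sum>\<kappa>=1..q. if bin_of q x = \<kappa> then c \<kappa> else 0)"
    unfolding step_fun_def by (rule sum.cong) (auto simp: in_bin_iff [OF assms] indicator_def)
  also have "\<dots> = c (bin_of q x)"
    using bin_of_range [OF assms] by simp
  finally show ?thesis .
qed

lemma measurable_step [measurable]: "step_fun q c \<in> borel_measurable borel"
  unfolding step_fun_def [abs_def] by measurable

lemma measurable_haar [measurable]: "haar j k \<in> borel_measurable borel"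
  unfolding haar_def [abs_def] by measurable

lemma measurable_haar_sum [measurable]: "haar_sum J \<theta> \<in> borel_measurable borel"
  unfolding haar_sum_def [abs_def] split_beta by measurable

section \<open>Inner products, bin averages and the projection onto histograms\<close>

lemma inner2_cong:
  assumes "\<And>x. x \<in> {0..1} \<Longrightarrow> g x * h x = g' x * h' x"
  shows "inner2 g h = inner2 g' h'"
  unfolding inner2_def using assms by (intro set_lebesgue_integral_cong) auto

lemma inner2_commute: "inner2 g h = inner2 h g"
  by (rule inner2_cong) simp

text \<open>Measurability is demanded of the restriction to the unit interval only, since
  \<open>a\<close> and \<open>f0\<close> are arbitrary functions outside it.\<close>

definition bounded_on_unit :: "real \<Rightarrow> (real \<Rightarrow> real) \<Rightarrow> bool" where
  "bounded_on_unit B g \<longleftrightarrow> set_borel_measurable lborel {0..1} g \<and> (\<forall>x\<in>{0..1}. \<bar>g x\<bar> \<le> B)"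

lemma bounded_on_unit_mult:
  assumes "bounded_on_unit B g" "bounded_on_unit C h"
  shows "bounded_on_unit (B * C) (\<lambda>x. g x * h x)"
proof -
  have "(\<lambda>x. (indicator {0..1} x *\<^sub>R g x) * (indicator {0..1} x *\<^sub>R h x)) \<in> borel_measurable lborel"
    using assms unfolding bounded_on_unit_def set_borel_measurable_def by (intro borel_measurable_times) auto
  also have "(\<lambda>x. (indicator {0..1} x *\<^sub>R g x) * (indicator {0..1} x *\<^sub>R h x)) = (\<lambda>x. indicator {0..1} x *\<^sub>R (g x * h x))"
    by (auto simp: indicator_def)
  finally have "set_borel_measurable lborel {0..1} (\<lambda>x. g x * h x)"
    unfolding set_borel_measurable_def .
  moreover have "\<bar>g x * h x\<bar> \<le> B * C" if "x \<in> {0..1}" for x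
    unfolding abs_mult using assms that unfolding bounded_on_unit_def
    by (intro mult_mono) (auto intro: order_trans [OF abs_ge_zero])
  ultimately show ?thesis
    unfolding bounded_on_unit_def by blast
qed

lemma bounded_on_unit_borel:
  assumes "g \<in> borel_measurable borel" "\<And>x. x \<in> {0..1} \<Longrightarrow> \<bar>g x\<bar> \<le> B"
  shows "bounded_on_unit B g"
  using assms unfolding bounded_on_unit_def set_borel_measurable_def by simp

lemma bounded_on_unit_integrable:
  assumes "bounded_on_unit B g"
  shows "set_integrable lborel {0..1} g"
  unfolding set_integrable_def
proof (rule Bochner_Integration.integrable_bound)
  show "integrable lborel (\<lambda>x::real. indicator {0..1} x * B)"
    by (intro integrable_mult_left integrable_real_indicator) auto
  show "(\<lambda>x. indicator {0..1} x *\<^sub>R g x) \<in> borel_measurable lborel"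
    using assms by (simp add: bounded_on_unit_def set_borel_measurable_def)
  show "AE x in lborel. norm (indicator {0..1} x *\<^sub>R g x) \<le> norm (indicator {0..1} x * B)"
    using assms by (intro AE_I2) (force simp: bounded_on_unit_def indicator_def)
qed

lemma bounded_on_unit_indicator: "A \<in> sets borel \<Longrightarrow> bounded_on_unit 1 (indicator A)"
  by (rule bounded_on_unit_borel) (auto simp: indicator_def)

lemma bounded_on_unit_step:
  assumes "q \<ge> 1" "\<And>\<kappa>. \<kappa> \<in> {1..q} \<Longrightarrow> \<bar>c \<kappa>\<bar> \<le> B"
  shows "bounded_on_unit B (step_fun q c)"
  using assms bin_of_range [OF assms(1)] by (intro bounded_on_unit_borel) (auto simp: step_eq)

lemma inner2_sum_right:
  assumes "bounded_on_unit B g" "finite I" "\<And>i. i \<in> I \<Longrightarrow> bounded_on_unit (C i) (h i)"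
  shows "inner2 g (\<lambda>x. \<Sum>i\<in>I. c i * h i x) = (\<Sum>i\<in>I. c i * inner2 g (h i))"
proof -
  have "set_integrable lborel {0..1} (\<lambda>x. c i * (g x * h i x))" if "i \<in> I" for i
    using bounded_on_unit_integrable [OF bounded_on_unit_mult [OF assms(1) assms(3) [OF that]]]
    by (intro set_integrable_mult_right) auto
  then have "(LINT x:{0..1}|lborel. (\<Sum>i\<in>I. c i * (g x * h i x))) = (\<Sum>i\<in>I. LINT x:{0..1}|lborel. c i * (g x * h i x))"
    unfolding set_integrable_def set_lebesgue_integral_def
    by (subst Bochner_Integration.integral_sum [symmetric]) (auto simp: sum_distrib_left)
  then show ?thesis
    by (simp add: inner2_def sum_distrib_left mult_ac)
qed

lemma inner2_diff_right:
  assumes "bounded_on_unit B g" "bounded_on_unit C h" "bounded_on_unit D h'"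
  shows "inner2 g (\<lambda>x. h x - h' x) = inner2 g h - inner2 g h'"
  unfolding inner2_def right_diff_distrib
  using assms by (intro set_integral_diff bounded_on_unit_integrable [OF bounded_on_unit_mult])

lemma inner2_le:
  assumes "bounded_on_unit B g" "0 \<le> B" "A \<in> sets borel" "A \<subseteq> {0..1}"
  shows "\<bar>inner2 g (indicator A)\<bar> \<le> B * measure lborel A"
proof -
  have fin: "emeasure lborel A < \<infinity>"
    using emeasure_mono [OF assms(4), of lborel] by (auto intro: le_less_trans)
  have "\<bar>inner2 g (indicator A)\<bar> \<le> (\<integral>x. \<bar>indicator {0..1} x *\<^sub>R (g x * indicator A x)\<bar> \<partial>lborel)"
    unfolding inner2_def set_lebesgue_integral_def
    using integral_norm_bound [of lborel "\<lambda>x. indicator {0..1} x *\<^sub>R (g x * indicator A x)"] by simp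
  also have "\<dots> \<le> (\<integral>x. B * indicator A x \<partial>lborel)"
  proof (rule integral_mono)
    show "integrable lborel (\<lambda>x. \<bar>indicator {0..1} x *\<^sub>R (g x * indicator A x)\<bar>)"
      using bounded_on_unit_integrable [OF bounded_on_unit_mult [OF assms(1) bounded_on_unit_indicator [OF assms(3)]]]
      unfolding set_integrable_def by (rule integrable_abs)
    show "\<bar>indicator {0..1} x *\<^sub>R (g x * indicator A x)\<bar> \<le> B * indicator A x" for x
      using assms(1,2,4) by (auto simp: bounded_on_unit_def indicator_def)
  qed (use fin assms(3) in auto)
  also have "\<dots> = B * measure lborel A"
    using fin assms(3) by simp
  finally show ?thesis .
qed

lemma bin_avg_le:
  assumes "q \<ge> 1" "bounded_on_unit B g" "0 \<le> B" "\<kappa> \<in> {1..q}"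
  shows "\<bar>bin_avg q g \<kappa>\<bar> \<le> B"
  using mult_left_mono [OF inner2_le [OF assms(2,3) bin_sets bin_subset [OF assms(1,4)]], of "real q"] assms(1)
  by (simp add: bin_avg_def measure_bin(1) abs_mult)

lemma inner2_bin_const:
  assumes "q \<ge> 1" "\<kappa> \<in> {1..q}" "\<And>x. x \<in> bin q \<kappa> \<Longrightarrow> g x = c"
  shows "inner2 g (indicator (bin q \<kappa>)) = c / real q"
proof -
  have "inner2 g (indicator (bin q \<kappa>)) = (\<integral>x. c * indicator (bin q \<kappa>) x \<partial>lborel)"
    unfolding inner2_def set_lebesgue_integral_def using bin_subset [OF assms(1,2)] assms(3)
    by (intro Bochner_Integration.integral_cong) (auto simp: indicator_def)
  then show ?thesis
    using measure_bin [OF assms(1), of \<kappa>] by simp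
qed

lemma inner2_step:
  assumes "bounded_on_unit B g"
  shows "inner2 g (step_fun q c) = (\<Sum>\<kappa>=1..q. c \<kappa> * inner2 g (indicator (bin q \<kappa>)))"
  unfolding step_fun_def [abs_def]
  by (rule inner2_sum_right [OF assms]) (auto intro: bounded_on_unit_indicator)

lemma bin_avg_step:
  assumes "q \<ge> 1" "\<kappa> \<in> {1..q}"
  shows "bin_avg q (step_fun q c) \<kappa> = c \<kappa>"
proof -
  have "inner2 (step_fun q c) (indicator (bin q \<kappa>)) = c \<kappa> / real q"
    using assms bin_subset [OF assms] by (intro inner2_bin_const) (auto simp: step_eq in_bin_iff)
  then show ?thesis using assms by (simp add: bin_avg_def)
qed

text \<open>\<open>hist_proj\<close> is a definite description, so uniqueness is as important as
  orthogonality. Against step functions the inner product of the residual is diagonal in the bins,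
  and the coefficients in \<open>{1..q}\<close> determine a step function at every real
  point.\<close>

lemma hist_proj_eq:
  assumes q: "q \<ge> 1" and g: "bounded_on_unit B g"
  shows "hist_proj q g = step_fun q (bin_avg q g)"
  unfolding hist_proj_def
proof (rule the_equality)
  have range: "hist_space q = range (step_fun q)"
    by (auto simp: hist_space_def step_fun_def [abs_def])
  have bdd: "bounded_on_unit (\<Sum>\<kappa>=1..q. \<bar>c \<kappa>\<bar>) (step_fun q c)" for c
    using q by (intro bounded_on_unit_step member_le_sum) auto
  have key: "inner2 (\<lambda>x. g x - step_fun q c x) (step_fun q e)
      = (\<Sum>\<kappa>=1..q. e \<kappa> * (bin_avg q g \<kappa> - c \<kappa>) / real q)" for c e
  proof -
    have "inner2 (\<lambda>x. g x - step_fun q c x) (step_fun q e) = inner2 (step_fun q e) g - inner2 (step_fun q e) (step_fun q c)"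
      by (subst inner2_commute) (rule inner2_diff_right [OF bdd g bdd])
    also have "inner2 (step_fun q e) g = inner2 g (step_fun q e)"
      by (rule inner2_commute)
    also have "inner2 (step_fun q e) (step_fun q c) = inner2 (step_fun q c) (step_fun q e)"
      by (rule inner2_commute)
    also have "inner2 g (step_fun q e) - inner2 (step_fun q c) (step_fun q e)
        = (\<Sum>\<kappa>=1..q. e \<kappa> * (inner2 g (indicator (bin q \<kappa>)) - inner2 (step_fun q c) (indicator (bin q \<kappa>))))"
      by (simp add: inner2_step [OF g] inner2_step [OF bdd] right_diff_distrib sum_subtractf)
    also have "\<dots> = (\<Sum>\<kappa>=1..q. e \<kappa> * (bin_avg q g \<kappa> - c \<kappa>) / real q)"
    proof (rule sum.cong [OF refl])
      fix \<kappa> assume "\<kappa> \<in> {1..q}"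
      then have "bin_avg q (step_fun q c) \<kappa> = c \<kappa>"
        using q by (intro bin_avg_step)
      then show "e \<kappa> * (inner2 g (indicator (bin q \<kappa>)) - inner2 (step_fun q c) (indicator (bin q \<kappa>)))
          = e \<kappa> * (bin_avg q g \<kappa> - c \<kappa>) / real q"
        using q by (simp add: bin_avg_def field_simps)
    qed
    finally show ?thesis .
  qed
  show "step_fun q (bin_avg q g) \<in> hist_space q \<and>
      (\<forall>e\<in>hist_space q. inner2 (\<lambda>x. g x - step_fun q (bin_avg q g) x) e = 0)"
    unfolding range by (auto simp: key)
  fix h assume h: "h \<in> hist_space q \<and> (\<forall>e\<in>hist_space q. inner2 (\<lambda>x. g x - h x) e = 0)"
  then obtain c where c: "h = step_fun q c" unfolding range by auto
  have "c \<kappa> = bin_avg q g \<kappa>" if \<kappa>: "\<kappa> \<in> {1..q}" for \<kappa>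
  proof -
    \<comment> \<open>A test function supported on one bin isolates one coefficient.\<close>
    have "inner2 (\<lambda>x. g x - step_fun q c x) (step_fun q (\<lambda>\<mu>. if \<mu> = \<kappa> then 1 else 0)) = 0"
      using h c unfolding range by auto
    then have "(\<Sum>\<mu>=1..q. if \<mu> = \<kappa> then (bin_avg q g \<mu> - c \<mu>) / real q else 0) = 0"
      unfolding key by (simp add: if_distrib [of "\<lambda>x. x * _ / _"] cong: if_cong)
    then show ?thesis using \<kappa> q by simp
  qed
  then show "h = step_fun q (bin_avg q g)"
    unfolding c step_fun_def [abs_def] by (intro ext sum.cong) auto
qed

lemma centring_eq:
  assumes "p \<ge> 1" "bounded_on_unit B g" "\<And>i. i \<in> {1..n} \<Longrightarrow> X i \<in> {0..1}"
  shows "centring p g n X = (\<Sum>i=1..n. bin_avg p g (bin_of p (X i))) / real n"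
  unfolding centring_def empirical_def hist_proj_eq [OF assms(1,2)]
  using assms by (auto simp: step_eq intro!: sum.cong arg_cong2 [where f = "(/)"])

lemma inner2_histogram:
  assumes "bounded_on_unit B g"
  shows "inner2 g (histogram p \<omega>) = (\<Sum>\<mu>=1..p. \<omega> \<mu> * bin_avg p g \<mu>)"
proof -
  have "histogram p \<omega> = step_fun p (\<lambda>\<mu>. real p * \<omega> \<mu>)"
    by (rule ext) (simp only: histogram_def step_fun_def sum_distrib_left mult.assoc)
  then show ?thesis
    using inner2_step [OF assms] by (simp add: bin_avg_def mult_ac)
qed

section \<open>Haar wavelets and dyadic averages\<close>

lemma dyadic_children:
  fixes k :: nat
  assumes "k \<in> {1..2 ^ j}"
  shows "2 * k - 1 \<in> {1..2 ^ (j + 1)}" "2 * k \<in> {1..2 ^ (j + 1)}"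
  using assms by auto

lemma haar_eq:
  assumes "x \<in> {0..1}" "k \<in> {1..2 ^ j}"
  shows "haar j k x = 2 powr (real j / 2) *
     ((if bin_of (2 ^ (j + 1)) x = 2 * k - 1 then 1 else 0) - (if bin_of (2 ^ (j + 1)) x = 2 * k then 1 else 0))"
proof -
  have "2 * k - 1 \<in> {1..2 ^ (j + 1)}" "2 * k \<in> {1..2 ^ (j + 1)}"
    using assms by auto
  then show ?thesis
    using assms(1) by (simp only: haar_def indicator_def in_bin_iff of_bool_def) (auto simp: in_bin_iff)
qed

lemma haar_abs_le: "\<bar>haar j k x\<bar> \<le> 2 powr (real j / 2)"
  by (auto simp: haar_def indicator_def)

lemma bounded_on_unit_haar: "bounded_on_unit (2 powr (real j / 2)) (haar j k)"
  by (rule bounded_on_unit_borel) (auto simp: haar_abs_le)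

lemma inner2_haar:
  assumes "bounded_on_unit B g"
  shows "inner2 (haar j k) g = 2 powr (real j / 2) *
     (inner2 g (indicator (bin (2 ^ (j + 1)) (2 * k - 1))) - inner2 g (indicator (bin (2 ^ (j + 1)) (2 * k))))"
proof -
  let ?I = "\<lambda>i. if i then indicator (bin (2 ^ (j + 1)) (2 * k - 1)) else indicator (bin (2 ^ (j + 1)) (2 * k)) :: real \<Rightarrow> real"
  let ?c = "\<lambda>i. if i then 2 powr (real j / 2) else - (2 powr (real j / 2))"
  have "haar j k = (\<lambda>x. \<Sum>i\<in>UNIV. ?c i * ?I i x)"
    by (auto simp: haar_def UNIV_bool right_diff_distrib)
  moreover have "bounded_on_unit 1 (?I i)" for i
    by (cases i) (auto intro: bounded_on_unit_indicator)
  ultimately have "inner2 g (haar j k) = (\<Sum>i\<in>UNIV. ?c i * inner2 g (?I i))"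
    by (simp only: inner2_sum_right [OF assms, where C = "\<lambda>_. 1"] finite)
  then show ?thesis
    by (simp add: inner2_commute [of "haar j k"] UNIV_bool right_diff_distrib)
qed

text \<open>Height \<open>2 powr (real j / 2)\<close> on an interval of length 2^-j gives the
  wavelet the L1 norm \<open>2 powr (- real j / 2)\<close>. This decay explains why the prior enters
  through the sum of 2^(j/2)/\<sigma>_j.\<close>

lemma inner2_haar_le:
  assumes g: "bounded_on_unit B g" "0 \<le> B" and k: "k \<in> {1..2 ^ j}"
  shows "\<bar>inner2 (haar j k) g\<bar> \<le> B * 2 powr (- real j / 2)"
proof -
  let ?q = "2 ^ (j + 1) :: nat"
  have le: "\<bar>inner2 g (indicator (bin ?q \<kappa>))\<bar> \<le> B / 2 ^ (j + 1)" if "\<kappa> \<in> {1..?q}" for \<kappa>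
    using inner2_le [OF g bin_sets bin_subset [OF _ that]] measure_bin(1) [of ?q \<kappa>] by simp
  have "\<bar>inner2 (haar j k) g\<bar> \<le> 2 powr (real j / 2) * (B / 2 ^ (j + 1) + B / 2 ^ (j + 1))"
    unfolding inner2_haar [OF g(1)] abs_mult
    using le [OF dyadic_children(1) [OF k]] le [OF dyadic_children(2) [OF k]] by (intro mult_mono) auto
  also have "\<dots> = B * (2 powr (real j / 2) / 2 powr real j)"
    by (simp add: powr_realpow)
  also have "2 powr (real j / 2) / 2 powr real j = 2 powr (- real j / 2)"
    by (simp flip: powr_diff add: field_simps)
  finally show ?thesis .
qed

text \<open>The two halves partition the dyadic interval, by \<open>bin_of_nested\<close> with
  \<open>r = 2\<close>.\<close>

lemma inner2_dyadic_split:
  assumes g: "bounded_on_unit B g" and k: "k \<in> {1..2 ^ j}"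
  shows "inner2 g (indicator (bin (2 ^ j) k)) = inner2 g (indicator (bin (2 ^ (j + 1)) (2 * k - 1)))
           + inner2 g (indicator (bin (2 ^ (j + 1)) (2 * k)))"
proof -
  let ?I = "\<lambda>i. if i then indicator (bin (2 ^ (j + 1)) (2 * k - 1)) else indicator (bin (2 ^ (j + 1)) (2 * k)) :: real \<Rightarrow> real"
  have r: "2 * k - 1 \<in> {1..2 ^ (j + 1)}" "2 * k \<in> {1..2 ^ (j + 1)}" using k by auto
  have "inner2 g (indicator (bin (2 ^ j) k)) = inner2 g (\<lambda>x. \<Sum>i\<in>UNIV. 1 * ?I i x)"
  proof (rule inner2_cong)
    fix x :: real assume x: "x \<in> {0..1}"
    have "bin_of (2 ^ j) x = (bin_of (2 ^ (j + 1)) x - 1) div 2 + 1"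
      using bin_of_nested [of "2 ^ j" 2 x] x by (simp add: mult.commute)
    moreover have "bin_of (2 ^ (j + 1)) x \<ge> 1"
      using bin_of_range [of "2 ^ (j + 1)" x] x by simp
    moreover have "(m - 1) div 2 + 1 = k \<longleftrightarrow> m = 2 * k - 1 \<or> m = 2 * k" if "m \<ge> 1" for m :: nat
      using k that by auto
    ultimately have "bin_of (2 ^ j) x = k \<longleftrightarrow> bin_of (2 ^ (j + 1)) x = 2 * k - 1 \<or> bin_of (2 ^ (j + 1)) x = 2 * k"
      by simp
    moreover have "2 * k - 1 \<noteq> 2 * k" using k by auto
    ultimately show "g x * indicator (bin (2 ^ j) k) x = g x * (\<Sum>i\<in>UNIV. 1 * ?I i x)"
      using in_bin_iff [OF _ x k] in_bin_iff [OF _ x r(1)] in_bin_iff [OF _ x r(2)]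
      by (auto simp: UNIV_bool indicator_def)
  qed
  also have "\<dots> = (\<Sum>i\<in>UNIV. 1 * inner2 g (?I i))"
    by (rule inner2_sum_right [OF g, where C = "\<lambda>_. 1"]) (auto intro: bounded_on_unit_indicator)
  finally show ?thesis by (simp add: UNIV_bool)
qed

text \<open>One summand of a telescoping sum over the levels.\<close>

lemma haar_level_expansion:
  assumes g: "bounded_on_unit B g" and x: "x \<in> {0..1}"
  shows "(\<Sum>k=1..2 ^ j. inner2 (haar j k) g * haar j k x)
       = bin_avg (2 ^ (j + 1)) g (bin_of (2 ^ (j + 1)) x) - bin_avg (2 ^ j) g (bin_of (2 ^ j) x)"
proof -
  define \<kappa> where "\<kappa> = bin_of (2 ^ (j + 1)) x"
  define k0 where "k0 = bin_of (2 ^ j) x"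
  have k0: "k0 = (\<kappa> - 1) div 2 + 1"
    using bin_of_nested [of "2 ^ j" 2 x] x by (simp add: k0_def \<kappa>_def mult.commute)
  have \<kappa>: "\<kappa> \<ge> 1" and k0_range: "k0 \<in> {1..2 ^ j}"
    using bin_of_range [of "2 ^ (j + 1)" x] bin_of_range [of "2 ^ j" x] x by (auto simp: \<kappa>_def k0_def)
  have cases: "\<kappa> = 2 * k0 - 1 \<or> \<kappa> = 2 * k0"
    using \<kappa> k0 by auto
  let ?I = "\<lambda>\<mu>. inner2 g (indicator (bin (2 ^ (j + 1)) \<mu>))"
  \<comment> \<open>At each level only the wavelet whose support contains \<open>x\<close>
    survives.\<close>
  have "(\<Sum>k=1..2 ^ j. inner2 (haar j k) g * haar j k x)
      = (\<Sum>k=1..2 ^ j. if k = k0 then inner2 (haar j k) g * haar j k x else 0)"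
  proof (rule sum.cong [OF refl])
    fix k :: nat assume k: "k \<in> {1..2 ^ j}"
    have "haar j k x = 0" if "k \<noteq> k0"
      using that cases k k0_range unfolding haar_eq [OF x k] \<kappa>_def [symmetric] by auto
    then show "inner2 (haar j k) g * haar j k x = (if k = k0 then inner2 (haar j k) g * haar j k x else 0)"
      by auto
  qed
  also have "\<dots> = inner2 (haar j k0) g * haar j k0 x"
    using k0_range by simp
  also have "\<dots> = (2 powr (real j / 2) * 2 powr (real j / 2)) * (?I (2 * k0 - 1) - ?I (2 * k0)) * (if \<kappa> = 2 * k0 - 1 then 1 else - 1)"
    using cases k0_range unfolding inner2_haar [OF g] haar_eq [OF x k0_range] \<kappa>_def [symmetric] by auto
  also have "2 powr (real j / 2) * 2 powr (real j / 2) = (2 ^ j :: real)"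
    by (simp flip: powr_add add: powr_realpow)
  \<comment> \<open>Whichever half contains \<open>x\<close>, its integral minus that of the other
    half is twice its integral minus the sum of both. After scaling this is the average over the
    half minus the average over the whole interval.\<close>
  also have "2 ^ j * (?I (2 * k0 - 1) - ?I (2 * k0)) * (if \<kappa> = 2 * k0 - 1 then 1 else - 1)
      = 2 ^ (j + 1) * ?I \<kappa> - 2 ^ j * (?I (2 * k0 - 1) + ?I (2 * k0))"
    using cases k0_range by (auto simp: algebra_simps)
  also have "?I (2 * k0 - 1) + ?I (2 * k0) = inner2 g (indicator (bin (2 ^ j) k0))"
    using inner2_dyadic_split [OF g k0_range] by simp
  finally show ?thesis
    by (simp add: bin_avg_def \<kappa>_def k0_def)
qed

lemma haar_sum_eq_levels: "haar_sum J \<theta> x = (\<Sum>j=0..J. \<Sum>k=1..2 ^ j. \<theta> (j, k) * haar j k x)"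
  unfolding haar_sum_def haar_index_def by (subst sum.Sigma) auto

text \<open>The level sums telescope down to the global mean. Consequently a shift of \<theta> by
  \<open>t\<close> times the Haar coefficients of \<open>g\<close> multiplies the density by the
  exponential of \<open>t\<close> times the projection of \<open>g\<close>, up to a constant that
  the log-normaliser absorbs.\<close>

lemma haar_sum_coefficients:
  assumes g: "bounded_on_unit B g" and x: "x \<in> {0..1}"
  shows "haar_sum J (\<lambda>(j, k). inner2 (haar j k) g) x
       = bin_avg (2 ^ (J + 1)) g (bin_of (2 ^ (J + 1)) x) - bin_avg 1 g 1"
proof -
  have "haar_sum J (\<lambda>(j, k). inner2 (haar j k) g) x
      = (\<Sum>j=0..J. bin_avg (2 ^ Suc j) g (bin_of (2 ^ Suc j) x) - bin_avg (2 ^ j) g (bin_of (2 ^ j) x))"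
    using haar_level_expansion [OF g x] by (simp add: haar_sum_eq_levels)
  also have "\<dots> = bin_avg (2 ^ Suc J) g (bin_of (2 ^ Suc J) x) - bin_avg (2 ^ 0) g (bin_of (2 ^ 0) x)"
    by (rule sum_Suc_diff) simp
  finally show ?thesis
    using bin_of_range [of 1 x] x by simp
qed

lemma haar_const_on_bin:
  assumes "j < i" "k \<in> {1..2 ^ j}" "x \<in> {0..1}" "y \<in> {0..1}" "bin_of (2 ^ i) x = bin_of (2 ^ i) y"
  shows "haar j k x = haar j k y"
proof -
  have "i = (j + 1) + (i - j - 1)" using assms(1) by simp
  then have "(2::nat) ^ i = 2 ^ (j + 1) * 2 ^ (i - j - 1)"
    by (metis power_add)
  then have "bin_of (2 ^ (j + 1)) x = bin_of (2 ^ (j + 1)) y"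
    using bin_of_nested [of "2 ^ (j + 1)" "2 ^ (i - j - 1)" x] bin_of_nested [of "2 ^ (j + 1)" "2 ^ (i - j - 1)" y] assms
    by simp
  then show ?thesis
    using assms by (simp add: haar_eq)
qed

lemma inner2_haar_const: "k \<in> {1..2 ^ j} \<Longrightarrow> inner2 (haar j k) (\<lambda>_. c) = 0"
proof -
  assume k: "k \<in> {1..2 ^ j}"
  have "bounded_on_unit \<bar>c\<bar> (\<lambda>_. c)"
    by (rule bounded_on_unit_borel) auto
  moreover have "inner2 (\<lambda>_. c) (indicator (bin (2 ^ (j + 1)) \<kappa>)) = c / real (2 ^ (j + 1))" if "\<kappa> \<in> {1..2 ^ (j + 1)}" for \<kappa>
    using that by (intro inner2_bin_const) auto
  from this [OF dyadic_children(1) [OF k]] this [OF dyadic_children(2) [OF k]]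
  have "inner2 (\<lambda>_. c) (indicator (bin (2 ^ (j + 1)) (2 * k - 1))) = inner2 (\<lambda>_. c) (indicator (bin (2 ^ (j + 1)) (2 * k)))"
    by simp
  ultimately show ?thesis
    by (subst inner2_haar) auto
qed

text \<open>The coarser wavelet is constant on the dyadic interval that carries the finer one, and
  there the two halves of the finer one cancel.\<close>

lemma inner2_haar_haar_less:
  assumes "j' < j" "k \<in> {1..2 ^ j}" "k' \<in> {1..2 ^ j'}"
  shows "inner2 (haar j k) (haar j' k') = 0"
proof -
  let ?q = "2 ^ (j + 1) :: nat"
  \<comment> \<open>The left endpoint of the interval carrying the finer wavelet, used as a
    reference point for the constant value of the coarser one.\<close>
  define y where "y = (real k - 1) / 2 ^ j"
  have y: "y \<in> {0..1}" "y \<in> bin (2 ^ j) k"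
  proof -
    have "real k \<le> real (2 ^ j)"
      using assms(2) by (subst of_nat_le_iff) simp
    then have "real k \<le> 1 + 2 ^ j"
      unfolding of_nat_power of_nat_numeral by linarith
    then show "y \<in> {0..1}" "y \<in> bin (2 ^ j) k"
      using assms(2) by (auto simp: y_def bin_def field_simps)
  qed
  have r: "2 * k - 1 \<in> {1..?q}" "2 * k \<in> {1..?q}" using assms by auto
  have "inner2 (haar j' k') (indicator (bin ?q \<kappa>)) = haar j' k' y / real ?q"
    if \<kappa>: "\<kappa> = 2 * k - 1 \<or> \<kappa> = 2 * k" for \<kappa>
  proof (rule inner2_bin_const)
    show \<kappa>_range: "\<kappa> \<in> {1..?q}" using r \<kappa> by auto
    fix x assume x: "x \<in> bin ?q \<kappa>"
    then have x01: "x \<in> {0..1}"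
      using bin_subset [OF _ \<kappa>_range] by auto
    have "bin_of (2 ^ j) x = (bin_of ?q x - 1) div 2 + 1"
      using bin_of_nested [of "2 ^ j" 2 x] x01 by (simp add: mult.commute)
    also have "bin_of ?q x = \<kappa>"
      using in_bin_iff [OF _ x01 \<kappa>_range] x by simp
    also have "(\<kappa> - 1) div 2 + 1 = k"
      using \<kappa> assms(2) by auto
    finally show "haar j' k' x = haar j' k' y"
      using in_bin_iff [OF _ y(1) assms(2)] y x01 assms by (intro haar_const_on_bin [of j' j]) auto
  qed simp
  then show ?thesis
    by (simp only: inner2_haar [OF bounded_on_unit_haar]) simp
qed

lemma inner2_haar_haar:
  assumes "k \<in> {1..2 ^ j}" "k' \<in> {1..2 ^ j'}"
  shows "inner2 (haar j k) (haar j' k') = (if j = j' \<and> k = k' then 1 else 0)"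
proof (cases j j' rule: linorder_cases)
  case less
  then show ?thesis
    using inner2_haar_haar_less [OF less assms(2,1)] by (simp add: inner2_commute)
next
  case greater
  then show ?thesis using inner2_haar_haar_less [OF greater assms] by simp
next
  case equal
  let ?q = "2 ^ (j + 1) :: nat"
  have "inner2 (haar j k') (indicator (bin ?q \<kappa>)) = 2 powr (real j / 2) * ((if \<kappa> = 2 * k' - 1 then 1 else 0) - (if \<kappa> = 2 * k' then 1 else 0)) / real ?q"
    if \<kappa>: "\<kappa> \<in> {1..?q}" for \<kappa>
  proof (rule inner2_bin_const)
    fix x assume x: "x \<in> bin ?q \<kappa>"
    have "1 \<le> ?q" by simp
    then have "x \<in> {0..1}" using x bin_subset [OF _ \<kappa>] by blast
    moreover from this have "bin_of ?q x = \<kappa>" using x in_bin_iff [OF \<open>1 \<le> ?q\<close> _ \<kappa>] by blast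
    moreover have "k' \<in> {1..2 ^ j}" using assms(2) equal by simp
    ultimately show "haar j k' x = 2 powr (real j / 2) * ((if \<kappa> = 2 * k' - 1 then 1 else 0) - (if \<kappa> = 2 * k' then 1 else 0))"
      by (simp only: haar_eq)
  qed (use \<kappa> in simp_all)
  moreover have "2 * k - 1 \<in> {1..?q}" "2 * k \<in> {1..?q}" using assms by auto
  ultimately have "inner2 (haar j k) (haar j k') = 2 powr (real j / 2) *
      (2 powr (real j / 2) * ((if 2 * k - 1 = 2 * k' - 1 then 1 else 0) - (if 2 * k - 1 = 2 * k' then 1 else 0)) / real ?q
      - 2 powr (real j / 2) * ((if 2 * k = 2 * k' - 1 then 1 else 0) - (if 2 * k = 2 * k' then 1 else 0)) / real ?q)"
    by (simp only: inner2_haar [OF bounded_on_unit_haar])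
  also have "\<dots> = 2 powr (real j / 2) * 2 powr (real j / 2) * (if k = k' then 2 else 0) / real ?q"
  proof -
    have "k \<ge> 1" "k' \<ge> 1" using assms by auto
    then have "2 * k - 1 \<noteq> 2 * k'" "2 * k \<noteq> 2 * k' - 1" "2 * k - 1 = 2 * k' - 1 \<longleftrightarrow> k = k'"
      by presburger+
    then show ?thesis by simp
  qed
  also have "2 powr (real j / 2) * 2 powr (real j / 2) = (2 ^ j :: real)"
    by (simp flip: powr_add add: powr_realpow)
  finally show ?thesis using equal by (cases "k = k'") simp_all
qed

lemma finite_haar_index [simp]: "finite (haar_index J)"
  by (simp add: haar_index_def)

text \<open>Orthonormality selects one coefficient and constants are orthogonal to all wavelets.
  With \<open>c\<close> the log-normaliser this recovers \<theta> from ln f, as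
  \<open>haar_functional\<close> requires.\<close>

lemma inner2_haar_haar_sum:
  assumes "(j, k) \<in> haar_index J"
  shows "inner2 (haar j k) (\<lambda>x. haar_sum J \<theta> x - c) = \<theta> (j, k)"
proof -
  have jk: "k \<in> {1..2 ^ j}" using assms by (auto simp: haar_index_def)
  have "bounded_on_unit (\<Sum>i\<in>haar_index J. \<bar>\<theta> i\<bar> * 2 powr (real (fst i) / 2)) (haar_sum J \<theta>)"
  proof (rule bounded_on_unit_borel)
    show "\<bar>haar_sum J \<theta> x\<bar> \<le> (\<Sum>i\<in>haar_index J. \<bar>\<theta> i\<bar> * 2 powr (real (fst i) / 2))" for x
      unfolding haar_sum_def
      by (rule order_trans [OF sum_abs]) (auto intro!: sum_mono mult_left_mono haar_abs_le simp: abs_mult split_beta)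
  qed measurable
  moreover have "bounded_on_unit \<bar>c\<bar> (\<lambda>_. c)"
    by (rule bounded_on_unit_borel) auto
  ultimately have "inner2 (haar j k) (\<lambda>x. haar_sum J \<theta> x - c) = inner2 (haar j k) (haar_sum J \<theta>) - inner2 (haar j k) (\<lambda>_. c)"
    by (rule inner2_diff_right [OF bounded_on_unit_haar])
  also have "inner2 (haar j k) (haar_sum J \<theta>) = inner2 (haar j k) (\<lambda>x. \<Sum>i\<in>haar_index J. \<theta> i * haar (fst i) (snd i) x)"
    by (simp add: haar_sum_def [abs_def] split_beta)
  also have "\<dots> = (\<Sum>i\<in>haar_index J. \<theta> i * inner2 (haar j k) (haar (fst i) (snd i)))"
    by (rule inner2_sum_right [OF bounded_on_unit_haar]) (auto intro: bounded_on_unit_haar)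
  also have "\<dots> = (\<Sum>i\<in>haar_index J. if i = (j, k) then \<theta> i else 0)"
    by (rule sum.cong [OF refl]) (auto simp: haar_index_def inner2_haar_haar [OF jk] split: if_splits)
  also have "\<dots> = \<theta> (j, k)"
    using assms by simp
  finally show ?thesis
    using inner2_haar_const [OF jk] by simp
qed

section \<open>Stein identities for the posterior\<close>

definition bin_var :: "nat \<Rightarrow> (nat \<Rightarrow> real) \<Rightarrow> (nat \<Rightarrow> real) \<Rightarrow> real" where
  "bin_var p b \<omega> = (\<Sum>\<mu>=1..p. \<omega> \<mu> * (b \<mu>)\<^sup>2) - (\<Sum>\<mu>=1..p. \<omega> \<mu> * b \<mu>)\<^sup>2"

lemma DERIV_ln_tilt_sum:
  assumes "p \<ge> 1" "\<And>\<mu>. \<mu> \<in> {1..p} \<Longrightarrow> 0 < \<omega> \<mu>"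
  shows "((\<lambda>t. ln (\<Sum>\<nu>=1..p. \<omega> \<nu> * exp (t * b \<nu>))) has_real_derivative (\<Sum>\<mu>=1..p. tilt p b t \<omega> \<mu> * b \<mu>)) (at t)"
proof -
  have pos: "0 < (\<Sum>\<nu>=1..p. \<omega> \<nu> * exp (t * b \<nu>))"
    using assms by (intro sum_tilt_weights_pos)
  have "((\<lambda>t. \<Sum>\<nu>=1..p. \<omega> \<nu> * exp (t * b \<nu>)) has_real_derivative (\<Sum>\<nu>=1..p. \<omega> \<nu> * (exp (t * b \<nu>) * b \<nu>))) (at t)"
    by (intro DERIV_sum DERIV_cmult) (auto intro!: derivative_eq_intros)
  from DERIV_chain2 [OF DERIV_ln [OF pos] this] show ?thesis
    by (simp add: tilt_def sum_distrib_left sum_distrib_right divide_inverse mult_ac)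
qed

text \<open>The tilted weights form an exponential family: the first derivative of its log-partition
  function is the mean, the second is the variance. This is where the variance in \<open>T\<close>
  comes from.\<close>

lemma DERIV_tilt_mean:
  assumes "p \<ge> 1" "\<And>\<mu>. \<mu> \<in> {1..p} \<Longrightarrow> 0 < \<omega> \<mu>"
  shows "((\<lambda>t. \<Sum>\<mu>=1..p. tilt p b t \<omega> \<mu> * b \<mu>) has_real_derivative bin_var p b (tilt p b t \<omega>)) (at t)"
proof -
  let ?C = "\<lambda>t. \<Sum>\<nu>=1..p. \<omega> \<nu> * exp (t * b \<nu>)"
  let ?m = "\<Sum>\<mu>=1..p. tilt p b t \<omega> \<mu> * b \<mu>"
  have pos: "0 < ?C t"
    using assms by (intro sum_tilt_weights_pos)
  have C: "(?C has_real_derivative (\<Sum>\<nu>=1..p. \<omega> \<nu> * (exp (t * b \<nu>) * b \<nu>))) (at t)"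
    by (intro DERIV_sum DERIV_cmult) (auto intro!: derivative_eq_intros)
  have C': "(\<Sum>\<nu>=1..p. \<omega> \<nu> * (exp (t * b \<nu>) * b \<nu>)) = ?C t * ?m"
    using pos by (simp add: tilt_def sum_distrib_left mult.assoc)
  have N: "((\<lambda>t. \<Sum>\<mu>=1..p. \<omega> \<mu> * exp (t * b \<mu>) * b \<mu>) has_real_derivative (\<Sum>\<mu>=1..p. \<omega> \<mu> * (exp (t * b \<mu>) * b \<mu>) * b \<mu>)) (at t)"
    by (intro DERIV_sum DERIV_cmult_right DERIV_cmult) (auto intro!: derivative_eq_intros)
  have "((\<lambda>t. (\<Sum>\<mu>=1..p. \<omega> \<mu> * exp (t * b \<mu>) * b \<mu>) / ?C t) has_real_derivative
      ((\<Sum>\<mu>=1..p. \<omega> \<mu> * (exp (t * b \<mu>) * b \<mu>) * b \<mu>) * ?C t - (\<Sum>\<mu>=1..p. \<omega> \<mu> * exp (t * b \<mu>) * b \<mu>) * (?C t * ?m)) / (?C t * ?C t)) (at t)"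
    using DERIV_divide [OF N C] pos C' by simp
  moreover have "(\<Sum>\<mu>=1..p. \<omega> \<mu> * exp (t * b \<mu>) * b \<mu>) / ?C t = (\<Sum>\<mu>=1..p. tilt p b t \<omega> \<mu> * b \<mu>)" for t
    by (simp add: tilt_def sum_divide_distrib)
  moreover have "(\<Sum>\<mu>=1..p. \<omega> \<mu> * (exp (t * b \<mu>) * b \<mu>) * b \<mu>) = ?C t * (\<Sum>\<mu>=1..p. tilt p b t \<omega> \<mu> * (b \<mu>)\<^sup>2)"
    using pos by (simp add: tilt_def sum_distrib_left power2_eq_square mult.assoc)
  moreover have "(\<Sum>\<mu>=1..p. \<omega> \<mu> * exp (t * b \<mu>) * b \<mu>) = ?C t * ?m"
    using pos by (simp add: tilt_def sum_distrib_left mult.assoc)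
  moreover have "(x * u * x - x * y * (x * y)) / (x * x) = u - y\<^sup>2" if "x > 0" for x u y :: real
    using that by (simp add: field_simps power2_eq_square)
  ultimately show ?thesis
    using pos by (simp add: bin_var_def)
qed

lemma weighted_mean_le:
  fixes \<omega> b :: "nat \<Rightarrow> real"
  assumes "\<And>\<mu>. \<mu> \<in> {1..p} \<Longrightarrow> 0 \<le> \<omega> \<mu>" "(\<Sum>\<mu>=1..p. \<omega> \<mu>) = 1" "\<And>\<mu>. \<mu> \<in> {1..p} \<Longrightarrow> \<bar>b \<mu>\<bar> \<le> B"
  shows "\<bar>\<Sum>\<mu>=1..p. \<omega> \<mu> * b \<mu>\<bar> \<le> B"
proof -
  have "\<bar>\<Sum>\<mu>=1..p. \<omega> \<mu> * b \<mu>\<bar> \<le> (\<Sum>\<mu>=1..p. \<omega> \<mu> * B)"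
    using assms by (intro order_trans [OF sum_abs] sum_mono) (auto simp: abs_mult mult_left_mono)
  also have "\<dots> = B" using assms(2) by (simp flip: sum_distrib_right)
  finally show ?thesis .
qed

text \<open>Both terms of the difference lie between 0 and \<open>B\<^sup>2\<close>, so no factor 2
  is lost.\<close>

lemma bin_var_le:
  assumes "\<And>\<mu>. \<mu> \<in> {1..p} \<Longrightarrow> 0 \<le> \<omega> \<mu>" "(\<Sum>\<mu>=1..p. \<omega> \<mu>) = 1" "\<And>\<mu>. \<mu> \<in> {1..p} \<Longrightarrow> \<bar>b \<mu>\<bar> \<le> B"
  shows "\<bar>bin_var p b \<omega>\<bar> \<le> B\<^sup>2"
proof -
  have "\<bar>(b \<mu>)\<^sup>2\<bar> \<le> B\<^sup>2" if "\<mu> \<in> {1..p}" for \<mu>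
    using assms(3) [OF that] by (metis abs_ge_zero abs_power2 power2_abs power_mono)
  then have "\<bar>\<Sum>\<mu>=1..p. \<omega> \<mu> * (b \<mu>)\<^sup>2\<bar> \<le> B\<^sup>2"
    using assms by (intro weighted_mean_le)
  moreover have "0 \<le> (\<Sum>\<mu>=1..p. \<omega> \<mu> * (b \<mu>)\<^sup>2)"
    using assms by (intro sum_nonneg) auto
  moreover have "(\<Sum>\<mu>=1..p. \<omega> \<mu> * b \<mu>)\<^sup>2 \<le> B\<^sup>2"
    using weighted_mean_le [of p \<omega> b B, OF assms] by (metis abs_ge_zero power2_abs power_mono)
  moreover have "0 \<le> (\<Sum>\<mu>=1..p. \<omega> \<mu> * b \<mu>)\<^sup>2" by simp
  ultimately show ?thesis
    unfolding bin_var_def by linarith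
qed

lemma prob_space_posterior:
  assumes "norm_const R F n X \<noteq> 0" "norm_const R F n X \<noteq> \<infinity>"
  shows "prob_space (posterior R F n X)"
proof
  have "space (unnorm_posterior R F n X) = space R"
    by (simp add: unnorm_posterior_def)
  then show "emeasure (posterior R F n X) (space (posterior R F n X)) = 1"
    using assms by (simp add: posterior_def space_scale_measure norm_const_def [symmetric] mult.commute
      less_top ennreal_divide_self flip: divide_ennreal_def)
qed

text \<open>A pointwise limit of difference quotients of a continuous function. It is applied to
  \<open>H''\<close>, which is assumed to exist and to be bounded but not to be continuous.\<close>

lemma borel_measurable_derivative:
  fixes f f' :: "real \<Rightarrow> real"
  assumes "\<And>x. (f has_real_derivative f' x) (at x)"
  shows "f' \<in> borel_measurable borel"
proof (rule borel_measurable_LIMSEQ_real)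
  have "continuous_on UNIV f"
    using assms DERIV_isCont continuous_at_imp_continuous_on by blast
  then have f [measurable]: "f \<in> borel_measurable borel"
    by (rule borel_measurable_continuous_onI)
  define e where "e = (\<lambda>k::nat. inverse (real (Suc k)))"
  have e_lim: "filterlim e (at 0) sequentially"
    unfolding filterlim_at using LIMSEQ_inverse_real_of_nat by (auto simp: e_def [abs_def])
  show "(\<lambda>x. (f (x + e k) - f x) / e k) \<in> borel_measurable borel" for k
    by measurable
  show "(\<lambda>k. (f (x + e k) - f x) / e k) \<longlonglongrightarrow> f' x" for x
    using filterlim_compose [OF assms [of x, unfolded DERIV_def] e_lim] .
qed

section \<open>The Dirichlet posterior\<close>

context
  fixes p n :: nat and m :: "nat \<Rightarrow> real" and X :: "nat \<Rightarrow> real" and g :: "real \<Rightarrow> real" and B :: real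
  assumes p: "p \<ge> 1" and m: "\<And>\<mu>. \<mu> \<in> {1..p} \<Longrightarrow> 0 < m \<mu>" and n: "n \<ge> 1"
    and X: "\<And>i. i \<in> {1..n} \<Longrightarrow> X i \<in> {0..1}"
    and g: "bounded_on_unit B g" "0 \<le> B"
begin

private abbreviation (input) "P \<equiv> PiM {1..<p} (\<lambda>_. lborel :: real measure)"
private abbreviation (input) "\<omega> \<equiv> bin_probs p"
private abbreviation (input) "base_weight w \<equiv> indicator (bin_simplex p) w * ennreal (\<Prod>\<mu>=1..p. 1 / \<omega> w \<mu>)"
private abbreviation (input) "post_factor w \<equiv> ennreal ((\<Prod>\<mu>=1..p. \<omega> w \<mu> powr m \<mu>) * (\<Prod>i=1..n. real p * \<omega> w (bin_of p (X i))))"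

lemma dirichlet_density_eq:
  "x \<in> {0..1} \<Longrightarrow> dirichlet_density p w x = real p * bin_probs p w (bin_of p x)"
  using step_eq [OF p] by (simp add: dirichlet_density_def histogram_def step_fun_def)

lemma measurable_dirichlet_likelihood [measurable]:
  "(\<lambda>w. \<Prod>i=1..n. real p * \<omega> w (bin_of p (X i))) \<in> borel_measurable P"
  by (intro borel_measurable_prod borel_measurable_times borel_measurable_const measurable_bin_probs
      bin_of_range [OF p X])

text \<open>Each power with exponent \<open>m \<mu> - 1\<close> is split into a reciprocal, which
  belongs to the flow-invariant measure on the simplex, and a power with exponent
  \<open>m \<mu>\<close>, which transforms multiplicatively under tilting and joins the
  likelihood.\<close>

lemma dirichlet_unnorm_posterior:
  "unnorm_posterior (dirichlet_prior p m) (dirichlet_density p) n X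
     = density P (\<lambda>w. base_weight w * post_factor w)"
proof -
  have br: "bin_of p (X i) \<in> {1..p}" if "i \<in> {1..n}" for i
    using bin_of_range [OF p X [OF that]] .
  have lik: "(\<Prod>i=1..n. dirichlet_density p w (X i)) = (\<Prod>i=1..n. real p * \<omega> w (bin_of p (X i)))" for w
    using X by (intro prod.cong) (auto simp: dirichlet_density_eq)
  have "unnorm_posterior (dirichlet_prior p m) (dirichlet_density p) n X
     = density P (\<lambda>w. ennreal (if \<forall>\<mu>\<in>{1..p}. 0 < \<omega> w \<mu> then \<Prod>\<mu>=1..p. \<omega> w \<mu> powr (m \<mu> - 1) else 0)
         * ennreal (\<Prod>i=1..n. real p * \<omega> w (bin_of p (X i))))"
    unfolding unnorm_posterior_def dirichlet_prior_def lik
    by (rule density_density_eq) measurable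
  also have "\<dots> = density P (\<lambda>w. base_weight w * post_factor w)"
  proof (rule density_cong)
    show "AE w in P. ennreal (if \<forall>\<mu>\<in>{1..p}. 0 < \<omega> w \<mu> then \<Prod>\<mu>=1..p. \<omega> w \<mu> powr (m \<mu> - 1) else 0)
         * ennreal (\<Prod>i=1..n. real p * \<omega> w (bin_of p (X i))) = base_weight w * post_factor w"
    proof (rule AE_I2)
      fix w assume w: "w \<in> space P"
      show "ennreal (if \<forall>\<mu>\<in>{1..p}. 0 < \<omega> w \<mu> then \<Prod>\<mu>=1..p. \<omega> w \<mu> powr (m \<mu> - 1) else 0)
         * ennreal (\<Prod>i=1..n. real p * \<omega> w (bin_of p (X i))) = base_weight w * post_factor w"
      proof (cases "w \<in> bin_simplex p")
        case True
        then have pos: "0 < \<omega> w \<mu>" if "\<mu> \<in> {1..p}" for \<mu>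
          using that by (auto simp: bin_simplex_def)
        have "(\<Prod>\<mu>=1..p. \<omega> w \<mu> powr (m \<mu> - 1)) = (\<Prod>\<mu>=1..p. 1 / \<omega> w \<mu>) * (\<Prod>\<mu>=1..p. \<omega> w \<mu> powr m \<mu>)"
          unfolding prod.distrib [symmetric]
        proof (rule prod.cong [OF refl])
          fix \<mu> assume "\<mu> \<in> {1..p}"
          from pos [OF this] show "\<omega> w \<mu> powr (m \<mu> - 1) = 1 / \<omega> w \<mu> * \<omega> w \<mu> powr m \<mu>"
            by (simp add: powr_diff)
        qed
        moreover have "0 \<le> (\<Prod>\<mu>=1..p. 1 / \<omega> w \<mu>)" "0 \<le> (\<Prod>\<mu>=1..p. \<omega> w \<mu> powr m \<mu>)"
          using pos by (auto intro!: prod_nonneg simp: less_imp_le)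
        ultimately show ?thesis
          using True pos by (simp add: ennreal_mult' mult.assoc)
      next
        case False
        then have "\<not> (\<forall>\<mu>\<in>{1..p}. 0 < \<omega> w \<mu>)"
          using w by (auto simp: bin_simplex_def)
        then show ?thesis
          using False by (simp only: if_False) simp
      qed
    qed
  qed measurable
  finally show ?thesis .
qed

text \<open>By conjugacy the constant is, up to a power of \<open>p\<close>, a Dirichlet integral
  with positive parameters, and the Gamma identity \<open>dirichlet_integral\<close> shows such
  integrals to be positive and finite.\<close>

lemma dirichlet_norm_const:
  "norm_const (dirichlet_prior p m) (dirichlet_density p) n X \<noteq> 0"
  "norm_const (dirichlet_prior p m) (dirichlet_density p) n X \<noteq> \<infinity>"
proof -
  have br: "bin_of p (X i) \<in> {1..p}" if "i \<in> {1..n}" for i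
    using bin_of_range [OF p X [OF that]] .
  \<comment> \<open>The conjugate update: every observation adds 1 to the parameter of its
    bin.\<close>
  define \<alpha> where "\<alpha> = (\<lambda>\<mu>. m \<mu> + real (card {i \<in> {1..n}. bin_of p (X i) = \<mu>}))"
  have \<alpha>: "0 < \<alpha> \<mu>" if "\<mu> \<in> {1..p}" for \<mu>
    using m [OF that] by (simp add: \<alpha>_def add_pos_nonneg)
  define D where "D = (\<integral>\<^sup>+w. indicator (bin_simplex p) w * ennreal (\<Prod>\<mu>=1..p. bin_probs p w \<mu> powr (\<alpha> \<mu> - 1)) \<partial>P)"
  have "norm_const (dirichlet_prior p m) (dirichlet_density p) n X
      = (\<integral>\<^sup>+w. base_weight w * post_factor w \<partial>P)"
    (is "_ = (\<integral>\<^sup>+w. ?f w \<partial>P)")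
  proof -
    have "emeasure (density P ?f) (space P) = (\<integral>\<^sup>+w. ?f w * indicator (space P) w \<partial>P)"
      by (rule emeasure_density) measurable
    also have "\<dots> = (\<integral>\<^sup>+w. ?f w \<partial>P)"
      by (rule nn_integral_cong) simp
    finally show ?thesis
      unfolding norm_const_def dirichlet_unnorm_posterior by (simp add: dirichlet_prior_def)
  qed
  also have "\<dots> = (\<integral>\<^sup>+w. ennreal (real p ^ n) * (indicator (bin_simplex p) w * ennreal (\<Prod>\<mu>=1..p. bin_probs p w \<mu> powr (\<alpha> \<mu> - 1))) \<partial>P)"
  proof (rule nn_integral_cong)
    fix w
    show "base_weight w * post_factor w
       = ennreal (real p ^ n) * (indicator (bin_simplex p) w * ennreal (\<Prod>\<mu>=1..p. bin_probs p w \<mu> powr (\<alpha> \<mu> - 1)))"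
    proof (cases "w \<in> bin_simplex p")
      case True
      then have pos: "0 < \<omega> w \<mu>" if "\<mu> \<in> {1..p}" for \<mu>
        using that by (auto simp: bin_simplex_def)
      \<comment> \<open>The likelihood depends on the data only through the bin counts.\<close>
      have "(\<Prod>i=1..n. \<omega> w (bin_of p (X i))) = (\<Prod>\<mu>=1..p. \<Prod>i\<in>{i \<in> {1..n}. bin_of p (X i) = \<mu>}. \<omega> w (bin_of p (X i)))"
        using br by (intro prod.group [symmetric]) auto
      also have "\<dots> = (\<Prod>\<mu>=1..p. \<omega> w \<mu> powr real (card {i \<in> {1..n}. bin_of p (X i) = \<mu>}))"
        using pos by (intro prod.cong) (auto simp: powr_realpow)
      finally have lik: "(\<Prod>i=1..n. real p * \<omega> w (bin_of p (X i)))
          = real p ^ n * (\<Prod>\<mu>=1..p. \<omega> w \<mu> powr real (card {i \<in> {1..n}. bin_of p (X i) = \<mu>}))"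
        by (simp only: prod.distrib prod_constant) simp
      have "(\<Prod>\<mu>=1..p. 1 / \<omega> w \<mu>) * (\<Prod>\<mu>=1..p. \<omega> w \<mu> powr m \<mu>) * (\<Prod>\<mu>=1..p. \<omega> w \<mu> powr real (card {i \<in> {1..n}. bin_of p (X i) = \<mu>}))
          = (\<Prod>\<mu>=1..p. \<omega> w \<mu> powr (\<alpha> \<mu> - 1))"
        unfolding prod.distrib [symmetric]
      proof (rule prod.cong [OF refl])
        fix \<mu> assume "\<mu> \<in> {1..p}"
        from pos [OF this]
        show "1 / \<omega> w \<mu> * \<omega> w \<mu> powr m \<mu> * \<omega> w \<mu> powr real (card {i \<in> {1..n}. bin_of p (X i) = \<mu>})
            = \<omega> w \<mu> powr (\<alpha> \<mu> - 1)"
          by (simp add: powr_diff powr_add \<alpha>_def)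
      qed
      then have eq: "(\<Prod>\<mu>=1..p. 1 / \<omega> w \<mu>) * ((\<Prod>\<mu>=1..p. \<omega> w \<mu> powr m \<mu>) * (\<Prod>i=1..n. real p * \<omega> w (bin_of p (X i))))
          = real p ^ n * (\<Prod>\<mu>=1..p. \<omega> w \<mu> powr (\<alpha> \<mu> - 1))"
        unfolding lik by (simp only: mult.assoc mult.left_commute [of _ "real p ^ n"])
      have "0 \<le> (\<Prod>\<mu>=1..p. 1 / \<omega> w \<mu>)"
        using pos by (auto intro!: prod_nonneg simp: less_imp_le)
      from ennreal_mult' [OF this, symmetric]
      have "ennreal (\<Prod>\<mu>=1..p. 1 / \<omega> w \<mu>) * post_factor w
          = ennreal (real p ^ n * (\<Prod>\<mu>=1..p. \<omega> w \<mu> powr (\<alpha> \<mu> - 1)))"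
        by (simp only: eq)
      also have "\<dots> = ennreal (real p ^ n) * ennreal (\<Prod>\<mu>=1..p. \<omega> w \<mu> powr (\<alpha> \<mu> - 1))"
        by (rule ennreal_mult') simp
      finally show ?thesis
        using True by simp
    qed simp
  qed
  also have "\<dots> = ennreal (real p ^ n) * D"
    unfolding D_def by (rule nn_integral_cmult) measurable
  finally have eq: "norm_const (dirichlet_prior p m) (dirichlet_density p) n X = ennreal (real p ^ n) * D" .
  have D: "ennreal (Gamma (\<Sum>\<mu>=1..p. \<alpha> \<mu>)) * D = ennreal (\<Prod>\<mu>=1..p. Gamma (\<alpha> \<mu>))"
    unfolding D_def by (rule dirichlet_integral [OF p \<alpha>])
  have "0 < (\<Prod>\<mu>=1..p. Gamma (\<alpha> \<mu>))"
    using \<alpha> by (intro prod_pos Gamma_real_pos) auto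
  then have prod: "ennreal (\<Prod>\<mu>=1..p. Gamma (\<alpha> \<mu>)) \<noteq> 0"
    by (simp only: ennreal_eq_0_iff not_le)
  have "0 < (\<Sum>\<mu>=1..p. \<alpha> \<mu>)"
    using \<alpha> p by (intro sum_pos) auto
  then have "0 < Gamma (\<Sum>\<mu>=1..p. \<alpha> \<mu>)"
    by (rule Gamma_real_pos)
  then have Gamma_sum: "ennreal (Gamma (\<Sum>\<mu>=1..p. \<alpha> \<mu>)) \<noteq> 0"
    by (simp only: ennreal_eq_0_iff not_le)
  have "D \<noteq> 0"
    using D prod by (metis mult_zero_right)
  moreover have "D \<noteq> \<infinity>"
    using D Gamma_sum by (metis ennreal_mult_eq_top_iff ennreal_neq_top infinity_ennreal_def)
  ultimately show "norm_const (dirichlet_prior p m) (dirichlet_density p) n X \<noteq> 0"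
    "norm_const (dirichlet_prior p m) (dirichlet_density p) n X \<noteq> \<infinity>"
    using p unfolding eq by (auto simp: ennreal_mult_eq_top_iff)
qed

text \<open>The factor ||m||_1 of the correction cancels the normalisation of the prior mean, so the
  parameters \<open>m\<close> appear directly.\<close>

lemma dirichlet_functional_eq:
  "dirichlet_functional p m g n (dirichlet_density p w)
     = (\<Sum>\<mu>=1..p. \<omega> w \<mu> * bin_avg p g \<mu>)
       - 1 / real n * ((\<Sum>\<mu>=1..p. m \<mu> * bin_avg p g \<mu>) - (\<Sum>\<mu>=1..p. m \<mu>) * (\<Sum>\<mu>=1..p. \<omega> w \<mu> * bin_avg p g \<mu>))"
proof -
  let ?M = "\<Sum>\<mu>=1..p. m \<mu>"
  have M: "?M > 0" using m p by (intro sum_pos) auto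
  have bdd: "bounded_on_unit (\<Sum>\<kappa>=1..p. \<bar>real p * c \<kappa>\<bar>) (histogram p c)" for c
  proof -
    have "histogram p c = step_fun p (\<lambda>\<mu>. real p * c \<mu>)"
      by (rule ext) (simp only: histogram_def step_fun_def sum_distrib_left mult.assoc)
    then show ?thesis
      using bounded_on_unit_step [OF p, of "\<lambda>\<mu>. real p * c \<mu>" "\<Sum>\<kappa>=1..p. \<bar>real p * c \<kappa>\<bar>"]
        member_le_sum [of _ "{1..p}" "\<lambda>\<kappa>. \<bar>real p * c \<kappa>\<bar>"] by auto
  qed
  have "inner2 g (\<lambda>x. histogram p (\<lambda>\<mu>. m \<mu> / ?M) x - dirichlet_density p w x)
      = inner2 g (histogram p (\<lambda>\<mu>. m \<mu> / ?M)) - inner2 g (dirichlet_density p w)"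
    unfolding dirichlet_density_def by (rule inner2_diff_right [OF g(1) bdd bdd])
  also have "\<dots> = (\<Sum>\<mu>=1..p. m \<mu> * bin_avg p g \<mu>) / ?M - (\<Sum>\<mu>=1..p. \<omega> w \<mu> * bin_avg p g \<mu>)"
    by (simp add: dirichlet_density_def inner2_histogram [OF g(1)] sum_divide_distrib)
  finally show ?thesis
    using M unfolding dirichlet_functional_def
    by (simp add: dirichlet_density_def inner2_histogram [OF g(1)] field_simps)
qed

text \<open>Along the flow the log of \<open>post_factor\<close> has as derivative the
  \<open>m\<close>-weighted sum of the bin averages, plus their sum over the data, minus (||m||_1 +
  n) times their mean under \<open>f\<close>. This equals \<open>- sqrt n * Z\<close> because the
  correction in the functional contains exactly the prior terms. The factor 1 + ||m||_1/n in
  \<open>T\<close> is the slope of Z/sqrt n as a function of that mean.\<close>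

lemma dirichlet_stein_pair:
  defines "M \<equiv> posterior (dirichlet_prior p m) (dirichlet_density p) n X"
  defines "Z \<equiv> \<lambda>w. sqrt (real n) * (dirichlet_functional p m g n (dirichlet_density p w) - centring p g n X)"
  defines "T \<equiv> \<lambda>w. (1 + (\<Sum>\<mu>=1..p. m \<mu>) / real n) * bin_var p (bin_avg p g) (bin_probs p w)"
  shows "prob_space M" "stein_pair M Z T" "AE w in M. w \<in> bin_simplex p"
proof -
  let ?b = "bin_avg p g"
  let ?M = "\<Sum>\<mu>=1..p. m \<mu>"
  let ?k = "((\<Sum>\<mu>=1..p. m \<mu> * ?b \<mu>) + (\<Sum>i=1..n. ?b (bin_of p (X i)))) / real n"
  let ?K1 = "\<bar>sqrt (real n)\<bar> * (\<bar>1 + ?M / real n\<bar> * B + \<bar>?k\<bar>)"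
  let ?K = "?K1 + \<bar>1 + ?M / real n\<bar> * B\<^sup>2"
  have br: "bin_of p (X i) \<in> {1..p}" if "i \<in> {1..n}" for i
    using bin_of_range [OF p X [OF that]] .
  have b_le: "\<bar>?b \<mu>\<bar> \<le> B" if "\<mu> \<in> {1..p}" for \<mu>
    using bin_avg_le [OF p g that] .
  have sq: "sqrt (real n) * sqrt (real n) = real n" "sqrt (real n) > 0" using n by auto
  show "prob_space M"
    unfolding M_def by (rule prob_space_posterior [OF dirichlet_norm_const])
  then interpret prob_space M .
  define V where "V = (\<lambda>w. base_weight w)"
  define D where "D = (\<lambda>w. post_factor w)"
  define r where "r = inverse (norm_const (dirichlet_prior p m) (dirichlet_density p) n X)"
  have M: "M = scale_measure r (density P (\<lambda>w. V w * D w))"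
    unfolding M_def posterior_def dirichlet_unnorm_posterior V_def D_def r_def ..
  have V [measurable]: "V \<in> borel_measurable P"
    unfolding V_def by measurable
  have D [measurable]: "D \<in> borel_measurable P"
    unfolding D_def by measurable
  have sets_M [simp]: "sets M = sets P" "space M = space P"
    by (simp_all add: M space_scale_measure)
  have meas_M: "measurable M M = measurable P P" "borel_measurable M = (borel_measurable P :: ((nat \<Rightarrow> real) \<Rightarrow> real) set)"
    by (auto intro!: measurable_cong_sets)
  define Cs where "Cs = (\<lambda>t w. \<Sum>\<nu>=1..p. \<omega> w \<nu> * exp (t * ?b \<nu>))"
  \<comment> \<open>The logarithm of the factor that \<open>post_factor\<close> acquires along the
    flow; the reciprocals in \<open>base_weight\<close> are left to the invariant measure.\<close>
  define L where "L = (\<lambda>t w. (\<Sum>\<mu>=1..p. m \<mu> * (t * ?b \<mu> - ln (Cs t w))) + (\<Sum>i=1..n. t * ?b (bin_of p (X i)) - ln (Cs t w)))"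
  have mean_meas [measurable]: "(\<lambda>w. \<Sum>\<mu>=1..p. \<omega> w \<mu> * c \<mu>) \<in> borel_measurable P" for c
    by measurable
  have [measurable]: "Cs t \<in> borel_measurable P" for t
    unfolding Cs_def by measurable
  have L_meas: "L t \<in> borel_measurable P" for t
    unfolding L_def by measurable
  have Z_eq: "Z = (\<lambda>w. sqrt (real n) * ((1 + ?M / real n) * (\<Sum>\<mu>=1..p. \<omega> w \<mu> * ?b \<mu>)
      - ?k))"
  proof -
    have "centring p g n X = (\<Sum>i=1..n. ?b (bin_of p (X i))) / real n"
      by (rule centring_eq [OF p g(1) X])
    then show ?thesis
      unfolding Z_def dirichlet_functional_eq using n by (simp add: fun_eq_iff field_simps)
  qed
  have Z_meas: "Z \<in> borel_measurable P"
    unfolding Z_eq by measurable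
  have T_meas: "T \<in> borel_measurable P"
    unfolding T_def bin_var_def by measurable
  have pos: "0 < \<omega> w \<mu>" if "w \<in> bin_simplex p" "\<mu> \<in> {1..p}" for w \<mu>
    using that by (auto simp: bin_simplex_def)
  have Cs_pos: "0 < Cs t w" if "w \<in> bin_simplex p" for t w
    unfolding Cs_def using pos [OF that] p by (intro sum_tilt_weights_pos) auto
  have D_flow: "D w * ennreal (exp (L t w)) = D (simplex_flow p ?b t w)" if w: "w \<in> bin_simplex p" for t w
  proof -
    have flow: "\<omega> (simplex_flow p ?b t w) \<mu> = \<omega> w \<mu> * exp (t * ?b \<mu> - ln (Cs t w))" if "\<mu> \<in> {1..p}" for \<mu>
      using bin_probs_simplex_flow [OF p w that, of ?b t] Cs_pos [OF w, of t]
      by (simp add: tilt_def Cs_def exp_diff)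
    have "(\<Prod>\<mu>=1..p. \<omega> (simplex_flow p ?b t w) \<mu> powr m \<mu>)
        = (\<Prod>\<mu>=1..p. \<omega> w \<mu> powr m \<mu> * exp (m \<mu> * (t * ?b \<mu> - ln (Cs t w))))"
      using pos [OF w] by (intro prod.cong) (auto simp: flow powr_mult less_imp_le powr_def [of "exp _"])
    also have "\<dots> = (\<Prod>\<mu>=1..p. \<omega> w \<mu> powr m \<mu>) * exp (\<Sum>\<mu>=1..p. m \<mu> * (t * ?b \<mu> - ln (Cs t w)))"
      by (simp add: prod.distrib exp_sum)
    finally have 1: "(\<Prod>\<mu>=1..p. \<omega> (simplex_flow p ?b t w) \<mu> powr m \<mu>) = \<dots>" .
    have "(\<Prod>i=1..n. real p * \<omega> (simplex_flow p ?b t w) (bin_of p (X i)))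
        = (\<Prod>i=1..n. real p * \<omega> w (bin_of p (X i)) * exp (t * ?b (bin_of p (X i)) - ln (Cs t w)))"
      using br by (intro prod.cong) (auto simp: flow)
    also have "\<dots> = (\<Prod>i=1..n. real p * \<omega> w (bin_of p (X i))) * exp (\<Sum>i=1..n. t * ?b (bin_of p (X i)) - ln (Cs t w))"
      by (simp add: prod.distrib exp_sum)
    finally have 2: "(\<Prod>i=1..n. real p * \<omega> (simplex_flow p ?b t w) (bin_of p (X i))) = \<dots>" .
    show ?thesis
      unfolding D_def 1 2 L_def exp_add
      by (subst ennreal_mult'' [symmetric]) (auto simp: mult_ac)
  qed
  have S: "AE w in M. w \<in> bin_simplex p"
  proof -
    have "AE w in density P (\<lambda>w. V w * D w). w \<in> bin_simplex p"
      by (subst AE_density) (measurable, auto simp: V_def indicator_def intro!: AE_I2 split: if_splits)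
    moreover have compl: "space P - bin_simplex p \<in> sets P"
      by measurable
    ultimately have "emeasure (density P (\<lambda>w. V w * D w)) (space P - bin_simplex p) = 0"
      by (subst (asm) AE_iff_measurable [of "space P - bin_simplex p"]) auto
    then have "emeasure M (space P - bin_simplex p) = 0"
      unfolding M by simp
    then show ?thesis
      using compl by (subst AE_iff_measurable [of "space P - bin_simplex p"]) auto
  qed
  then show "AE w in M. w \<in> bin_simplex p" .
  have deriv_mean: "((\<lambda>t. \<Sum>\<mu>=1..p. \<omega> (simplex_flow p ?b t w) \<mu> * ?b \<mu>) has_real_derivative
      bin_var p ?b (\<omega> (simplex_flow p ?b t w))) (at t)" if w: "w \<in> bin_simplex p" for t w
  proof -
    have eq: "(\<Sum>\<mu>=1..p. \<omega> (simplex_flow p ?b t w) \<mu> * c \<mu>) = (\<Sum>\<mu>=1..p. tilt p ?b t (\<omega> w) \<mu> * c \<mu>)" for c t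
      using bin_probs_simplex_flow [OF p w] by (intro sum.cong) auto
    show ?thesis
      unfolding bin_var_def eq using DERIV_tilt_mean [of p "\<omega> w" ?b t] p pos [OF w] by (simp add: bin_var_def)
  qed
  have deriv_ln: "((\<lambda>t. ln (Cs t w)) has_real_derivative (\<Sum>\<mu>=1..p. \<omega> (simplex_flow p ?b t w) \<mu> * ?b \<mu>)) (at t)"
    if w: "w \<in> bin_simplex p" for t w
  proof -
    have eq: "(\<Sum>\<mu>=1..p. \<omega> (simplex_flow p ?b t w) \<mu> * ?b \<mu>) = (\<Sum>\<mu>=1..p. tilt p ?b t (\<omega> w) \<mu> * ?b \<mu>)"
      using bin_probs_simplex_flow [OF p w] by (intro sum.cong) auto
    show ?thesis
      unfolding eq Cs_def using DERIV_ln_tilt_sum [of p "\<omega> w" ?b t] p pos [OF w] by simp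
  qed
  show "stein_pair M Z T"
  proof (rule stein_pair_from_flow [where \<phi> = "simplex_flow p ?b" and L = L and S = "bin_simplex p" and r = "sqrt (real n)"])
    show "Z \<in> borel_measurable M" "T \<in> borel_measurable M" "L t \<in> borel_measurable M" for t
      using Z_meas T_meas L_meas by (simp_all add: meas_M)
    show "simplex_flow p ?b t \<in> measurable M M" for t
      unfolding meas_M by (rule measurable_simplex_flow)
    show "sqrt (real n) > 0" by fact
    show "distr (density M (\<lambda>x. ennreal (exp (L t x)))) M (simplex_flow p ?b t) = M" for t
      unfolding M
    proof (rule flow_invariance_density [where V = V and D = D])
      show "(\<integral>\<^sup>+x. V x * \<Phi> (simplex_flow p ?b t x) \<partial>P) = (\<integral>\<^sup>+x. V x * \<Phi> x \<partial>P)"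
        if "\<Phi> \<in> borel_measurable P" for \<Phi>
        unfolding V_def by (rule nn_integral_simplex_flow [OF p that])
      show "D x * ennreal (exp (L t x)) = D (simplex_flow p ?b t x)" if "V x \<noteq> 0" for x
        using that by (intro D_flow) (auto simp: V_def indicator_def split: if_splits)
      show "(\<lambda>w. V w * D w) \<in> borel_measurable P"
        by measurable
      show "V \<in> borel_measurable P" "D \<in> borel_measurable P" "L t \<in> borel_measurable P"
        by (rule V D L_meas)+
      show "simplex_flow p ?b t \<in> measurable P P"
        by (rule measurable_simplex_flow)
    qed (rule refl)
    show "bin_simplex p \<in> sets M"
      unfolding sets_M by (rule sets_bin_simplex)
    show "AE x in M. x \<in> bin_simplex p" by fact
    show "simplex_flow p ?b t x \<in> bin_simplex p" if "x \<in> bin_simplex p" for t x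
      using simplex_flow_in_bin_simplex [OF p that] .
    show "simplex_flow p ?b 0 x = x" if "x \<in> bin_simplex p" for x
    proof
      fix \<mu>
      show "simplex_flow p ?b 0 x \<mu> = x \<mu>"
        using that sum_bin_probs [OF p, of x]
        by (auto simp: simplex_flow_def tilt_def bin_simplex_def space_PiM bin_probs_def extensional_def PiE_def)
    qed
    show "L 0 x = 0" for x
      using sum_bin_probs [OF p, of x] by (simp add: L_def Cs_def)
    show "((\<lambda>t. Z (simplex_flow p ?b t x)) has_real_derivative sqrt (real n) * T (simplex_flow p ?b t x)) (at t)"
      if x: "x \<in> bin_simplex p" for t x
    proof -
      have "((\<lambda>t. sqrt (real n) * ((1 + ?M / real n) * (\<Sum>\<mu>=1..p. \<omega> (simplex_flow p ?b t x) \<mu> * ?b \<mu>)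
          - ?k))
          has_real_derivative sqrt (real n) * ((1 + ?M / real n) * bin_var p ?b (\<omega> (simplex_flow p ?b t x)) - 0)) (at t)"
        by (intro DERIV_cmult DERIV_diff deriv_mean [OF x] DERIV_const)
      then show ?thesis by (simp add: Z_eq T_def)
    qed
    show "((\<lambda>t. L t x) has_real_derivative - sqrt (real n) * Z (simplex_flow p ?b t x)) (at t)"
      if x: "x \<in> bin_simplex p" for t x
    proof -
      let ?s = "\<Sum>\<mu>=1..p. \<omega> (simplex_flow p ?b t x) \<mu> * ?b \<mu>"
      have "((\<lambda>t. L t x) has_real_derivative (\<Sum>\<mu>=1..p. m \<mu> * (1 * ?b \<mu> - ?s)) + (\<Sum>i=1..n. 1 * ?b (bin_of p (X i)) - ?s)) (at t)"
        unfolding L_def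
        by (intro DERIV_add DERIV_sum DERIV_cmult DERIV_cmult_right DERIV_diff deriv_ln [OF x] DERIV_ident)
      moreover have "(\<Sum>\<mu>=1..p. m \<mu> * (1 * ?b \<mu> - ?s)) + (\<Sum>i=1..n. 1 * ?b (bin_of p (X i)) - ?s)
          = (\<Sum>\<mu>=1..p. m \<mu> * ?b \<mu>) + (\<Sum>i=1..n. ?b (bin_of p (X i))) - (?M + real n) * ?s"
        by (simp add: sum_subtractf right_diff_distrib sum_distrib_right distrib_right)
      moreover have "- sqrt (real n) * Z (simplex_flow p ?b t x) = - (real n * ((1 + ?M / real n) * ?s
          - ?k))"
        unfolding Z_eq by (simp only: mult_minus_left mult.assoc [symmetric] sq(1))
      moreover have "\<dots> = (\<Sum>\<mu>=1..p. m \<mu> * ?b \<mu>) + (\<Sum>i=1..n. ?b (bin_of p (X i))) - (?M + real n) * ?s"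
        using n by (simp add: field_simps)
      ultimately show ?thesis by simp
    qed
    show "\<bar>Z x\<bar> \<le> ?K
        \<and> \<bar>T x\<bar> \<le> ?K"
      if x: "x \<in> bin_simplex p" for x
    proof -
      have "\<bar>\<Sum>\<mu>=1..p. \<omega> x \<mu> * ?b \<mu>\<bar> \<le> B" "\<bar>bin_var p ?b (\<omega> x)\<bar> \<le> B\<^sup>2"
        by (rule weighted_mean_le bin_var_le, rule less_imp_le [OF pos [OF x]], assumption,
            rule sum_bin_probs [OF p], rule b_le, assumption)+
      then have T_le: "\<bar>T x\<bar> \<le> \<bar>1 + ?M / real n\<bar> * B\<^sup>2"
        and "\<bar>1 + ?M / real n\<bar> * \<bar>\<Sum>\<mu>=1..p. \<omega> x \<mu> * ?b \<mu>\<bar> \<le> \<bar>1 + ?M / real n\<bar> * B"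
        unfolding T_def abs_mult by (auto intro: mult_left_mono)
      then have diff_le: "\<bar>(1 + ?M / real n) * (\<Sum>\<mu>=1..p. \<omega> x \<mu> * ?b \<mu>) - k\<bar> \<le> \<bar>1 + ?M / real n\<bar> * B + \<bar>k\<bar>" for k
        using abs_triangle_ineq4 [of "(1 + ?M / real n) * (\<Sum>\<mu>=1..p. \<omega> x \<mu> * ?b \<mu>)" k]
        unfolding abs_mult by linarith
      have Z_le: "\<bar>Z x\<bar> \<le> ?K1"
        unfolding Z_eq abs_mult [of "sqrt (real n)"] by (rule mult_left_mono [OF diff_le]) simp
      have "0 \<le> \<bar>1 + ?M / real n\<bar> * B\<^sup>2" by simp
      moreover have "0 \<le> ?K1"
        using g(2) by (intro mult_nonneg_nonneg add_nonneg_nonneg) auto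
      ultimately show ?thesis using Z_le T_le by linarith
    qed
  qed
qed

end

section \<open>The Haar series posterior\<close>

definition haar_level :: "nat \<Rightarrow> (nat \<times> nat \<Rightarrow> real) \<Rightarrow> nat \<Rightarrow> real" where
  "haar_level J \<theta> \<mu> = haar_sum J \<theta> ((real \<mu> - 1) / 2 ^ (J + 1))"

text \<open>The bin probabilities of \<open>haar_density\<close>; the common bin length cancels in
  the quotient.\<close>

definition haar_probs :: "nat \<Rightarrow> (nat \<times> nat \<Rightarrow> real) \<Rightarrow> nat \<Rightarrow> real" where
  "haar_probs J \<theta> \<mu> = exp (haar_level J \<theta> \<mu>) / (\<Sum>\<nu>=1..2 ^ (J + 1). exp (haar_level J \<theta> \<nu>))"

lemma bin_of_left_endpoint:
  assumes "\<mu> \<in> {1..q}"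
  shows "(real \<mu> - 1) / real q \<in> {0..1}" "bin_of q ((real \<mu> - 1) / real q) = \<mu>"
proof -
  have q: "real q > 0" "q \<ge> 1" "real \<mu> \<le> real q" using assms by auto
  then show *: "(real \<mu> - 1) / real q \<in> {0..1}"
    using assms by (auto simp: field_simps)
  have "(real \<mu> - 1) / real q \<in> bin q \<mu>"
    using q assms by (auto simp: bin_def field_simps)
  then show "bin_of q ((real \<mu> - 1) / real q) = \<mu>"
    using in_bin_iff [OF q(2) * assms] by simp
qed

text \<open>Wavelets up to level \<open>J\<close> are constant on the \<open>2 ^ (J + 1)\<close>
  bins, so the left endpoint chosen in \<open>haar_level\<close> represents its whole bin.\<close>

lemma haar_sum_eq_level:
  assumes "x \<in> {0..1}"
  shows "haar_sum J \<theta> x = haar_level J \<theta> (bin_of (2 ^ (J + 1)) x)"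
proof -
  let ?q = "2 ^ (J + 1) :: nat"
  define y where "y = (real (bin_of ?q x) - 1) / real ?q"
  have "bin_of ?q x \<in> {1..?q}"
    using assms by (intro bin_of_range) auto
  from bin_of_left_endpoint [OF this] have y: "y \<in> {0..1}" "bin_of ?q y = bin_of ?q x"
    by (simp_all only: y_def)
  have "haar_sum J \<theta> x = haar_sum J \<theta> y"
    unfolding haar_sum_def
  proof (rule sum.cong [OF refl])
    fix i assume "i \<in> haar_index J"
    then obtain j k where i: "i = (j, k)" "j < J + 1" "k \<in> {1..2 ^ j}"
      by (auto simp: haar_index_def)
    have "haar j k x = haar j k y"
      using haar_const_on_bin [OF i(2,3) assms y(1)] y(2) by simp
    then show "(case i of (j, k) \<Rightarrow> \<theta> (j, k) * haar j k x) = (case i of (j, k) \<Rightarrow> \<theta> (j, k) * haar j k y)"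
      by (simp add: i)
  qed
  then show ?thesis
    by (simp add: haar_level_def y_def)
qed

lemma sum_exp_haar_level_pos: "0 < (\<Sum>\<nu>=1..2 ^ (J + 1). exp (haar_level J \<theta> \<nu>))"
  by (intro sum_pos) auto

lemma haar_probs_pos: "0 < haar_probs J \<theta> \<mu>"
  using sum_exp_haar_level_pos [of J \<theta>] by (simp add: haar_probs_def)

lemma sum_haar_probs: "(\<Sum>\<mu>=1..2 ^ (J + 1). haar_probs J \<theta> \<mu>) = 1"
  using sum_exp_haar_level_pos [of J \<theta>] unfolding haar_probs_def
  by (simp flip: sum_divide_distrib)

lemma log_normaliser_eq:
  "log_normaliser J \<theta> = ln ((\<Sum>\<nu>=1..2 ^ (J + 1). exp (haar_level J \<theta> \<nu>)) / 2 ^ (J + 1))"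
proof -
  let ?q = "2 ^ (J + 1) :: nat"
  have one: "bounded_on_unit 1 (\<lambda>_. 1)"
    by (rule bounded_on_unit_borel) auto
  have "(LINT x:{0..1}|lborel. exp (haar_sum J \<theta> x)) = inner2 (\<lambda>_. 1) (\<lambda>x. exp (haar_sum J \<theta> x))"
    by (simp add: inner2_def)
  also have "\<dots> = inner2 (\<lambda>_. 1) (step_fun ?q (\<lambda>\<mu>. exp (haar_level J \<theta> \<mu>)))"
    by (rule inner2_cong) (simp add: step_eq haar_sum_eq_level)
  also have "\<dots> = (\<Sum>\<kappa>=1..?q. exp (haar_level J \<theta> \<kappa>) * inner2 (\<lambda>_. 1) (indicator (bin ?q \<kappa>)))"
    by (rule inner2_step [OF one])
  also have "\<dots> = (\<Sum>\<kappa>=1..?q. exp (haar_level J \<theta> \<kappa>) * (1 / real ?q))"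
    by (intro sum.cong arg_cong2 [where f = "(*)"] inner2_bin_const) auto
  finally show ?thesis
    by (simp add: log_normaliser_def sum_divide_distrib)
qed

lemma haar_density_eq_histogram:
  assumes "x \<in> {0..1}"
  shows "haar_density J \<theta> x = histogram (2 ^ (J + 1)) (haar_probs J \<theta>) x"
proof -
  let ?q = "2 ^ (J + 1) :: nat"
  have "histogram ?q (haar_probs J \<theta>) x = real ?q * haar_probs J \<theta> (bin_of ?q x)"
    using step_eq [of ?q x "haar_probs J \<theta>"] assms by (simp add: histogram_def step_fun_def)
  also have "\<dots> = exp (haar_level J \<theta> (bin_of ?q x)) / ((\<Sum>\<nu>=1..?q. exp (haar_level J \<theta> \<nu>)) / 2 ^ (J + 1))"
    by (simp add: haar_probs_def)
  also have "\<dots> = haar_density J \<theta> x"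
    using sum_exp_haar_level_pos [of J \<theta>]
    by (simp add: haar_density_def log_normaliser_eq exp_diff haar_sum_eq_level [OF assms])
  finally show ?thesis ..
qed

context
  fixes J n :: nat and \<sigma> :: "nat \<Rightarrow> real" and H H' H'' :: "real \<Rightarrow> real" and X :: "nat \<Rightarrow> real"
    and g :: "real \<Rightarrow> real" and B h1 h2 :: real
  assumes \<sigma>: "\<And>j. j \<le> J \<Longrightarrow> 0 < \<sigma> j"
    and H: "\<And>x. (H has_real_derivative H' x) (at x)" "\<And>x. (H' has_real_derivative H'' x) (at x)"
    and H_bound: "\<And>x. \<bar>H' x\<bar> \<le> h1" "\<And>x. \<bar>H'' x\<bar> \<le> h2"
    and n: "n \<ge> 1"
    and X: "\<And>i. i \<in> {1..n} \<Longrightarrow> X i \<in> {0..1}"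
    and g: "bounded_on_unit B g" "0 \<le> B"
begin

private abbreviation (input) "p \<equiv> 2 ^ (J + 1) :: nat"
private abbreviation (input) "\<Lambda> \<equiv> PiM (haar_index J) (\<lambda>_. lborel :: real measure)"
private abbreviation (input) "R \<equiv> haar_prior J \<sigma> H"

lemma measurable_haar_sum_param [measurable]: "(\<lambda>\<theta>. haar_sum J \<theta> x) \<in> borel_measurable \<Lambda>"
  unfolding haar_sum_def split_beta prod.collapse by measurable

lemma measurable_haar_level [measurable]: "(\<lambda>\<theta>. haar_level J \<theta> \<mu>) \<in> borel_measurable \<Lambda>"
  unfolding haar_level_def by measurable

lemma measurable_haar_probs [measurable]: "(\<lambda>\<theta>. haar_probs J \<theta> \<mu>) \<in> borel_measurable \<Lambda>"
  unfolding haar_probs_def by measurable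

lemma measurable_log_normaliser [measurable]: "log_normaliser J \<in> borel_measurable \<Lambda>"
  unfolding log_normaliser_eq [abs_def] by measurable

lemma haar_functional_eq:
  "haar_functional J \<sigma> H' g n (haar_density J \<theta>)
     = (\<Sum>\<mu>=1..p. haar_probs J \<theta> \<mu> * bin_avg p g \<mu>)
       + 1 / real n * (\<Sum>(j, k)\<in>haar_index J. H' (\<theta> (j, k) / \<sigma> j) * inner2 (haar j k) g / \<sigma> j)"
proof -
  have "inner2 g (haar_density J \<theta>) = inner2 g (histogram p (haar_probs J \<theta>))"
    by (rule inner2_cong) (simp add: haar_density_eq_histogram)
  also have "\<dots> = (\<Sum>\<mu>=1..p. haar_probs J \<theta> \<mu> * bin_avg p g \<mu>)"
    by (rule inner2_histogram [OF g(1)])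
  finally have 1: "inner2 g (haar_density J \<theta>) = (\<Sum>\<mu>=1..p. haar_probs J \<theta> \<mu> * bin_avg p g \<mu>)" .
  have "(\<Sum>j=0..J. 1 / \<sigma> j * (\<Sum>k=1..2 ^ j. H' (1 / \<sigma> j * inner2 (haar j k) (\<lambda>x. ln (haar_density J \<theta> x))) * inner2 (haar j k) g))
      = (\<Sum>j=0..J. \<Sum>k=1..2 ^ j. H' (\<theta> (j, k) / \<sigma> j) * inner2 (haar j k) g / \<sigma> j)"
    unfolding sum_distrib_left
  proof (intro sum.cong refl)
    fix j k :: nat assume "j \<in> {0..J}" "k \<in> {1..2 ^ j}"
    then have "(j, k) \<in> haar_index J" by (auto simp: haar_index_def)
    then show "1 / \<sigma> j * (H' (1 / \<sigma> j * inner2 (haar j k) (\<lambda>x. ln (haar_density J \<theta> x))) * inner2 (haar j k) g)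
        = H' (\<theta> (j, k) / \<sigma> j) * inner2 (haar j k) g / \<sigma> j"
      using inner2_haar_haar_sum [of j k J \<theta> "log_normaliser J \<theta>"] by (simp add: haar_density_def)
  qed
  also have "\<dots> = (\<Sum>(j, k)\<in>haar_index J. H' (\<theta> (j, k) / \<sigma> j) * inner2 (haar j k) g / \<sigma> j)"
    unfolding haar_index_def by (subst sum.Sigma) auto
  finally show ?thesis
    unfolding haar_functional_def 1 by simp
qed

text \<open>The factor 1 keeps the product form expected by \<open>flow_invariance_density\<close>:
  the flow will be a translation of \<theta>, under which Lebesgue measure is itself
  invariant.\<close>

lemma haar_unnorm_posterior:
  "unnorm_posterior R (haar_density J) n X
     = density \<Lambda> (\<lambda>\<theta>. 1 * ennreal (exp (- (\<Sum>(j, k)\<in>haar_index J. H (\<theta> (j, k) / \<sigma> j))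
         + (\<Sum>i=1..n. haar_sum J \<theta> (X i) - log_normaliser J \<theta>))))"
proof -
  have "continuous_on UNIV H"
    using H(1) DERIV_isCont continuous_at_imp_continuous_on by blast
  then have H_meas [measurable]: "H \<in> borel_measurable borel"
    by (rule borel_measurable_continuous_onI)
  have "unnorm_posterior R (haar_density J) n X
     = density \<Lambda> (\<lambda>\<theta>. ennreal (\<Prod>(j, k)\<in>haar_index J. exp (- H (\<theta> (j, k) / \<sigma> j))) * ennreal (\<Prod>i=1..n. haar_density J \<theta> (X i)))"
    unfolding unnorm_posterior_def haar_prior_def haar_density_def split_beta prod.collapse
    by (rule density_density_eq) measurable
  also have "(\<lambda>\<theta>. ennreal (\<Prod>(j, k)\<in>haar_index J. exp (- H (\<theta> (j, k) / \<sigma> j))) * ennreal (\<Prod>i=1..n. haar_density J \<theta> (X i)))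
      = (\<lambda>\<theta>. 1 * ennreal (exp (- (\<Sum>(j, k)\<in>haar_index J. H (\<theta> (j, k) / \<sigma> j))
         + (\<Sum>i=1..n. haar_sum J \<theta> (X i) - log_normaliser J \<theta>))))"
  proof
    fix \<theta>
    have "(\<Prod>(j, k)\<in>haar_index J. exp (- H (\<theta> (j, k) / \<sigma> j))) = exp (- (\<Sum>(j, k)\<in>haar_index J. H (\<theta> (j, k) / \<sigma> j)))"
      by (simp add: split_beta exp_sum sum_negf flip: sum_negf)
    moreover have "(\<Prod>i=1..n. haar_density J \<theta> (X i)) = exp (\<Sum>i=1..n. haar_sum J \<theta> (X i) - log_normaliser J \<theta>)"
      unfolding haar_density_def by (rule exp_sum [symmetric]) simp
    ultimately show "ennreal (\<Prod>(j, k)\<in>haar_index J. exp (- H (\<theta> (j, k) / \<sigma> j))) * ennreal (\<Prod>i=1..n. haar_density J \<theta> (X i))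
        = 1 * ennreal (exp (- (\<Sum>(j, k)\<in>haar_index J. H (\<theta> (j, k) / \<sigma> j))
         + (\<Sum>i=1..n. haar_sum J \<theta> (X i) - log_normaliser J \<theta>)))"
      by (simp only: exp_add mult_1 ennreal_mult' [OF exp_ge_zero])
  qed
  finally show ?thesis .
qed

text \<open>The density is positive everywhere and Lebesgue measure on the parameter space is not
  null. Finiteness is a matter of the data and is handled as a hypothesis.\<close>

lemma haar_norm_const_nonzero: "norm_const R (haar_density J) n X \<noteq> 0"
proof
  have "continuous_on UNIV H"
    using H(1) DERIV_isCont continuous_at_imp_continuous_on by blast
  then have H_meas [measurable]: "H \<in> borel_measurable borel"
    by (rule borel_measurable_continuous_onI)
  interpret product_sigma_finite "\<lambda>_. lborel :: real measure" ..
  let ?f = "\<lambda>\<theta>. 1 * ennreal (exp (- (\<Sum>(j, k)\<in>haar_index J. H (\<theta> (j, k) / \<sigma> j))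
         + (\<Sum>i=1..n. haar_sum J \<theta> (X i) - log_normaliser J \<theta>)))"
  have f [measurable]: "?f \<in> borel_measurable \<Lambda>"
    unfolding split_beta prod.collapse by measurable
  have space_R: "space R = space \<Lambda>"
    by (simp add: haar_prior_def)
  assume "norm_const R (haar_density J) n X = 0"
  then have "emeasure (density \<Lambda> ?f) (space \<Lambda>) = 0"
    by (simp only: norm_const_def haar_unnorm_posterior space_R)
  also have "emeasure (density \<Lambda> ?f) (space \<Lambda>) = (\<integral>\<^sup>+\<theta>. ?f \<theta> * indicator (space \<Lambda>) \<theta> \<partial>\<Lambda>)"
    by (rule emeasure_density [OF f]) auto
  also have "\<dots> = (\<integral>\<^sup>+\<theta>. ?f \<theta> \<partial>\<Lambda>)"
    by (rule nn_integral_cong) simp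
  finally have "AE \<theta> in \<Lambda>. ?f \<theta> = 0"
    by (subst (asm) nn_integral_0_iff_AE [OF f])
  then have "AE \<theta> in \<Lambda>. False"
    by (auto elim: eventually_mono)
  then have "emeasure \<Lambda> (space \<Lambda>) = 0"
    by (subst (asm) AE_iff_measurable [OF sets.top]) auto
  moreover have "emeasure \<Lambda> (space \<Lambda>) = (\<Prod>i\<in>haar_index J. emeasure (lborel :: real measure) UNIV)"
    unfolding space_PiM by (subst emeasure_PiM) auto
  ultimately show False
    by simp
qed

text \<open>The flow translates \<theta> along the Haar coefficients of \<open>g\<close>, which
  tilts the density by the projection of \<open>g\<close>. Differentiating the prior factor once
  produces the \<open>H'\<close> correction inside \<open>Z\<close>; differentiating that correction
  produces the \<open>H''\<close> term in \<open>T\<close>.\<close>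

lemma haar_stein_pair:
  assumes fin: "norm_const R (haar_density J) n X \<noteq> \<infinity>"
  defines "M \<equiv> posterior R (haar_density J) n X"
  defines "Z \<equiv> \<lambda>\<theta>. sqrt (real n) * (haar_functional J \<sigma> H' g n (haar_density J \<theta>) - centring p g n X)"
  defines "T \<equiv> \<lambda>\<theta>. bin_var p (bin_avg p g) (haar_probs J \<theta>)
      + 1 / real n * (\<Sum>(j, k)\<in>haar_index J. H'' (\<theta> (j, k) / \<sigma> j) * (inner2 (haar j k) g / \<sigma> j)\<^sup>2)"
  shows "prob_space M" "stein_pair M Z T"
proof -
  let ?b = "bin_avg p g"
  define \<beta> where "\<beta> = (\<lambda>(j, k). inner2 (haar j k) g)"
  define \<phi> where "\<phi> = (\<lambda>t \<theta>. \<lambda>i\<in>haar_index J. \<theta> i + t * \<beta> i)"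
  have p1: "p \<ge> 1" by simp
  have b_le: "\<bar>?b \<mu>\<bar> \<le> B" if "\<mu> \<in> {1..p}" for \<mu>
    using bin_avg_le [OF p1 g that] .
  have br: "bin_of p (X i) \<in> {1..p}" if "i \<in> {1..n}" for i
    using bin_of_range [OF p1 X [OF that]] .
  have sq: "sqrt (real n) * sqrt (real n) = real n" "sqrt (real n) > 0" using n by auto
  have \<sigma>_pos: "\<sigma> (fst i) > 0" if "i \<in> haar_index J" for i
    using that \<sigma> by (auto simp: haar_index_def)
  have "continuous_on UNIV H" "continuous_on UNIV H'"
    using H DERIV_isCont continuous_at_imp_continuous_on by blast+
  then have H_meas [measurable]: "H \<in> borel_measurable borel" "H' \<in> borel_measurable borel" "H'' \<in> borel_measurable borel"
    using borel_measurable_derivative [OF H(2)] by (auto intro: borel_measurable_continuous_onI)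
  show "prob_space M"
    unfolding M_def by (rule prob_space_posterior [OF haar_norm_const_nonzero fin])
  then interpret prob_space M .
  define lp where "lp = (\<lambda>\<theta>. - (\<Sum>(j, k)\<in>haar_index J. H (\<theta> (j, k) / \<sigma> j))
         + (\<Sum>i=1..n. haar_sum J \<theta> (X i) - log_normaliser J \<theta>))"
  have lp_meas [measurable]: "lp \<in> borel_measurable \<Lambda>"
    unfolding lp_def split_beta prod.collapse by measurable
  define r where "r = inverse (norm_const R (haar_density J) n X)"
  have M: "M = scale_measure r (density \<Lambda> (\<lambda>\<theta>. 1 * ennreal (exp (lp \<theta>))))"
    unfolding M_def posterior_def haar_unnorm_posterior lp_def r_def ..
  have sets_M [simp]: "sets M = sets \<Lambda>" "space M = space \<Lambda>"
    by (simp_all add: M space_scale_measure)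
  have meas_M: "measurable M M = measurable \<Lambda> \<Lambda>" "borel_measurable M = (borel_measurable \<Lambda> :: ((nat \<times> nat \<Rightarrow> real) \<Rightarrow> real) set)"
    by (auto intro!: measurable_cong_sets)
  have \<phi>_meas [measurable]: "\<phi> t \<in> measurable \<Lambda> \<Lambda>" for t
    unfolding \<phi>_def by (rule measurable_restrict) measurable
  define L where "L = (\<lambda>t \<theta>. lp (\<phi> t \<theta>) - lp \<theta>)"
  have L_meas: "L t \<in> borel_measurable \<Lambda>" for t
    unfolding L_def by measurable
  have Z_eq: "Z = (\<lambda>\<theta>. sqrt (real n) * ((\<Sum>\<mu>=1..p. haar_probs J \<theta> \<mu> * ?b \<mu>)
      + 1 / real n * (\<Sum>i\<in>haar_index J. H' (\<theta> i / \<sigma> (fst i)) * \<beta> i / \<sigma> (fst i))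
      - (\<Sum>i=1..n. ?b (bin_of p (X i))) / real n))"
  proof -
    have "centring p g n X = (\<Sum>i=1..n. ?b (bin_of p (X i))) / real n"
      by (rule centring_eq [OF p1 g(1) X])
    then show ?thesis
      unfolding Z_def haar_functional_eq by (simp add: \<beta>_def split_beta)
  qed
  have T_eq: "T = (\<lambda>\<theta>. bin_var p ?b (haar_probs J \<theta>)
      + 1 / real n * (\<Sum>i\<in>haar_index J. H'' (\<theta> i / \<sigma> (fst i)) * (\<beta> i / \<sigma> (fst i))\<^sup>2))"
    unfolding T_def by (simp add: \<beta>_def split_beta)
  have Z_meas: "Z \<in> borel_measurable \<Lambda>"
    unfolding Z_eq by measurable
  have T_meas: "T \<in> borel_measurable \<Lambda>"
    unfolding T_eq bin_var_def by measurable
  have \<phi>_i: "\<phi> t \<theta> i = \<theta> i + t * \<beta> i" if "i \<in> haar_index J" for t \<theta> i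
    using that by (simp add: \<phi>_def)
  let ?mean = "bin_avg 1 g 1"
  \<comment> \<open>The translation adds \<open>t\<close> times the projection only up to its mean,
    since wavelets do not see constants; the mean is removed again by the normalisation
    below.\<close>
  have hs: "haar_sum J (\<phi> t \<theta>) x = haar_sum J \<theta> x + t * (?b (bin_of p x) - ?mean)" if "x \<in> {0..1}" for t \<theta> x
  proof -
    have "haar_sum J (\<phi> t \<theta>) x = haar_sum J \<theta> x + t * haar_sum J \<beta> x"
      unfolding haar_sum_def sum_distrib_left sum.distrib [symmetric]
      by (rule sum.cong) (auto simp: \<phi>_i algebra_simps)
    also have "haar_sum J \<beta> x = ?b (bin_of p x) - ?mean"
      unfolding \<beta>_def by (rule haar_sum_coefficients [OF g(1) that])
    finally show ?thesis .
  qed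
  have hl: "haar_level J (\<phi> t \<theta>) \<mu> = haar_level J \<theta> \<mu> + t * (?b \<mu> - ?mean)" if "\<mu> \<in> {1..p}" for t \<theta> \<mu>
    using hs [OF bin_of_left_endpoint(1) [OF that], of t \<theta>] bin_of_left_endpoint(2) [OF that]
    by (simp add: haar_level_def)
  define Cs where "Cs = (\<lambda>t \<theta>. \<Sum>\<nu>=1..p. haar_probs J \<theta> \<nu> * exp (t * ?b \<nu>))"
  have Cs_pos: "0 < Cs t \<theta>" for t \<theta>
    unfolding Cs_def using haar_probs_pos by (intro sum_tilt_weights_pos) auto
  have hl_exp: "exp (haar_level J (\<phi> t \<theta>) \<mu>) = exp (haar_level J \<theta> \<mu>) * (exp (t * ?b \<mu>) * exp (- (t * ?mean)))"
    if "\<mu> \<in> {1..p}" for t \<theta> \<mu>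
    unfolding hl [OF that] exp_add [symmetric] by (simp add: algebra_simps)
  have sum_exp: "(\<Sum>\<nu>=1..p. exp (haar_level J (\<phi> t \<theta>) \<nu>))
      = (\<Sum>\<nu>=1..p. exp (haar_level J \<theta> \<nu>)) * exp (- (t * ?mean)) * Cs t \<theta>" for t \<theta>
    unfolding Cs_def sum_distrib_left using sum_exp_haar_level_pos [of J \<theta>]
    by (intro sum.cong refl, subst hl_exp) (auto simp: haar_probs_def)
  \<comment> \<open>The factor containing \<open>?mean\<close> cancels between numerator and
    denominator, so the bin probabilities follow the same \<open>tilt\<close> as under the Dirichlet
    prior.\<close>
  have probs: "haar_probs J (\<phi> t \<theta>) \<mu> = tilt p ?b t (haar_probs J \<theta>) \<mu>" if "\<mu> \<in> {1..p}" for t \<theta> \<mu>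
  proof -
    have "haar_probs J (\<phi> t \<theta>) \<mu> = exp (haar_level J \<theta> \<mu>) * (exp (t * ?b \<mu>) * exp (- (t * ?mean)))
        / ((\<Sum>\<nu>=1..p. exp (haar_level J \<theta> \<nu>)) * exp (- (t * ?mean)) * Cs t \<theta>)"
      unfolding haar_probs_def sum_exp hl_exp [OF that] ..
    also have "\<dots> = haar_probs J \<theta> \<mu> * exp (t * ?b \<mu>) / Cs t \<theta>"
      by (simp add: haar_probs_def)
    finally show ?thesis by (simp add: tilt_def Cs_def)
  qed
  have lognorm: "log_normaliser J (\<phi> t \<theta>) = log_normaliser J \<theta> - t * ?mean + ln (Cs t \<theta>)" for t \<theta>
    unfolding log_normaliser_eq sum_exp using sum_exp_haar_level_pos [of J \<theta>] Cs_pos [of t \<theta>]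
    by (simp add: ln_mult ln_div)
  have L_eq: "L t \<theta> = - (\<Sum>i\<in>haar_index J. H ((\<theta> i + t * \<beta> i) / \<sigma> (fst i))) + (\<Sum>i\<in>haar_index J. H (\<theta> i / \<sigma> (fst i)))
      + (\<Sum>i=1..n. t * ?b (bin_of p (X i)) - ln (Cs t \<theta>))" for t \<theta>
  proof -
    have "(\<Sum>(j, k)\<in>haar_index J. H (\<phi> t \<theta> (j, k) / \<sigma> j)) = (\<Sum>i\<in>haar_index J. H ((\<theta> i + t * \<beta> i) / \<sigma> (fst i)))"
      by (rule sum.cong) (auto simp: \<phi>_i)
    moreover have "(\<Sum>i=1..n. haar_sum J (\<phi> t \<theta>) (X i) - log_normaliser J (\<phi> t \<theta>))
        = (\<Sum>i=1..n. haar_sum J \<theta> (X i) - log_normaliser J \<theta>) + (\<Sum>i=1..n. t * ?b (bin_of p (X i)) - ln (Cs t \<theta>))"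
      unfolding sum.distrib [symmetric] using X
      by (intro sum.cong) (auto simp: hs lognorm algebra_simps)
    ultimately show ?thesis
      by (simp add: L_def lp_def split_beta)
  qed
  have deriv_mean: "((\<lambda>t. \<Sum>\<mu>=1..p. haar_probs J (\<phi> t \<theta>) \<mu> * ?b \<mu>) has_real_derivative
      bin_var p ?b (haar_probs J (\<phi> t \<theta>))) (at t)" for t \<theta>
  proof -
    have eq: "(\<Sum>\<mu>=1..p. haar_probs J (\<phi> t \<theta>) \<mu> * c \<mu>) = (\<Sum>\<mu>=1..p. tilt p ?b t (haar_probs J \<theta>) \<mu> * c \<mu>)" for c t
      by (rule sum.cong) (auto simp: probs)
    show ?thesis
      unfolding bin_var_def eq
      using DERIV_tilt_mean [of p "haar_probs J \<theta>" ?b t, OF p1 haar_probs_pos] by (simp only: bin_var_def)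
  qed
  have deriv_ln: "((\<lambda>t. ln (Cs t \<theta>)) has_real_derivative (\<Sum>\<mu>=1..p. haar_probs J (\<phi> t \<theta>) \<mu> * ?b \<mu>)) (at t)" for t \<theta>
  proof -
    have eq: "(\<Sum>\<mu>=1..p. haar_probs J (\<phi> t \<theta>) \<mu> * ?b \<mu>) = (\<Sum>\<mu>=1..p. tilt p ?b t (haar_probs J \<theta>) \<mu> * ?b \<mu>)"
      by (rule sum.cong) (auto simp: probs)
    show ?thesis
      unfolding eq Cs_def by (rule DERIV_ln_tilt_sum [OF p1 haar_probs_pos])
  qed
  have deriv_shift: "((\<lambda>t. F ((\<theta> i + t * \<beta> i) / \<sigma> (fst i))) has_real_derivative F' ((\<theta> i + t * \<beta> i) / \<sigma> (fst i)) * (\<beta> i / \<sigma> (fst i))) (at t)"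
    if "\<And>x. (F has_real_derivative F' x) (at x)" "i \<in> haar_index J" for F F' :: "real \<Rightarrow> real" and i t \<theta>
  proof -
    have "((\<lambda>t. (\<theta> i + t * \<beta> i) / \<sigma> (fst i)) has_real_derivative \<beta> i / \<sigma> (fst i)) (at t)"
      using \<sigma>_pos [OF that(2)] by (auto intro!: derivative_eq_intros)
    from DERIV_chain2 [OF that(1) this] show ?thesis .
  qed
  \<comment> \<open>\<open>K1\<close>, \<open>K2\<close> and \<open>K3\<close> bound the prior
    correction, the curvature term and the centring for fixed \<open>n\<close> and \<open>X\<close>.
    They need no uniformity, because the Stein identity asks only for some finite bound.\<close>
  define K1 where "K1 = 1 / real n * (\<Sum>i\<in>haar_index J. h1 * \<bar>\<beta> i / \<sigma> (fst i)\<bar>)"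
  define K2 where "K2 = 1 / real n * (\<Sum>i\<in>haar_index J. h2 * (\<beta> i / \<sigma> (fst i))\<^sup>2)"
  define K3 where "K3 = \<bar>(\<Sum>i=1..n. ?b (bin_of p (X i))) / real n\<bar>"
  show "stein_pair M Z T"
  proof (rule stein_pair_from_flow [where \<phi> = \<phi> and L = L and S = "space \<Lambda>" and r = "sqrt (real n)"])
    show "Z \<in> borel_measurable M" "T \<in> borel_measurable M" "L t \<in> borel_measurable M" for t
      using Z_meas T_meas L_meas by (simp_all add: meas_M)
    show "\<phi> t \<in> measurable M M" for t
      unfolding meas_M by (rule \<phi>_meas)
    show "sqrt (real n) > 0" by fact
    show "distr (density M (\<lambda>x. ennreal (exp (L t x)))) M (\<phi> t) = M" for t
      unfolding M
    proof (rule flow_invariance_density [where V = "\<lambda>_. 1" and D = "\<lambda>\<theta>. ennreal (exp (lp \<theta>))"])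
      show "(\<integral>\<^sup>+x. 1 * \<Phi> (\<phi> t x) \<partial>\<Lambda>) = (\<integral>\<^sup>+x. 1 * \<Phi> x \<partial>\<Lambda>)" if "\<Phi> \<in> borel_measurable \<Lambda>" for \<Phi>
      proof -
        have "(\<integral>\<^sup>+x. \<Phi> x \<partial>\<Lambda>) = (\<integral>\<^sup>+x. \<Phi> x \<partial>distr \<Lambda> \<Lambda> (\<phi> t))"
          using distr_PiM_translation [OF finite_haar_index, of J "\<lambda>i. t * \<beta> i"] by (simp only: \<phi>_def)
        also have "\<dots> = (\<integral>\<^sup>+x. \<Phi> (\<phi> t x) \<partial>\<Lambda>)"
          by (rule nn_integral_distr [OF \<phi>_meas]) (use that in simp)
        finally show ?thesis by simp
      qed
      show "ennreal (exp (lp x)) * ennreal (exp (L t x)) = ennreal (exp (lp (\<phi> t x)))" for x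
        by (simp add: L_def flip: ennreal_mult' exp_add)
      show "L t \<in> borel_measurable \<Lambda>" "\<phi> t \<in> measurable \<Lambda> \<Lambda>"
        by (rule L_meas \<phi>_meas)+
      show "(\<lambda>\<theta>. 1 * ennreal (exp (lp \<theta>))) \<in> borel_measurable \<Lambda>" "(\<lambda>\<theta>. ennreal (exp (lp \<theta>))) \<in> borel_measurable \<Lambda>"
        by measurable
    qed auto
    show "space \<Lambda> \<in> sets M" by simp
    show "AE x in M. x \<in> space \<Lambda>" by (rule AE_I2) simp
    show "\<phi> t x \<in> space \<Lambda>" if "x \<in> space \<Lambda>" for t x
      using measurable_space [OF \<phi>_meas that] .
    show \<phi>_0: "\<phi> 0 x = x" if "x \<in> space \<Lambda>" for x
      using that by (auto simp: \<phi>_def space_PiM fun_eq_iff extensional_def PiE_def)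
    show "L 0 x = 0" if "x \<in> space \<Lambda>" for x
      by (simp add: L_def \<phi>_0 [OF that])
    show "((\<lambda>t. Z (\<phi> t x)) has_real_derivative sqrt (real n) * T (\<phi> t x)) (at t)" for t x
    proof -
      have sums: "(\<Sum>i\<in>haar_index J. H' (\<phi> t x i / \<sigma> (fst i)) * \<beta> i / \<sigma> (fst i))
          = (\<Sum>i\<in>haar_index J. H' ((x i + t * \<beta> i) / \<sigma> (fst i)) * (\<beta> i / \<sigma> (fst i)))"
        "(\<Sum>i\<in>haar_index J. H'' (\<phi> t x i / \<sigma> (fst i)) * (\<beta> i / \<sigma> (fst i))\<^sup>2)
          = (\<Sum>i\<in>haar_index J. H'' ((x i + t * \<beta> i) / \<sigma> (fst i)) * (\<beta> i / \<sigma> (fst i)) * (\<beta> i / \<sigma> (fst i)))" for t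
        by (auto intro!: sum.cong simp: \<phi>_i power2_eq_square)
      have "((\<lambda>t. sqrt (real n) * ((\<Sum>\<mu>=1..p. haar_probs J (\<phi> t x) \<mu> * ?b \<mu>)
          + 1 / real n * (\<Sum>i\<in>haar_index J. H' ((x i + t * \<beta> i) / \<sigma> (fst i)) * (\<beta> i / \<sigma> (fst i)))
          - (\<Sum>i=1..n. ?b (bin_of p (X i))) / real n)) has_real_derivative
          sqrt (real n) * (bin_var p ?b (haar_probs J (\<phi> t x))
          + 1 / real n * (\<Sum>i\<in>haar_index J. H'' ((x i + t * \<beta> i) / \<sigma> (fst i)) * (\<beta> i / \<sigma> (fst i)) * (\<beta> i / \<sigma> (fst i))) - 0)) (at t)"
        by (intro DERIV_cmult DERIV_cmult_right DERIV_diff DERIV_add DERIV_sum deriv_mean DERIV_const deriv_shift H(2))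
      then show ?thesis by (simp add: Z_eq T_eq sums)
    qed
    show "((\<lambda>t. L t x) has_real_derivative - sqrt (real n) * Z (\<phi> t x)) (at t)" for t x
    proof -
      let ?s = "\<Sum>\<mu>=1..p. haar_probs J (\<phi> t x) \<mu> * ?b \<mu>"
      let ?h = "\<Sum>i\<in>haar_index J. H' ((x i + t * \<beta> i) / \<sigma> (fst i)) * (\<beta> i / \<sigma> (fst i))"
      have sums: "(\<Sum>i\<in>haar_index J. H' (\<phi> t x i / \<sigma> (fst i)) * \<beta> i / \<sigma> (fst i)) = ?h"
        by (auto intro!: sum.cong simp: \<phi>_i)
      have "((\<lambda>t. L t x) has_real_derivative - ?h + 0 + (\<Sum>i=1..n. 1 * ?b (bin_of p (X i)) - ?s)) (at t)"
        unfolding L_eq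
        by (intro DERIV_add DERIV_minus DERIV_sum DERIV_cmult_right DERIV_diff deriv_ln deriv_shift DERIV_const DERIV_ident H(1))
      moreover have "- sqrt (real n) * Z (\<phi> t x) = - (real n * (?s + 1 / real n * ?h - (\<Sum>i=1..n. ?b (bin_of p (X i))) / real n))"
        unfolding Z_eq sums by (simp only: mult_minus_left mult.assoc [symmetric] sq(1))
      moreover have "\<dots> = - ?h + 0 + (\<Sum>i=1..n. 1 * ?b (bin_of p (X i)) - ?s)"
        using n by (simp add: field_simps sum_subtractf)
      ultimately show ?thesis by simp
    qed
    show "\<bar>Z x\<bar> \<le> sqrt (real n) * (B + K1 + K3) + (B\<^sup>2 + K2) \<and> \<bar>T x\<bar> \<le> sqrt (real n) * (B + K1 + K3) + (B\<^sup>2 + K2)" for x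
    proof -
      have h0: "0 \<le> h1" "0 \<le> h2"
        using H_bound [of 0] by auto
      then have K0: "0 \<le> K1" "0 \<le> K2" "0 \<le> K3"
        unfolding K1_def K2_def K3_def by (auto intro!: divide_nonneg_nonneg sum_nonneg)
      have mean: "\<bar>\<Sum>\<mu>=1..p. haar_probs J x \<mu> * ?b \<mu>\<bar> \<le> B" and var: "\<bar>bin_var p ?b (haar_probs J x)\<bar> \<le> B\<^sup>2"
        by (rule weighted_mean_le bin_var_le, rule less_imp_le [OF haar_probs_pos],
            rule sum_haar_probs, rule b_le, assumption)+
      have "\<bar>\<Sum>i\<in>haar_index J. H' (x i / \<sigma> (fst i)) * \<beta> i / \<sigma> (fst i)\<bar> \<le> (\<Sum>i\<in>haar_index J. h1 * \<bar>\<beta> i / \<sigma> (fst i)\<bar>)"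
        by (rule order_trans [OF sum_abs], rule sum_mono, subst times_divide_eq_right [symmetric], subst abs_mult, rule mult_right_mono [OF H_bound(1)]) simp
      then have k1: "\<bar>1 / real n * (\<Sum>i\<in>haar_index J. H' (x i / \<sigma> (fst i)) * \<beta> i / \<sigma> (fst i))\<bar> \<le> K1"
        unfolding K1_def abs_mult by (intro mult_mono) auto
      have "\<bar>\<Sum>i\<in>haar_index J. H'' (x i / \<sigma> (fst i)) * (\<beta> i / \<sigma> (fst i))\<^sup>2\<bar> \<le> (\<Sum>i\<in>haar_index J. h2 * (\<beta> i / \<sigma> (fst i))\<^sup>2)"
        by (rule order_trans [OF sum_abs], rule sum_mono, subst abs_mult, subst abs_power2, rule mult_right_mono [OF H_bound(2)]) simp
      then have k2: "\<bar>1 / real n * (\<Sum>i\<in>haar_index J. H'' (x i / \<sigma> (fst i)) * (\<beta> i / \<sigma> (fst i))\<^sup>2)\<bar> \<le> K2"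
        unfolding K2_def abs_mult by (intro mult_mono) auto
      have "\<bar>Z x\<bar> \<le> sqrt (real n) * (B + K1 + K3)"
      proof -
        have "\<bar>(\<Sum>\<mu>=1..p. haar_probs J x \<mu> * ?b \<mu>)
            + 1 / real n * (\<Sum>i\<in>haar_index J. H' (x i / \<sigma> (fst i)) * \<beta> i / \<sigma> (fst i))
            - (\<Sum>i=1..n. ?b (bin_of p (X i))) / real n\<bar> \<le> B + K1 + K3"
          using mean k1 unfolding K3_def by linarith
        then show ?thesis
          unfolding Z_eq abs_mult [of "sqrt (real n)"] using sq(2) by (simp only: abs_of_pos) (rule mult_left_mono, auto)
      qed
      moreover have "\<bar>T x\<bar> \<le> B\<^sup>2 + K2"
        unfolding T_eq using var k2 by linarith
      moreover have "0 \<le> sqrt (real n) * (B + K1 + K3)" "0 \<le> B\<^sup>2 + K2"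
        using K0 g(2) by auto
      ultimately show ?thesis by linarith
    qed
  qed
qed

end

section \<open>Hoelder functions and empirical means\<close>

lemma continuous_on_holder:
  fixes f :: "real \<Rightarrow> real"
  assumes s: "s > 0" and f: "\<And>x y. x \<in> S \<Longrightarrow> y \<in> S \<Longrightarrow> \<bar>f x - f y\<bar> \<le> L * \<bar>x - y\<bar> powr s"
  shows "continuous_on S f"
  unfolding continuous_on_def
proof
  fix x assume x: "x \<in> S"
  have "((\<lambda>y. L * \<bar>x - y\<bar> powr s) \<longlongrightarrow> L * \<bar>x - x\<bar> powr s) (at x within S)"
    using s by (intro tendsto_intros) auto
  then have "((\<lambda>y. L * \<bar>x - y\<bar> powr s) \<longlongrightarrow> 0) (at x within S)"
    using s by simp
  moreover have "\<forall>\<^sub>F y in at x within S. norm (f y - f x) \<le> L * \<bar>x - y\<bar> powr s"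
    using f [OF _ x] by (auto simp: eventually_at_filter abs_minus_commute intro!: always_eventually)
  ultimately have "((\<lambda>y. f y - f x) \<longlongrightarrow> 0) (at x within S)"
    by (rule Lim_null_comparison [rotated])
  then show "(f \<longlongrightarrow> f x) (at x within S)"
    by (simp add: LIM_zero_iff)
qed

lemma powr_mono_unit:
  fixes t :: real
  assumes "0 \<le> t" "t \<le> 1" "0 < b" "b \<le> c"
  shows "t powr c \<le> t powr b"
  using assms by (cases "t = 0") (auto intro: powr_mono')

text \<open>If \<gamma> \<le> 1, no derivatives are involved and distances at most 1 allow the
  exponent to be lowered. Otherwise the first derivative is bounded on the compact interval, so the
  function is Lipschitz and the exponent is lowered from 1.\<close>

lemma holder_spaceD:
  assumes g: "g \<in> holder_space \<gamma>" and \<gamma>: "0 < \<gamma>" and s: "0 < s" "s \<le> 1"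
  obtains C where "C \<ge> 0" "\<And>x y. x \<in> {0..1} \<Longrightarrow> y \<in> {0..1} \<Longrightarrow> \<bar>g x - g y\<bar> \<le> C * \<bar>x - y\<bar> powr min \<gamma> s"
proof -
  from g obtain k D L where k: "k = nat \<lceil>\<gamma>\<rceil> - 1" and D0: "\<forall>x\<in>{0..1}. D 0 x = g x"
    and D: "\<forall>i<k. \<forall>x\<in>{0..1}. (D i has_real_derivative D (Suc i) x) (at x within {0..1})"
    and L: "\<forall>x\<in>{0..1}. \<forall>y\<in>{0..1}. \<bar>D k x - D k y\<bar> \<le> L * \<bar>x - y\<bar> powr (\<gamma> - real k)"
    unfolding holder_space_def by blast
  have \<gamma>k: "0 < \<gamma> - real k"
  proof -
    have "1 \<le> \<lceil>\<gamma>\<rceil>" using \<gamma> by simp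
    moreover from this have "k = nat (\<lceil>\<gamma>\<rceil> - 1)" unfolding k by (simp add: nat_diff_distrib)
    ultimately have "real k = of_int \<lceil>\<gamma>\<rceil> - 1" by simp
    then show ?thesis by linarith
  qed
  have "\<exists>C\<ge>0. \<forall>x\<in>{0..1}. \<forall>y\<in>{0..1}. \<bar>g x - g y\<bar> \<le> C * \<bar>x - y\<bar> powr min \<gamma> s"
  proof (cases "k = 0")
    case True
    have "\<bar>g x - g y\<bar> \<le> \<bar>L\<bar> * \<bar>x - y\<bar> powr min \<gamma> s" if "x \<in> {0..1}" "y \<in> {0..1}" for x y
    proof -
      have "\<bar>g x - g y\<bar> \<le> L * \<bar>x - y\<bar> powr \<gamma>"
        using L D0 that True by auto
      also have "\<dots> \<le> \<bar>L\<bar> * \<bar>x - y\<bar> powr min \<gamma> s"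
        using that s \<gamma> by (intro mult_mono powr_mono_unit) auto
      finally show ?thesis .
    qed
    then show ?thesis by (intro exI [of _ "\<bar>L\<bar>"]) auto
  next
    case False
    \<comment> \<open>Two sources of continuity: the Hoelder condition when the first derivative is
      the top one, differentiability when it is not.\<close>
    have "continuous_on {0..1} (D 1)"
    proof (cases "k = 1")
      case True
      then show ?thesis using L \<gamma>k by (intro continuous_on_holder [of "\<gamma> - real k" _ _ L]) auto
    next
      case k1: False
      then have "\<forall>x\<in>{0..1}. (D 1 has_real_derivative D (Suc 1) x) (at x within {0..1})"
        using D False by simp
      then show ?thesis
        by (meson DERIV_continuous continuous_on_eq_continuous_within)
    qed
    then have "bounded (D 1 ` {0..1})"
      by (intro compact_imp_bounded compact_continuous_image) auto
    then obtain C where "\<forall>x\<in>{0..1}. \<bar>D 1 x\<bar> \<le> C"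
      unfolding bounded_iff by auto
    then have C: "\<bar>D 1 x\<bar> \<le> C" if "x \<in> {0..1}" for x
      using that by blast
    have "\<bar>g x - g y\<bar> \<le> C * \<bar>x - y\<bar> powr min \<gamma> s" if xy: "x \<in> {0..1}" "y \<in> {0..1}" for x y
    proof -
      have C0: "0 \<le> C" using C [of 0] by simp
      have "norm (D 0 x - D 0 y) \<le> C * norm (x - y)"
        using D False C xy
        by (intro field_differentiable_bound [of "{0..1}" "D 0" "D 1"]) auto
      then have "\<bar>g x - g y\<bar> \<le> C * \<bar>x - y\<bar> powr 1"
        using D0 xy by simp
      also have "\<dots> \<le> C * \<bar>x - y\<bar> powr min \<gamma> s"
        using xy s \<gamma> C0 by (intro mult_left_mono powr_mono_unit) auto
      finally show ?thesis .
    qed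
    moreover have "0 \<le> C" using C [of 0] by simp
    ultimately show ?thesis by blast
  qed
  then show ?thesis using that by blast
qed

lemma bounded_on_unit_continuous:
  assumes "continuous_on {0..1} g" "\<And>x. x \<in> {0..1} \<Longrightarrow> \<bar>g x\<bar> \<le> B"
  shows "bounded_on_unit B g"
proof -
  have "(\<lambda>x. indicator {0..1} x *\<^sub>R g x) \<in> borel_measurable borel"
    by (rule borel_measurable_continuous_on_indicator) (use assms in auto)
  then show ?thesis
    using assms by (simp add: bounded_on_unit_def set_borel_measurable_def)
qed

lemma bin_diameter:
  assumes "q \<ge> 1" "\<kappa> \<in> {1..q}" "x \<in> bin q \<kappa>" "y \<in> bin q \<kappa>"
  shows "\<bar>x - y\<bar> \<le> 1 / real q"
proof -
  have "(real \<kappa> - 1) / real q \<le> x \<and> x \<le> real \<kappa> / real q" if "x \<in> bin q \<kappa>" for x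
    using that assms(1,2) by (cases "\<kappa> = q") (auto simp: bin_def)
  from this [OF assms(3)] this [OF assms(4)] show ?thesis
    by (auto simp: diff_divide_distrib)
qed

text \<open>The difference is the average of \<open>g y - g x\<close> over the bin of
  \<open>x\<close>, whose diameter is at most 1/q.\<close>

lemma bin_avg_approx:
  assumes q: "q \<ge> 1" and g: "bounded_on_unit B g" and x: "x \<in> {0..1}"
    and osc: "\<And>y. y \<in> {0..1} \<Longrightarrow> \<bar>x - y\<bar> \<le> 1 / real q \<Longrightarrow> \<bar>g y - g x\<bar> \<le> \<epsilon>"
  shows "\<bar>bin_avg q g (bin_of q x) - g x\<bar> \<le> \<epsilon>"
proof -
  let ?b = "bin q (bin_of q x)"
  note r = bin_of_range [OF q x]
  have xb: "x \<in> ?b" using in_bin_iff [OF q x r] by simp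
  have const: "bounded_on_unit \<bar>g x\<bar> (\<lambda>_. g x)" by (rule bounded_on_unit_borel) auto
  have \<epsilon>: "0 \<le> \<epsilon>" using osc [OF x] by simp
  \<comment> \<open>The oscillation is controlled only near \<open>x\<close>, so the difference is
    cut off outside the bin to obtain a bound on all of the unit interval.\<close>
  define h where "h = (\<lambda>y. (g y - g x) * indicator ?b y)"
  have "bounded_on_unit 1 (indicator ?b)" by (rule bounded_on_unit_indicator) simp
  then have "inner2 (indicator ?b) (\<lambda>y. g y - g x) = inner2 (indicator ?b) g - inner2 (indicator ?b) (\<lambda>_. g x)"
    by (rule inner2_diff_right [OF _ g const])
  moreover have "inner2 (\<lambda>_. g x) (indicator ?b) = g x / real q"
    by (rule inner2_bin_const [OF q r]) simp
  ultimately have "bin_avg q g (bin_of q x) - g x = real q * inner2 (indicator ?b) (\<lambda>y. g y - g x)"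
    using q by (simp add: bin_avg_def inner2_commute [of "indicator ?b"] right_diff_distrib)
  also have "inner2 (indicator ?b) (\<lambda>y. g y - g x) = inner2 h (indicator ?b)"
    by (rule inner2_cong) (simp add: h_def indicator_def)
  also have "\<bar>real q * inner2 h (indicator ?b)\<bar> \<le> real q * (\<epsilon> * measure lborel ?b)"
    unfolding abs_mult
  proof (intro mult_mono inner2_le)
    have "set_borel_measurable lborel {0..1} (\<lambda>y. g y - g x)"
    proof -
      have "(\<lambda>y. indicator {0..1} y *\<^sub>R g y - indicator {0..1} y * g x) \<in> borel_measurable lborel"
        using g unfolding bounded_on_unit_def set_borel_measurable_def by (intro borel_measurable_diff) auto
      then show ?thesis
        by (simp add: set_borel_measurable_def right_diff_distrib)
    qed
    then have "(\<lambda>y. (indicator {0..1} y *\<^sub>R (g y - g x)) * indicator ?b y) \<in> borel_measurable lborel"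
      unfolding set_borel_measurable_def by (rule borel_measurable_times) simp
    then have "set_borel_measurable lborel {0..1} h"
      by (simp add: h_def set_borel_measurable_def mult.assoc)
    moreover have "\<bar>h y\<bar> \<le> \<epsilon>" if "y \<in> {0..1}" for y
      using osc [OF that bin_diameter [OF q r xb]] \<epsilon> by (auto simp: h_def indicator_def)
    ultimately show "bounded_on_unit \<epsilon> h"
      unfolding bounded_on_unit_def by blast
    show "?b \<subseteq> {0..1}" by (rule bin_subset [OF q r])
  qed (use \<epsilon> in auto)
  finally show ?thesis using q by (simp add: measure_bin)
qed

section \<open>Concentration and moments under the sampling density\<close>

context
  fixes f0 :: "real \<Rightarrow> real" and c_hi :: real
  assumes f0: "bounded_on_unit c_hi f0" and f0_nonneg: "\<And>x. x \<in> {0..1} \<Longrightarrow> 0 \<le> f0 x"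
    and f0_1: "(LINT x:{0..1}|lborel. f0 x) = 1"
begin

private abbreviation (input) "D \<equiv> density lborel (\<lambda>x. ennreal (f0 x * indicator {0..1} x))"

lemma measurable_f0_indicator:
  "(\<lambda>x. f0 x * indicator {0..1} x) \<in> borel_measurable lborel"
  "(\<lambda>x. ennreal (f0 x * indicator {0..1} x)) \<in> borel_measurable lborel"
proof -
  show *: "(\<lambda>x. f0 x * indicator {0..1} x) \<in> borel_measurable lborel"
    using f0 by (simp add: bounded_on_unit_def set_borel_measurable_def mult.commute)
  show "(\<lambda>x. ennreal (f0 x * indicator {0..1} x)) \<in> borel_measurable lborel"
    by (rule measurable_compose [OF * measurable_ennreal])
qed

lemma prob_space_f0: "prob_space D"
proof
  have "emeasure D (space D) = (\<integral>\<^sup>+x. ennreal (f0 x * indicator {0..1} x) \<partial>lborel)"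
    using measurable_f0_indicator(2) by (simp add: emeasure_density)
  also have "\<dots> = ennreal (\<integral>x. f0 x * indicator {0..1} x \<partial>lborel)"
    using bounded_on_unit_integrable [OF f0] f0_nonneg
    by (intro nn_integral_eq_integral) (auto simp: set_integrable_def mult.commute indicator_def)
  also have "\<dots> = 1"
    using f0_1 by (simp add: set_lebesgue_integral_def mult.commute)
  finally show "emeasure D (space D) = 1" .
qed

lemma integral_f0:
  assumes "g \<in> borel_measurable borel"
  shows "(\<integral>x. g x \<partial>D) = inner2 g f0"
proof -
  have "(\<integral>x. g x \<partial>D) = (\<integral>x. (f0 x * indicator {0..1} x) *\<^sub>R g x \<partial>lborel)"
    by (rule integral_density [OF _ measurable_f0_indicator(1)])
       (use assms f0_nonneg in \<open>auto simp: indicator_def\<close>)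
  also have "\<dots> = inner2 g f0"
    unfolding inner2_def set_lebesgue_integral_def
    by (intro Bochner_Integration.integral_cong) (auto simp: indicator_def)
  finally show ?thesis .
qed

lemma prob_space_sample_law: "prob_space (sample_law f0 n)"
  unfolding sample_law_def by (intro prob_space_PiM prob_space_f0)

lemma AE_sample_unit: "AE X in sample_law f0 n. \<forall>i\<in>{1..n}. X i \<in> {0..1}"
proof -
  have "AE x in D. x \<in> {0..1}"
    by (subst AE_density [OF measurable_f0_indicator(2)]) (auto simp: indicator_def split: if_splits intro!: AE_I2)
  then have "AE X in sample_law f0 n. X i \<in> {0..1}" if "i \<in> {1..n}" for i
    unfolding sample_law_def using that prob_space_f0 by (intro AE_PiM_component) auto
  then show ?thesis
    by (intro AE_finite_allI) auto
qed

text \<open>Each summand lies in an interval of length \<open>2 * B\<close>, so Hoeffding's exponent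
  is -2 K^2 n / (4 n B^2). The bound involves \<open>g\<close> only through \<open>B\<close>, which
  allows histogram functions that change with \<open>n\<close>.\<close>

lemma empirical_deviation:
  assumes g [measurable]: "g \<in> borel_measurable borel" and B: "\<And>x. \<bar>g x\<bar> \<le> B" "B > 0" and n: "n \<ge> 1" and K: "K \<ge> 0"
  shows "{X \<in> space (sample_law f0 n). \<bar>empirical n X g - inner2 g f0\<bar> \<ge> K / sqrt (real n)} \<in> sets (sample_law f0 n)"
    and "emeasure (sample_law f0 n) {X \<in> space (sample_law f0 n). \<bar>empirical n X g - inner2 g f0\<bar> \<ge> K / sqrt (real n)}
      \<le> ennreal (2 * exp (- K\<^sup>2 / (2 * B\<^sup>2)))"
proof -
  interpret D: prob_space D by (rule prob_space_f0)
  interpret S: prob_space "sample_law f0 n" by (rule prob_space_sample_law)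
  have g_D [measurable]: "g \<in> borel_measurable D" by simp
  have comp [measurable]: "(\<lambda>X. X i) \<in> measurable (sample_law f0 n) D" if "i \<in> {1..n}" for i
    unfolding sample_law_def by (rule measurable_component_singleton [OF that])
  have emp: "(\<lambda>X. empirical n X g) \<in> borel_measurable (sample_law f0 n)"
    unfolding empirical_def using measurable_compose [OF comp g_D]
    by (intro borel_measurable_divide borel_measurable_sum) auto
  then show "{X \<in> space (sample_law f0 n). \<bar>empirical n X g - inner2 g f0\<bar> \<ge> K / sqrt (real n)} \<in> sets (sample_law f0 n)"
    by measurable
  have dist_i: "distr (sample_law f0 n) D (\<lambda>X. X i) = D" if "i \<in> {1..n}" for i
    unfolding sample_law_def using that prob_space_f0 by (intro distr_PiM_component) auto
  \<comment> \<open>Taken together the coordinates form the identity map, so their joint law is the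
    product measure itself.\<close>
  have "S.indep_vars (\<lambda>_. D) (\<lambda>i X. X i) {1..n}"
  proof (subst S.indep_vars_iff_distr_eq_PiM')
    have "distr (sample_law f0 n) (PiM {1..n} (\<lambda>_. D)) (\<lambda>x. \<lambda>i\<in>{1..n}. x i) = distr (sample_law f0 n) (sample_law f0 n) (\<lambda>x. x)"
      by (rule distr_cong) (auto simp: sample_law_def space_PiM PiE_def extensional_restrict)
    also have "\<dots> = sample_law f0 n" by (simp add: distr_id2)
    also have "\<dots> = PiM {1..n} (\<lambda>_. D)" by (simp add: sample_law_def)
    also have "\<dots> = PiM {1..n} (\<lambda>i. distr (sample_law f0 n) D (\<lambda>X. X i))"
      by (intro PiM_cong) (auto simp: dist_i)
    finally show "distr (sample_law f0 n) (PiM {1..n} (\<lambda>_. D)) (\<lambda>x. \<lambda>i\<in>{1..n}. x i)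
        = PiM {1..n} (\<lambda>i. distr (sample_law f0 n) D (\<lambda>X. X i))" .
  qed (use n comp in auto)
  then have indep: "S.indep_vars (\<lambda>_. borel) (\<lambda>i X. g (X i)) {1..n}"
    by (rule S.indep_vars_compose2) simp
  have mean: "S.expectation (\<lambda>X. g (X i)) = inner2 g f0" if "i \<in> {1..n}" for i
  proof -
    have "inner2 g f0 = (\<integral>x. g x \<partial>distr (sample_law f0 n) D (\<lambda>X. X i))"
      unfolding dist_i [OF that] by (rule integral_f0 [OF g, symmetric])
    also have "\<dots> = S.expectation (\<lambda>X. g (X i))"
      by (rule integral_distr [OF comp [OF that] g_D])
    finally show ?thesis ..
  qed
  interpret H: Hoeffding_ineq "sample_law f0 n" "{1..n}" "\<lambda>i X. g (X i)" "\<lambda>_. - B" "\<lambda>_. B"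
      "\<Sum>i=1..n. S.expectation (\<lambda>X. g (X i))"
    by unfold_locales (use indep B(1) in \<open>auto simp: abs_le_iff minus_le_iff\<close>)
  have "{X \<in> space (sample_law f0 n). \<bar>empirical n X g - inner2 g f0\<bar> \<ge> K / sqrt (real n)}
      = {X \<in> space (sample_law f0 n). \<bar>(\<Sum>i=1..n. g (X i)) - (\<Sum>i=1..n. S.expectation (\<lambda>X. g (X i)))\<bar> \<ge> K * sqrt (real n)}"
  proof (intro Collect_cong conj_cong refl)
    fix X
    have "(\<Sum>i=1..n. S.expectation (\<lambda>X. g (X i))) = real n * inner2 g f0"
      by (simp add: mean)
    then have "(\<Sum>i=1..n. g (X i)) - (\<Sum>i=1..n. S.expectation (\<lambda>X. g (X i))) = real n * (empirical n X g - inner2 g f0)"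
      using n by (simp add: empirical_def right_diff_distrib)
    then have "\<bar>(\<Sum>i=1..n. g (X i)) - (\<Sum>i=1..n. S.expectation (\<lambda>X. g (X i)))\<bar> = real n * \<bar>empirical n X g - inner2 g f0\<bar>"
      by (simp add: abs_mult)
    moreover have "K * sqrt (real n) \<le> real n * t \<longleftrightarrow> K / sqrt (real n) \<le> t" for t
    proof -
      have "K / sqrt (real n) \<le> t \<longleftrightarrow> K \<le> t * sqrt (real n)"
        using n by (intro pos_divide_le_eq) simp
      also have "\<dots> \<longleftrightarrow> K * sqrt (real n) \<le> t * sqrt (real n) * sqrt (real n)"
        using n by simp
      also have "t * sqrt (real n) * sqrt (real n) = real n * t"
        by (simp add: mult.assoc)
      finally show ?thesis by blast
    qed
    ultimately show "K / sqrt (real n) \<le> \<bar>empirical n X g - inner2 g f0\<bar>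
        \<longleftrightarrow> K * sqrt (real n) \<le> \<bar>(\<Sum>i=1..n. g (X i)) - (\<Sum>i=1..n. S.expectation (\<lambda>X. g (X i)))\<bar>"
      by simp
  qed
  then have "S.prob {X \<in> space (sample_law f0 n). \<bar>empirical n X g - inner2 g f0\<bar> \<ge> K / sqrt (real n)}
      \<le> 2 * exp (- 2 * (K * sqrt (real n))\<^sup>2 / (\<Sum>i=1..n. (B - - B)\<^sup>2))"
    using H.Hoeffding_ineq_abs_ge [of "K * sqrt (real n)"] K B(2) n by (simp add: sum_pos)
  also have "- 2 * (K * sqrt (real n))\<^sup>2 / (\<Sum>i=1..n. (B - - B)\<^sup>2) = - K\<^sup>2 / (2 * B\<^sup>2)"
    using n B(2) by (simp add: power_mult_distrib field_simps power2_eq_square)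
  finally show "emeasure (sample_law f0 n) {X \<in> space (sample_law f0 n). \<bar>empirical n X g - inner2 g f0\<bar> \<ge> K / sqrt (real n)}
      \<le> ennreal (2 * exp (- K\<^sup>2 / (2 * B\<^sup>2)))"
    unfolding S.emeasure_eq_measure by (rule ennreal_leI)
qed

lemma asymp_var_eq:
  assumes a: "bounded_on_unit A a"
  shows "asymp_var f0 a = inner2 (\<lambda>x. (a x)\<^sup>2) f0 - (inner2 a f0)\<^sup>2"
proof -
  let ?m = "inner2 a f0"
  have a2: "bounded_on_unit (A * A) (\<lambda>x. a x * a x)" by (rule bounded_on_unit_mult [OF a a])
  have int: "set_integrable lborel {0..1} (\<lambda>x. a x * a x * f0 x)" "set_integrable lborel {0..1} (\<lambda>x. a x * f0 x)"
    "set_integrable lborel {0..1} f0"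
    using bounded_on_unit_integrable [OF bounded_on_unit_mult [OF a2 f0]] bounded_on_unit_integrable [OF bounded_on_unit_mult [OF a f0]]
      bounded_on_unit_integrable [OF f0] by auto
  have "asymp_var f0 a = (LINT x:{0..1}|lborel. a x * a x * f0 x - 2 * ?m * (a x * f0 x) + ?m\<^sup>2 * f0 x)"
    unfolding asymp_var_def inner2_def by (intro set_lebesgue_integral_cong) (auto simp: power2_eq_square algebra_simps)
  also have "\<dots> = (LINT x:{0..1}|lborel. a x * a x * f0 x) - 2 * ?m * ?m + ?m\<^sup>2 * 1"
    using int f0_1 by (simp add: inner2_def)
  finally show ?thesis
    by (simp add: inner2_def power2_eq_square)
qed

lemma inner2_f0_close:
  assumes "bounded_on_unit A g" "bounded_on_unit A' h" "\<And>x. x \<in> {0..1} \<Longrightarrow> \<bar>g x - h x\<bar> \<le> \<epsilon>"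
  shows "\<bar>inner2 g f0 - inner2 h f0\<bar> \<le> \<epsilon>"
proof -
  have int: "set_integrable lborel {0..1} (\<lambda>x. g x * f0 x)" "set_integrable lborel {0..1} (\<lambda>x. h x * f0 x)" "set_integrable lborel {0..1} f0"
    using assms f0 by (auto intro: bounded_on_unit_integrable bounded_on_unit_mult)
  have "\<bar>inner2 g f0 - inner2 h f0\<bar> = \<bar>LINT x:{0..1}|lborel. g x * f0 x - h x * f0 x\<bar>"
    unfolding inner2_def using int by simp
  also have "\<dots> \<le> (LINT x:{0..1}|lborel. \<epsilon> * f0 x)"
    unfolding set_lebesgue_integral_def
  proof (rule abs_integral_le)
    show "integrable lborel (\<lambda>x. indicator {0..1} x *\<^sub>R (g x * f0 x - h x * f0 x))"
      using set_integral_diff(1) [OF int(1,2)] by (simp add: set_integrable_def)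
    show "integrable lborel (\<lambda>x. indicator {0..1} x *\<^sub>R (\<epsilon> * f0 x))"
      using set_integrable_mult_right [of \<epsilon> lborel "{0..1}" f0] int(3) by (simp add: set_integrable_def)
    show "\<bar>indicator {0..1} x *\<^sub>R (g x * f0 x - h x * f0 x)\<bar> \<le> indicator {0..1} x *\<^sub>R (\<epsilon> * f0 x)" for x
      using assms(3) [of x] f0_nonneg [of x]
      by (auto simp: indicator_def abs_mult mult_right_mono simp flip: left_diff_distrib)
  qed
  also have "\<dots> = \<epsilon>"
    using f0_1 by simp
  finally show ?thesis .
qed

end

section \<open>Distance to the normal law\<close>

text \<open>The inequality \<open>\<bar>z\<bar> \<le> (sqrt K + z\<^sup>2 / sqrt K) / 2\<close>
  replaces Cauchy-Schwarz, and the second moment of \<open>Z\<close> is the mean of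
  \<open>T\<close>. Only the deterministic bound on \<open>T\<close> is used, not its closeness to a
  limit.\<close>

lemma (in prob_space) stein_pair_abs_moment:
  assumes SP: "stein_pair M Z T" and T: "AE x in M. \<bar>T x\<bar> \<le> K" and K: "K > 0"
  shows "expectation (\<lambda>x. \<bar>Z x\<bar>) \<le> sqrt K"
proof -
  note int = stein_pair_integrable [OF SP]
  have sK: "sqrt K > 0" using K by simp
  have "\<bar>z\<bar> \<le> (sqrt K + z\<^sup>2 / sqrt K) / 2" for z :: real
  proof -
    have "0 \<le> (sqrt K - \<bar>z\<bar>)\<^sup>2" by simp
    then show ?thesis using sK K by (simp add: power2_diff field_simps power2_eq_square)
  qed
  then have "expectation (\<lambda>x. \<bar>Z x\<bar>) \<le> expectation (\<lambda>x. (sqrt K + (Z x)\<^sup>2 / sqrt K) / 2)"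
    using int by (intro integral_mono) auto
  also have "\<dots> = (sqrt K + expectation T / sqrt K) / 2"
    using int by (simp add: prob_space stein_pair_second_moment [OF SP])
  also have "expectation T \<le> expectation (\<lambda>_. K)"
    using T int by (intro integral_mono_AE) (auto elim!: eventually_mono)
  then have "(sqrt K + expectation T / sqrt K) / 2 \<le> (sqrt K + K / sqrt K) / 2"
    using sK by (simp add: prob_space divide_right_mono)
  also have "\<dots> = sqrt K"
    using K by (simp add: real_div_sqrt)
  finally show ?thesis .
qed

text \<open>In the applications \<open>U\<close> and \<open>V\<close> are the means of the binned
  function and of its square under the random density, \<open>u\<close> and \<open>w\<close> are
  their empirical counterparts, \<open>r\<close> is the shift caused by the prior, and
  \<open>e\<close> the gap between \<open>T1\<close> and the variance
  \<open>V x - (U x)\<^sup>2\<close>. In the factor \<open>1 + 2 * A\<close>, the 1 comes from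
  \<open>V x - w\<close> and \<open>2 * A\<close> from factoring the difference of the squared
  means.\<close>

lemma (in prob_space) stein_pair_variance_bound:
  fixes U V :: "'a \<Rightarrow> real"
  assumes SP1: "stein_pair M Z1 T1" and SP2: "stein_pair M Z2 T2" and n: "n \<ge> 1" and K: "K > 0"
    and T: "AE x in M. \<bar>T1 x\<bar> \<le> K \<and> \<bar>T2 x\<bar> \<le> K"
    and U: "AE x in M. \<bar>U x\<bar> \<le> A" and u: "\<bar>u\<bar> \<le> A"
    and T1: "AE x in M. \<bar>T1 x - (V x - (U x)\<^sup>2)\<bar> \<le> e"
    and dev: "AE x in M. \<bar>U x - u\<bar> \<le> r + \<bar>Z1 x\<bar> / sqrt (real n) \<and> \<bar>V x - w\<bar> \<le> r + \<bar>Z2 x\<bar> / sqrt (real n)"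
  shows "expectation (\<lambda>x. \<bar>T1 x - v\<bar>) \<le> e + (1 + 2 * A) * (r + sqrt (K / real n)) + \<bar>w - u\<^sup>2 - v\<bar>"
proof -
  note int1 = stein_pair_integrable [OF SP1] and int2 = stein_pair_integrable [OF SP2]
  have A: "A \<ge> 0" using u by simp
  let ?n = "sqrt (real n)"
  have np: "?n > 0" using n by simp
  let ?f = "\<lambda>x. e + (r + \<bar>Z2 x\<bar> / ?n) + 2 * A * (r + \<bar>Z1 x\<bar> / ?n) + \<bar>w - u\<^sup>2 - v\<bar>"
  have "AE x in M. \<bar>T1 x - v\<bar> \<le> ?f x"
    using T1 dev U
  proof eventually_elim
    case (elim x)
    have "(U x)\<^sup>2 - u\<^sup>2 = (U x + u) * (U x - u)"
      by (simp add: power2_eq_square algebra_simps)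
    then have "\<bar>(U x)\<^sup>2 - u\<^sup>2\<bar> = \<bar>U x + u\<bar> * \<bar>U x - u\<bar>"
      by (simp add: abs_mult)
    also have "\<dots> \<le> (2 * A) * (r + \<bar>Z1 x\<bar> / ?n)"
      using elim u A by (intro mult_mono) auto
    finally have "\<bar>(U x)\<^sup>2 - u\<^sup>2\<bar> \<le> 2 * A * (r + \<bar>Z1 x\<bar> / ?n)" .
    then show ?case using elim by linarith
  qed
  then have "expectation (\<lambda>x. \<bar>T1 x - v\<bar>) \<le> expectation ?f"
    using int1 int2 by (intro integral_mono_AE) auto
  also have "\<dots> = e + (r + expectation (\<lambda>x. \<bar>Z2 x\<bar>) / ?n) + 2 * A * (r + expectation (\<lambda>x. \<bar>Z1 x\<bar>) / ?n) + \<bar>w - u\<^sup>2 - v\<bar>"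
    using int1 int2 by (simp add: prob_space)
  also have "\<dots> \<le> e + (r + sqrt K / ?n) + 2 * A * (r + sqrt K / ?n) + \<bar>w - u\<^sup>2 - v\<bar>"
  proof -
    have "expectation (\<lambda>x. \<bar>Z1 x\<bar>) / ?n \<le> sqrt K / ?n" "expectation (\<lambda>x. \<bar>Z2 x\<bar>) / ?n \<le> sqrt K / ?n"
      using np T K by (auto intro!: divide_right_mono stein_pair_abs_moment [OF SP1] stein_pair_abs_moment [OF SP2] elim!: eventually_mono)
    then show ?thesis
      using A by (intro add_mono mult_left_mono order_refl) auto
  qed
  finally show ?thesis
    by (simp add: real_sqrt_divide algebra_simps)
qed

section \<open>Bounds for fixed data under both priors\<close>

lemma step_cong: "(\<And>\<mu>. \<mu> \<in> {1..p} \<Longrightarrow> c \<mu> = d \<mu>) \<Longrightarrow> step_fun p c = step_fun p d"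
  unfolding step_fun_def [abs_def] by (intro ext sum.cong) auto

lemma empirical_step_le:
  assumes "p \<ge> 1" "n \<ge> 1" "\<And>i. i \<in> {1..n} \<Longrightarrow> X i \<in> {0..1}" "\<And>\<mu>. \<mu> \<in> {1..p} \<Longrightarrow> \<bar>c \<mu>\<bar> \<le> A"
  shows "\<bar>empirical n X (step_fun p c)\<bar> \<le> A"
proof -
  have "\<bar>\<Sum>i=1..n. step_fun p c (X i)\<bar> \<le> (\<Sum>i=1..n. A)"
    using assms bin_of_range [OF assms(1)] by (intro order_trans [OF sum_abs] sum_mono) (auto simp: step_eq)
  then show ?thesis
    using assms(2) by (simp add: empirical_def field_simps)
qed

lemma square_le_fourth_power:
  fixes A :: real
  assumes "A \<ge> 1"
  shows "A \<le> A\<^sup>2" "A\<^sup>2 \<le> A ^ 4"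
  using assms power_increasing [of 1 2 A] power_increasing [of 2 4 A] by auto

text \<open>The square of the projection is a histogram function, hence its own projection. The
  Stein identity for it is therefore centred at the empirical second moment of the projected
  function.\<close>

lemma squares_of_bin_avg:
  assumes p: "p \<ge> 1" and a: "bounded_on_unit A a" "A \<ge> 0"
  shows "bounded_on_unit (A\<^sup>2) (step_fun p (\<lambda>\<mu>. (bin_avg p a \<mu>)\<^sup>2))"
    and "\<mu> \<in> {1..p} \<Longrightarrow> bin_avg p (step_fun p (\<lambda>\<mu>. (bin_avg p a \<mu>)\<^sup>2)) \<mu> = (bin_avg p a \<mu>)\<^sup>2"
    and "centring p (step_fun p (\<lambda>\<mu>. (bin_avg p a \<mu>)\<^sup>2)) n X = empirical n X (step_fun p (\<lambda>\<mu>. (bin_avg p a \<mu>)\<^sup>2))"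
proof -
  have "\<bar>(bin_avg p a \<mu>)\<^sup>2\<bar> \<le> A\<^sup>2" if "\<mu> \<in> {1..p}" for \<mu>
    using bin_avg_le [OF p a that] by (metis abs_ge_zero abs_power2 power2_abs power_mono)
  then show *: "bounded_on_unit (A\<^sup>2) (step_fun p (\<lambda>\<mu>. (bin_avg p a \<mu>)\<^sup>2))"
    by (rule bounded_on_unit_step [OF p])
  show avg: "bin_avg p (step_fun p (\<lambda>\<mu>. (bin_avg p a \<mu>)\<^sup>2)) \<mu> = (bin_avg p a \<mu>)\<^sup>2" if "\<mu> \<in> {1..p}" for \<mu>
    by (rule bin_avg_step [OF p that])
  then have "step_fun p (bin_avg p (step_fun p (\<lambda>\<mu>. (bin_avg p a \<mu>)\<^sup>2))) = step_fun p (\<lambda>\<mu>. (bin_avg p a \<mu>)\<^sup>2)"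
    by (rule step_cong)
  then show "centring p (step_fun p (\<lambda>\<mu>. (bin_avg p a \<mu>)\<^sup>2)) n X = empirical n X (step_fun p (\<lambda>\<mu>. (bin_avg p a \<mu>)\<^sup>2))"
    by (simp add: centring_def hist_proj_eq [OF p *])
qed

lemma haar_energy_eq: "haar_energy J \<sigma> g = (\<Sum>(j, k)\<in>haar_index J. (inner2 (haar j k) g / \<sigma> j)\<^sup>2)"
proof -
  have "haar_energy J \<sigma> g = (\<Sum>j=0..J. \<Sum>k=1..2 ^ j. (inner2 (haar j k) g / \<sigma> j)\<^sup>2)"
    by (simp add: haar_energy_def sum_distrib_left power_divide)
  also have "\<dots> = (\<Sum>(j, k)\<in>haar_index J. (inner2 (haar j k) g / \<sigma> j)\<^sup>2)"
    unfolding haar_index_def by (subst sum.Sigma) auto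
  finally show ?thesis .
qed

text \<open>Level \<open>j\<close> has 2^j coefficients of size at most
  \<open>B * 2 powr (- real j / 2)\<close>, so their absolute values add up to at most
  \<open>B * 2 powr (real j / 2)\<close> and their squares to at most \<open>B\<^sup>2\<close>. The
  energy bound is meant for the squared projection, since the energy hypothesis speaks about
  \<open>a\<close> alone.\<close>

lemma haar_coefficient_sums:
  assumes g: "bounded_on_unit B g" "0 \<le> B" and \<sigma>: "\<And>j. j \<le> J \<Longrightarrow> 0 < \<sigma> j"
  defines "S \<equiv> \<Sum>j=0..J. 1 / \<sigma> j * 2 powr (real j / 2)"
  shows "(\<Sum>(j, k)\<in>haar_index J. \<bar>inner2 (haar j k) g / \<sigma> j\<bar>) \<le> B * S"
    and "haar_energy J \<sigma> g \<le> B\<^sup>2 * S\<^sup>2"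
proof -
  have pw: "(2::real) ^ j * 2 powr (- real j / 2) = 2 powr (real j / 2)"
    "(2::real) ^ j * (2 powr (- real j / 2))\<^sup>2 = 1" for j
  proof -
    have "(2::real) ^ j * 2 powr (- real j / 2) = 2 powr (real j + (- real j / 2))"
      by (simp only: powr_add) (simp add: powr_realpow)
    then show "(2::real) ^ j * 2 powr (- real j / 2) = 2 powr (real j / 2)" by (simp add: field_simps)
    have "(2 powr (- real j / 2))\<^sup>2 = 2 powr (- real j)"
      by (simp add: power2_eq_square flip: powr_add)
    then show "(2::real) ^ j * (2 powr (- real j / 2))\<^sup>2 = 1"
      by (simp add: powr_minus powr_realpow)
  qed
  have "(\<Sum>(j, k)\<in>haar_index J. \<bar>inner2 (haar j k) g / \<sigma> j\<bar>) = (\<Sum>j=0..J. \<Sum>k=1..2 ^ j. \<bar>inner2 (haar j k) g / \<sigma> j\<bar>)"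
    unfolding haar_index_def by (subst sum.Sigma) auto
  also have "\<dots> \<le> (\<Sum>j=0..J. \<Sum>k=1..(2::nat) ^ j. B * 2 powr (- real j / 2) / \<sigma> j)"
  proof (intro sum_mono)
    fix j k :: nat assume j: "j \<in> {0..J}" and k: "k \<in> {1..2 ^ j}"
    then have "0 < \<sigma> j" using \<sigma> by simp
    then show "\<bar>inner2 (haar j k) g / \<sigma> j\<bar> \<le> B * 2 powr (- real j / 2) / \<sigma> j"
      using divide_right_mono [OF inner2_haar_le [OF g k], of "\<sigma> j"] by (simp add: abs_divide)
  qed
  also have "\<dots> = (\<Sum>j=0..J. B * (1 / \<sigma> j * (2 ^ j * 2 powr (- real j / 2))))"
    by (intro sum.cong) auto
  also have "\<dots> = B * S"
    unfolding pw S_def by (simp add: sum_distrib_left)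
  finally show "(\<Sum>(j, k)\<in>haar_index J. \<bar>inner2 (haar j k) g / \<sigma> j\<bar>) \<le> B * S" .
  have sq_le: "(inner2 (haar j k) g)\<^sup>2 \<le> B\<^sup>2 * (2 powr (- real j / 2))\<^sup>2" if "k \<in> {1..2 ^ j}" for j k
    using power_mono [OF inner2_haar_le [OF g that], of 2] by (simp add: power_mult_distrib)
  have "haar_energy J \<sigma> g \<le> (\<Sum>j=0..J. 1 / (\<sigma> j)\<^sup>2 * (\<Sum>k=1..(2::nat) ^ j. B\<^sup>2 * (2 powr (- real j / 2))\<^sup>2))"
    unfolding haar_energy_def using sq_le by (intro sum_mono mult_left_mono) auto
  also have "\<dots> = (\<Sum>j=0..J. B\<^sup>2 * (1 / \<sigma> j)\<^sup>2 * (2 ^ j * (2 powr (- real j / 2))\<^sup>2))"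
    by (intro sum.cong) (auto simp: power_divide)
  also have "\<dots> = B\<^sup>2 * (\<Sum>j=0..J. (1 / \<sigma> j)\<^sup>2)"
    unfolding pw by (simp add: sum_distrib_left)
  also have "\<dots> \<le> B\<^sup>2 * S\<^sup>2"
  proof (rule mult_left_mono)
    have le_S: "1 / \<sigma> j \<le> S" if "j \<in> {0..J}" for j
    proof -
      have "1 / \<sigma> j * 1 \<le> 1 / \<sigma> j * 2 powr (real j / 2)"
        using \<sigma> that by (intro mult_left_mono) (auto simp: ge_one_powr_ge_zero less_imp_le)
      also have "\<dots> \<le> S"
        unfolding S_def using \<sigma> that by (intro member_le_sum) (auto simp: less_imp_le)
      finally show ?thesis by simp
    qed
    \<comment> \<open>One factor \<open>1 / \<sigma> j\<close> is enlarged by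
      \<open>2 powr (real j / 2) \<ge> 1\<close>, the other is bounded by the whole sum
      \<open>S\<close>.\<close>
    have "(\<Sum>j=0..J. (1 / \<sigma> j)\<^sup>2) \<le> (\<Sum>j=0..J. 1 / \<sigma> j * 2 powr (real j / 2) * S)"
    proof (rule sum_mono)
      fix j assume j: "j \<in> {0..J}"
      then have "0 < \<sigma> j" using \<sigma> by auto
      then have "1 / \<sigma> j * 1 \<le> 1 / \<sigma> j * 2 powr (real j / 2)"
        by (intro mult_left_mono) (auto simp: ge_one_powr_ge_zero)
      then show "(1 / \<sigma> j)\<^sup>2 \<le> 1 / \<sigma> j * 2 powr (real j / 2) * S"
        unfolding power2_eq_square using le_S [OF j] \<open>0 < \<sigma> j\<close> by (intro mult_mono) auto
    qed
    also have "\<dots> = (\<Sum>j=0..J. 1 / \<sigma> j * 2 powr (real j / 2)) * S"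
      by (rule sum_distrib_right [symmetric])
    also have "\<dots> = S\<^sup>2"
      by (simp only: S_def power2_eq_square)
    finally show "(\<Sum>j=0..J. (1 / \<sigma> j)\<^sup>2) \<le> S\<^sup>2" .
  qed simp
  finally show "haar_energy J \<sigma> g \<le> B\<^sup>2 * S\<^sup>2" .
qed

text \<open>Two Stein pairs live on the same posterior, one for \<open>a\<close> and one for the
  square of its projection. As \<open>1 \<le> A\<close>, the number \<open>A\<^sup>2\<close> bounds
  both functions, and its square is the \<open>A ^ 4\<close> in the common bound for
  \<open>T\<close>.\<close>

lemma haar_BvM_bound:
  fixes J n :: nat and \<sigma> :: "nat \<Rightarrow> real" and H H' H'' a :: "real \<Rightarrow> real" and X :: "nat \<Rightarrow> real"
  assumes \<sigma>: "\<And>j. j \<le> J \<Longrightarrow> 0 < \<sigma> j"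
    and H: "\<And>x. (H has_real_derivative H' x) (at x)" "\<And>x. (H' has_real_derivative H'' x) (at x)"
    and H_bound: "\<And>x. \<bar>H' x\<bar> \<le> h1" "\<And>x. \<bar>H'' x\<bar> \<le> h2"
    and n: "n \<ge> 1" and X: "\<And>i. i \<in> {1..n} \<Longrightarrow> X i \<in> {0..1}"
    and a: "bounded_on_unit A a" "1 \<le> A" and v: "v > 0"
    and fin: "norm_const (haar_prior J \<sigma> H) (haar_density J) n X \<noteq> \<infinity>"
  defines "p \<equiv> 2 ^ (J + 1)"
  defines "b \<equiv> bin_avg p a"
  defines "S \<equiv> \<Sum>j=0..J. 1 / \<sigma> j * 2 powr (real j / 2)"
  shows "\<bar>d_BL (posterior_law (haar_prior J \<sigma> H) (haar_density J) n X
            (\<lambda>f. sqrt (real n) * (haar_functional J \<sigma> H' a n f - centring p a n X))) (gaussian v)\<bar>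
    \<le> 4 / v * (h2 / real n * haar_energy J \<sigma> a
        + (1 + 2 * A) * (h1 * A\<^sup>2 * S / real n + sqrt ((A ^ 4 + h2 * A ^ 4 * S\<^sup>2 / real n) / real n))
        + \<bar>empirical n X (step_fun p (\<lambda>\<mu>. (b \<mu>)\<^sup>2)) - (empirical n X (step_fun p b))\<^sup>2 - v\<bar>)"
proof -
  define M where "M = posterior (haar_prior J \<sigma> H) (haar_density J) n X"
  define g2 where "g2 = step_fun p (\<lambda>\<mu>. (b \<mu>)\<^sup>2)"
  define Z where "Z = (\<lambda>g \<theta>. sqrt (real n) * (haar_functional J \<sigma> H' g n (haar_density J \<theta>) - centring p g n X))"
  define T where "T = (\<lambda>g \<theta>. bin_var p (bin_avg p g) (haar_probs J \<theta>)
      + 1 / real n * (\<Sum>(j, k)\<in>haar_index J. H'' (\<theta> (j, k) / \<sigma> j) * (inner2 (haar j k) g / \<sigma> j)\<^sup>2))"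
  have p1: "p \<ge> 1" by (simp add: p_def)
  have A: "0 \<le> A" "0 \<le> A\<^sup>2" "A \<le> A\<^sup>2" "A\<^sup>2 \<le> A ^ 4"
    using a(2) square_le_fourth_power by auto
  have h: "0 \<le> h1" "0 \<le> h2" using H_bound [of 0] by auto
  have S: "0 \<le> S" unfolding S_def using \<sigma> by (intro sum_nonneg) (auto simp: less_imp_le)
  have aA2: "bounded_on_unit (A\<^sup>2) a"
    using a(1) A(3) unfolding bounded_on_unit_def by force
  have g2: "bounded_on_unit (A\<^sup>2) g2"
    unfolding g2_def b_def by (rule squares_of_bin_avg [OF p1 a(1) A(1)])
  have M: "prob_space M"
    unfolding M_def by (rule haar_stein_pair(1)) (fact \<sigma> H H_bound n X aA2 A(2) fin)+
  have SP: "stein_pair M (Z g) (T g)" if g: "bounded_on_unit (A\<^sup>2) g" for g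
    unfolding Z_def T_def M_def p_def
    by (rule haar_stein_pair(2)) (fact \<sigma> H H_bound n X g A(2) fin)+
  interpret prob_space M by (rule M)
  have pr: "0 \<le> haar_probs J \<theta> \<mu>" "(\<Sum>\<mu>=1..p. haar_probs J \<theta> \<mu>) = 1" for \<theta> \<mu>
    using haar_probs_pos [of J \<theta> \<mu>] sum_haar_probs [of J \<theta>] by (simp_all add: p_def)
  \<comment> \<open>For \<open>a\<close> this gap is kept as the energy term of the rate; for
    \<open>g2\<close> it only enters the crude bound \<open>T_le\<close>, through
    \<open>S\<close>.\<close>
  have curv: "\<bar>T g \<theta> - bin_var p (bin_avg p g) (haar_probs J \<theta>)\<bar> \<le> h2 / real n * haar_energy J \<sigma> g" for g \<theta>
  proof -
    have "\<bar>\<Sum>(j, k)\<in>haar_index J. H'' (\<theta> (j, k) / \<sigma> j) * (inner2 (haar j k) g / \<sigma> j)\<^sup>2\<bar> \<le> h2 * haar_energy J \<sigma> g"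
      unfolding haar_energy_eq sum_distrib_left
      by (rule order_trans [OF sum_abs], rule sum_mono)
         (auto simp: abs_mult split_beta simp del: power_divide intro!: mult_right_mono H_bound(2))
    then show ?thesis
      using n by (simp add: T_def abs_mult divide_right_mono)
  qed
  \<comment> \<open>The definition of \<open>Z\<close> solved for the mean under the random density:
    its distance to the centring is the \<open>H'\<close> correction plus \<open>Z\<close> divided
    by sqrt n.\<close>
  have shift: "\<bar>(\<Sum>\<mu>=1..p. haar_probs J \<theta> \<mu> * bin_avg p g \<mu>) - centring p g n X\<bar>
      \<le> h1 * A\<^sup>2 * S / real n + \<bar>Z g \<theta>\<bar> / sqrt (real n)" if g: "bounded_on_unit (A\<^sup>2) g" for g \<theta>
  proof -
    let ?c = "\<Sum>(j, k)\<in>haar_index J. H' (\<theta> (j, k) / \<sigma> j) * inner2 (haar j k) g / \<sigma> j"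
    have "\<bar>?c\<bar> \<le> (\<Sum>(j, k)\<in>haar_index J. h1 * \<bar>inner2 (haar j k) g / \<sigma> j\<bar>)"
      unfolding split_beta times_divide_eq_right [symmetric]
      by (rule order_trans [OF sum_abs], rule sum_mono, subst abs_mult, rule mult_right_mono [OF H_bound(1)]) simp
    also have "\<dots> = h1 * (\<Sum>(j, k)\<in>haar_index J. \<bar>inner2 (haar j k) g / \<sigma> j\<bar>)"
      by (simp add: sum_distrib_left split_beta)
    also have "\<dots> \<le> h1 * (A\<^sup>2 * S)"
      unfolding S_def using haar_coefficient_sums(1) [OF g A(2) \<sigma>] h by (intro mult_left_mono) auto
    finally have c: "\<bar>1 / real n * ?c\<bar> \<le> h1 * A\<^sup>2 * S / real n"
      using n by (simp add: abs_mult divide_right_mono mult.assoc)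
    have "\<bar>Z g \<theta>\<bar> / sqrt (real n) = \<bar>haar_functional J \<sigma> H' g n (haar_density J \<theta>) - centring p g n X\<bar>"
      using n by (simp add: Z_def abs_mult)
    also have "haar_functional J \<sigma> H' g n (haar_density J \<theta>)
        = (\<Sum>\<mu>=1..p. haar_probs J \<theta> \<mu> * bin_avg p g \<mu>) + 1 / real n * ?c"
      unfolding p_def by (rule haar_functional_eq) (fact \<sigma> H H_bound n X g A(2))+
    finally show ?thesis using c by linarith
  qed
  have avg2: "(\<Sum>\<mu>=1..p. haar_probs J \<theta> \<mu> * bin_avg p g2 \<mu>) = (\<Sum>\<mu>=1..p. haar_probs J \<theta> \<mu> * (b \<mu>)\<^sup>2)" for \<theta>
    unfolding g2_def b_def using squares_of_bin_avg(2) [OF p1 a(1) A(1)] by (intro sum.cong) auto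
  have emp: "centring p a n X = empirical n X (step_fun p b)" "centring p g2 n X = empirical n X g2"
    unfolding g2_def b_def by (simp add: centring_def hist_proj_eq [OF p1 a(1)], rule squares_of_bin_avg(3) [OF p1 a(1) A(1)])
  let ?K = "A ^ 4 + h2 * A ^ 4 * S\<^sup>2 / real n"
  have T_le: "\<bar>T g \<theta>\<bar> \<le> ?K" if g: "bounded_on_unit (A\<^sup>2) g" for g \<theta>
  proof -
    have "\<bar>bin_var p (bin_avg p g) (haar_probs J \<theta>)\<bar> \<le> (A\<^sup>2)\<^sup>2"
      by (rule bin_var_le [OF pr]) (rule bin_avg_le [OF p1 g A(2)])
    moreover have "h2 / real n * haar_energy J \<sigma> g \<le> h2 / real n * ((A\<^sup>2)\<^sup>2 * S\<^sup>2)"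
      unfolding S_def using haar_coefficient_sums(2) [OF g A(2) \<sigma>] h by (intro mult_left_mono) auto
    ultimately show ?thesis
      using curv [of g \<theta>] by (simp add: mult.assoc flip: power_mult)
  qed
  have K: "?K > 0" using h S a(2) by (intro add_pos_nonneg) auto
  have "\<bar>d_BL (distr M borel (Z a)) (gaussian v)\<bar> \<le> 4 / v * expectation (\<lambda>\<theta>. \<bar>T a \<theta> - v\<bar>)"
    by (rule d_BL_stein_pair [OF SP [OF aA2] v])
  also have "\<dots> \<le> 4 / v * (h2 / real n * haar_energy J \<sigma> a
        + (1 + 2 * A) * (h1 * A\<^sup>2 * S / real n + sqrt (?K / real n)) + \<bar>empirical n X g2 - (empirical n X (step_fun p b))\<^sup>2 - v\<bar>)"
  proof (rule mult_left_mono)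
    have b_le: "\<bar>b \<mu>\<bar> \<le> A" if "\<mu> \<in> {1..p}" for \<mu>
      unfolding b_def by (rule bin_avg_le [OF p1 a(1) A(1) that])
    show "expectation (\<lambda>\<theta>. \<bar>T a \<theta> - v\<bar>) \<le> h2 / real n * haar_energy J \<sigma> a
        + (1 + 2 * A) * (h1 * A\<^sup>2 * S / real n + sqrt (?K / real n)) + \<bar>empirical n X g2 - (empirical n X (step_fun p b))\<^sup>2 - v\<bar>"
    proof (rule stein_pair_variance_bound [OF SP [OF aA2] SP [OF g2] n K])
      show "AE x in M. \<bar>T a x\<bar> \<le> ?K \<and> \<bar>T g2 x\<bar> \<le> ?K"
        using T_le aA2 g2 by (intro AE_I2) auto
      show "AE x in M. \<bar>\<Sum>\<mu>=1..p. haar_probs J x \<mu> * b \<mu>\<bar> \<le> A"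
        using weighted_mean_le [OF pr b_le] by (intro AE_I2) auto
      show "\<bar>empirical n X (step_fun p b)\<bar> \<le> A"
        by (rule empirical_step_le [OF p1 n X b_le])
      show "AE x in M. \<bar>T a x - ((\<Sum>\<mu>=1..p. haar_probs J x \<mu> * (b \<mu>)\<^sup>2) - (\<Sum>\<mu>=1..p. haar_probs J x \<mu> * b \<mu>)\<^sup>2)\<bar>
          \<le> h2 / real n * haar_energy J \<sigma> a"
        using curv [of a] by (intro AE_I2) (simp only: bin_var_def b_def)
      show "AE x in M. \<bar>(\<Sum>\<mu>=1..p. haar_probs J x \<mu> * b \<mu>) - empirical n X (step_fun p b)\<bar> \<le> h1 * A\<^sup>2 * S / real n + \<bar>Z a x\<bar> / sqrt (real n)
          \<and> \<bar>(\<Sum>\<mu>=1..p. haar_probs J x \<mu> * (b \<mu>)\<^sup>2) - empirical n X g2\<bar> \<le> h1 * A\<^sup>2 * S / real n + \<bar>Z g2 x\<bar> / sqrt (real n)"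
        using shift [OF aA2] shift [OF g2] by (intro AE_I2) (simp only: avg2 emp b_def)
    qed
  qed (use v in simp)
  finally show ?thesis
    by (simp only: posterior_law_def M_def Z_def g2_def)
qed

text \<open>The correction is a difference of two terms of size at most
  \<open>m1 * A\<^sup>2\<close>, hence the factor 2 in the shift. Here the gap between
  \<open>T\<close> and the variance is multiplicative, the fraction \<open>m1 / real n\<close> of
  the variance.\<close>

lemma dirichlet_BvM_bound:
  fixes p n :: nat and m :: "nat \<Rightarrow> real" and X :: "nat \<Rightarrow> real" and a :: "real \<Rightarrow> real"
  assumes p: "p \<ge> 1" and m: "\<And>\<mu>. \<mu> \<in> {1..p} \<Longrightarrow> 0 < m \<mu>" and n: "n \<ge> 1"
    and X: "\<And>i. i \<in> {1..n} \<Longrightarrow> X i \<in> {0..1}"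
    and a: "bounded_on_unit A a" "1 \<le> A" and v: "v > 0"
  defines "b \<equiv> bin_avg p a"
  defines "m1 \<equiv> \<Sum>\<mu>=1..p. m \<mu>"
  shows "\<bar>d_BL (posterior_law (dirichlet_prior p m) (dirichlet_density p) n X
            (\<lambda>f. sqrt (real n) * (dirichlet_functional p m a n f - centring p a n X))) (gaussian v)\<bar>
    \<le> 4 / v * (m1 / real n * A\<^sup>2
        + (1 + 2 * A) * (2 * m1 * A\<^sup>2 / real n + sqrt ((1 + m1 / real n) * A ^ 4 / real n))
        + \<bar>empirical n X (step_fun p (\<lambda>\<mu>. (b \<mu>)\<^sup>2)) - (empirical n X (step_fun p b))\<^sup>2 - v\<bar>)"
proof -
  define M where "M = posterior (dirichlet_prior p m) (dirichlet_density p) n X"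
  define g2 where "g2 = step_fun p (\<lambda>\<mu>. (b \<mu>)\<^sup>2)"
  define Z where "Z = (\<lambda>g w. sqrt (real n) * (dirichlet_functional p m g n (dirichlet_density p w) - centring p g n X))"
  define T where "T = (\<lambda>g w. (1 + m1 / real n) * bin_var p (bin_avg p g) (bin_probs p w))"
  have A: "0 \<le> A" "0 \<le> A\<^sup>2" "A \<le> A\<^sup>2" "A\<^sup>2 \<le> A ^ 4"
    using a(2) square_le_fourth_power by auto
  have m1: "0 \<le> m1" unfolding m1_def using m by (intro sum_nonneg) (auto simp: less_imp_le)
  have aA2: "bounded_on_unit (A\<^sup>2) a"
    using a(1) A(3) unfolding bounded_on_unit_def by force
  have g2: "bounded_on_unit (A\<^sup>2) g2"
    unfolding g2_def b_def by (rule squares_of_bin_avg [OF p a(1) A(1)])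
  have M: "prob_space M"
    unfolding M_def by (rule dirichlet_stein_pair(1)) (fact p m n X aA2 A(2))+
  have SP: "stein_pair M (Z g) (T g)" if g: "bounded_on_unit (A\<^sup>2) g" for g
    unfolding Z_def T_def M_def m1_def
    by (rule dirichlet_stein_pair(2)) (fact p m n X g A(2))+
  have simplex: "AE w in M. w \<in> bin_simplex p"
    unfolding M_def by (rule dirichlet_stein_pair(3)) (fact p m n X aA2 A(2))+
  interpret prob_space M by (rule M)
  have pr: "0 \<le> bin_probs p w \<mu>" if "w \<in> bin_simplex p" "\<mu> \<in> {1..p}" for w \<mu>
    using that by (auto simp: bin_simplex_def less_imp_le)
  have mean_le: "\<bar>\<Sum>\<mu>=1..p. bin_probs p w \<mu> * bin_avg p g \<mu>\<bar> \<le> B"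
    if "w \<in> bin_simplex p" "bounded_on_unit B g" "0 \<le> B" for w g B
    by (rule weighted_mean_le [OF pr [OF that(1)] sum_bin_probs [OF p] bin_avg_le [OF p that(2,3)]])
  have var_le: "\<bar>bin_var p (bin_avg p g) (bin_probs p w)\<bar> \<le> B\<^sup>2"
    if "w \<in> bin_simplex p" "bounded_on_unit B g" "0 \<le> B" for w g B
    by (rule bin_var_le [OF pr [OF that(1)] sum_bin_probs [OF p] bin_avg_le [OF p that(2,3)]])
  have shift: "\<bar>(\<Sum>\<mu>=1..p. bin_probs p w \<mu> * bin_avg p g \<mu>) - centring p g n X\<bar>
      \<le> 2 * m1 * A\<^sup>2 / real n + \<bar>Z g w\<bar> / sqrt (real n)" if g: "bounded_on_unit (A\<^sup>2) g" and w: "w \<in> bin_simplex p" for g w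
  proof -
    let ?U = "\<Sum>\<mu>=1..p. bin_probs p w \<mu> * bin_avg p g \<mu>"
    let ?c = "(\<Sum>\<mu>=1..p. m \<mu> * bin_avg p g \<mu>) - m1 * ?U"
    have "\<bar>\<Sum>\<mu>=1..p. m \<mu> * bin_avg p g \<mu>\<bar> \<le> (\<Sum>\<mu>=1..p. m \<mu> * A\<^sup>2)"
      using m bin_avg_le [OF p g A(2)]
      by (intro order_trans [OF sum_abs] sum_mono) (auto simp: abs_mult less_imp_le intro!: mult_left_mono)
    then have "\<bar>\<Sum>\<mu>=1..p. m \<mu> * bin_avg p g \<mu>\<bar> \<le> m1 * A\<^sup>2"
      by (simp add: m1_def sum_distrib_right)
    moreover have "\<bar>m1 * ?U\<bar> \<le> m1 * A\<^sup>2"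
      unfolding abs_mult using m1 mean_le [OF w g A(2)] by (simp add: mult_left_mono)
    ultimately have "\<bar>?c\<bar> \<le> 2 * m1 * A\<^sup>2" by linarith
    then have c: "\<bar>1 / real n * ?c\<bar> \<le> 2 * m1 * A\<^sup>2 / real n"
      using n by (simp add: abs_mult divide_right_mono)
    have "\<bar>Z g w\<bar> / sqrt (real n) = \<bar>dirichlet_functional p m g n (dirichlet_density p w) - centring p g n X\<bar>"
      using n by (simp add: Z_def abs_mult)
    also have "dirichlet_functional p m g n (dirichlet_density p w) = ?U - 1 / real n * ?c"
      unfolding m1_def by (rule dirichlet_functional_eq) (fact p m n X g A(2))+
    finally have Z_eq: "\<bar>Z g w\<bar> / sqrt (real n) = \<bar>?U - 1 / real n * ?c - centring p g n X\<bar>" .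
    have "\<bar>x - y\<bar> \<le> r + \<bar>x - d - y\<bar>" if "\<bar>d\<bar> \<le> r" for x y d r :: real
      using that by linarith
    from this [OF c] show ?thesis unfolding Z_eq .
  qed
  have avg2: "(\<Sum>\<mu>=1..p. bin_probs p w \<mu> * bin_avg p g2 \<mu>) = (\<Sum>\<mu>=1..p. bin_probs p w \<mu> * (b \<mu>)\<^sup>2)" for w
    unfolding g2_def b_def using squares_of_bin_avg(2) [OF p a(1) A(1)] by (intro sum.cong) auto
  have emp: "centring p a n X = empirical n X (step_fun p b)" "centring p g2 n X = empirical n X g2"
    unfolding g2_def b_def by (simp add: centring_def hist_proj_eq [OF p a(1)], rule squares_of_bin_avg(3) [OF p a(1) A(1)])
  let ?K = "(1 + m1 / real n) * A ^ 4"
  have T_le: "\<bar>T g w\<bar> \<le> ?K" if g: "bounded_on_unit (A\<^sup>2) g" and w: "w \<in> bin_simplex p" for g w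
  proof -
    have "\<bar>bin_var p (bin_avg p g) (bin_probs p w)\<bar> \<le> A ^ 4"
      using var_le [OF w g A(2)] by (simp flip: power_mult)
    then show ?thesis
      unfolding T_def abs_mult using m1 by (intro mult_mono) auto
  qed
  have K: "?K > 0" using m1 a(2) by (intro mult_pos_pos add_pos_nonneg) auto
  have "\<bar>d_BL (distr M borel (Z a)) (gaussian v)\<bar> \<le> 4 / v * expectation (\<lambda>w. \<bar>T a w - v\<bar>)"
    by (rule d_BL_stein_pair [OF SP [OF aA2] v])
  also have "\<dots> \<le> 4 / v * (m1 / real n * A\<^sup>2
        + (1 + 2 * A) * (2 * m1 * A\<^sup>2 / real n + sqrt (?K / real n)) + \<bar>empirical n X g2 - (empirical n X (step_fun p b))\<^sup>2 - v\<bar>)"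
  proof (rule mult_left_mono)
    have b_le: "\<bar>b \<mu>\<bar> \<le> A" if "\<mu> \<in> {1..p}" for \<mu>
      unfolding b_def by (rule bin_avg_le [OF p a(1) A(1) that])
    show "expectation (\<lambda>w. \<bar>T a w - v\<bar>) \<le> m1 / real n * A\<^sup>2
        + (1 + 2 * A) * (2 * m1 * A\<^sup>2 / real n + sqrt (?K / real n)) + \<bar>empirical n X g2 - (empirical n X (step_fun p b))\<^sup>2 - v\<bar>"
    proof (rule stein_pair_variance_bound [OF SP [OF aA2] SP [OF g2] n K])
      show "AE x in M. \<bar>T a x\<bar> \<le> ?K \<and> \<bar>T g2 x\<bar> \<le> ?K"
        using simplex by eventually_elim (intro conjI T_le aA2 g2)
      show "AE x in M. \<bar>\<Sum>\<mu>=1..p. bin_probs p x \<mu> * b \<mu>\<bar> \<le> A"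
        using simplex by eventually_elim (use mean_le [OF _ a(1) A(1)] in \<open>simp only: b_def\<close>)
      show "\<bar>empirical n X (step_fun p b)\<bar> \<le> A"
        by (rule empirical_step_le [OF p n X b_le])
      show "AE x in M. \<bar>T a x - ((\<Sum>\<mu>=1..p. bin_probs p x \<mu> * (b \<mu>)\<^sup>2) - (\<Sum>\<mu>=1..p. bin_probs p x \<mu> * b \<mu>)\<^sup>2)\<bar>
          \<le> m1 / real n * A\<^sup>2"
        using simplex
      proof eventually_elim
        case (elim x)
        have "T a x - bin_var p b (bin_probs p x) = m1 / real n * bin_var p b (bin_probs p x)"
          by (simp add: T_def b_def algebra_simps)
        then have "\<bar>T a x - bin_var p b (bin_probs p x)\<bar> = m1 / real n * \<bar>bin_var p b (bin_probs p x)\<bar>"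
          using m1 by (simp add: abs_mult)
        also have "\<dots> \<le> m1 / real n * A\<^sup>2"
          using var_le [OF elim a(1) A(1)] m1 unfolding b_def by (intro mult_left_mono) auto
        finally show ?case by (simp only: bin_var_def)
      qed
      show "AE x in M. \<bar>(\<Sum>\<mu>=1..p. bin_probs p x \<mu> * b \<mu>) - empirical n X (step_fun p b)\<bar> \<le> 2 * m1 * A\<^sup>2 / real n + \<bar>Z a x\<bar> / sqrt (real n)
          \<and> \<bar>(\<Sum>\<mu>=1..p. bin_probs p x \<mu> * (b \<mu>)\<^sup>2) - empirical n X g2\<bar> \<le> 2 * m1 * A\<^sup>2 / real n + \<bar>Z g2 x\<bar> / sqrt (real n)"
        using simplex
      proof eventually_elim
        case (elim x)
        show ?case
          using shift [OF aA2 elim] shift [OF g2 elim] by (simp only: avg2 emp b_def)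
      qed
    qed
  qed (use v in simp)
  finally show ?thesis
    by (simp only: posterior_law_def M_def Z_def g2_def)
qed

section \<open>Outer probabilities and stochastic rates\<close>

lemma outer_measure_of_Un_le:
  assumes "A \<subseteq> space M" "B \<subseteq> space M"
  shows "outer_measure_of M (A \<union> B) \<le> outer_measure_of M A + outer_measure_of M B"
proof -
  obtain A' B' where A': "A' \<in> sets M" "A \<subseteq> A'" "outer_measure_of M A = emeasure M A'"
    and B': "B' \<in> sets M" "B \<subseteq> B'" "outer_measure_of M B = emeasure M B'"
    using outer_measure_of_attain [OF assms(1)] outer_measure_of_attain [OF assms(2)] by metis
  have "outer_measure_of M (A \<union> B) \<le> outer_measure_of M (A' \<union> B')"
    using A' B' by (intro outer_measure_of_mono) auto
  also have "\<dots> = emeasure M (A' \<union> B')"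
    using A' B' by simp
  also have "\<dots> \<le> emeasure M A' + emeasure M B'"
    using A' B' by (intro emeasure_subadditive)
  finally show ?thesis using A' B' by simp
qed

lemma o_prob_1_if_O_prob:
  assumes Y: "O_prob P Y r" and r: "r \<longlonglongrightarrow> 0"
  shows "o_prob_1 P Y"
  unfolding o_prob_1_def
proof (intro allI impI)
  fix \<delta> :: real assume \<delta>: "\<delta> > 0"
  show "(\<lambda>n. outer_measure_of (P n) {x \<in> space (P n). \<bar>Y n x\<bar> > \<delta>}) \<longlonglongrightarrow> 0"
  proof (rule order_tendstoI)
    fix e :: ennreal assume "0 < e"
    obtain \<epsilon> where "0 < \<epsilon>" and \<epsilon>: "ennreal \<epsilon> < e"
    proof (cases e)
      case (real t)
      with \<open>0 < e\<close> that [of "t / 2"] show ?thesis by (auto simp: ennreal_lessI)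
    next
      case top
      with that [of 1] show ?thesis by simp
    qed
    then obtain C where C: "C > 0" and ev: "\<forall>\<^sub>F n in sequentially. outer_measure_of (P n) {x \<in> space (P n). \<bar>Y n x\<bar> > C * r n} \<le> ennreal \<epsilon>"
      using Y unfolding O_prob_def by blast
    have "\<forall>\<^sub>F n in sequentially. r n < \<delta> / C"
      using order_tendstoD(2) [OF r, of "\<delta> / C"] \<delta> C by simp
    with ev show "\<forall>\<^sub>F n in sequentially. outer_measure_of (P n) {x \<in> space (P n). \<bar>Y n x\<bar> > \<delta>} < e"
    proof eventually_elim
      case (elim n)
      have "C * r n < \<delta>" using elim(2) C by (simp add: field_simps)
      then have "outer_measure_of (P n) {x \<in> space (P n). \<bar>Y n x\<bar> > \<delta>} \<le> outer_measure_of (P n) {x \<in> space (P n). \<bar>Y n x\<bar> > C * r n}"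
        by (intro outer_measure_of_mono) auto
      also have "\<dots> \<le> ennreal \<epsilon>" by (rule elim(1))
      also have "\<dots> < e" by (rule \<epsilon>)
      finally show ?case .
    qed
  qed simp
qed

text \<open>Valid on the whole line because step functions vanish outside the unit interval; the
  deviation inequality asks for such a global bound.\<close>

lemma step_abs_le:
  assumes "q \<ge> 1" "0 \<le> B" "\<And>\<kappa>. \<kappa> \<in> {1..q} \<Longrightarrow> \<bar>c \<kappa>\<bar> \<le> B"
  shows "\<bar>step_fun q c x\<bar> \<le> B"
proof (cases "x \<in> {0..1}")
  case True
  then show ?thesis
    using assms bin_of_range [OF assms(1) True] by (simp add: step_eq)
next
  case False
  then have "step_fun q c x = 0"
    unfolding step_fun_def using bin_subset [OF assms(1)] by (intro sum.neutral) (auto simp: indicator_def subset_iff)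
  then show ?thesis using assms by simp
qed

context
  fixes f0 :: "real \<Rightarrow> real" and c_hi :: real
  assumes f0: "bounded_on_unit c_hi f0" and f0_nonneg: "\<And>x. x \<in> {0..1} \<Longrightarrow> 0 \<le> f0 x"
    and f0_1: "(LINT x:{0..1}|lborel. f0 x) = 1"
begin

text \<open>The budget is \<epsilon>/2 for the bad data and \<epsilon>/4 for each of the two
  empirical deviations; samples that leave the unit interval are null. \<open>K\<close> is fixed
  before \<open>n\<close>, which is possible because the deviation bound is uniform in
  \<open>n\<close>, and the assumption on \<open>r\<close> turns \<open>K / sqrt (real n)\<close>
  into a multiple of the rate.\<close>

lemma O_prob_if_empirical_bound:
  fixes q1 q2 :: "nat \<Rightarrow> real \<Rightarrow> real"
  assumes q: "\<And>n. q1 n \<in> borel_measurable borel" "\<And>n. q2 n \<in> borel_measurable borel"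
      "\<And>n x. \<bar>q1 n x\<bar> \<le> B" "\<And>n x. \<bar>q2 n x\<bar> \<le> B" and B: "B > 0" and C0: "C0 \<ge> 0"
    and bad: "(\<lambda>n. outer_measure_of (sample_law f0 n) {X \<in> space (sample_law f0 n). bad n X}) \<longlonglongrightarrow> 0"
    and rate: "\<forall>\<^sub>F n in sequentially. 1 / sqrt (real n) \<le> r n"
    and bound: "\<forall>\<^sub>F n in sequentially. \<forall>X. (\<forall>i\<in>{1..n}. X i \<in> {0..1}) \<longrightarrow> \<not> bad n X \<longrightarrow>
        \<bar>Y n X\<bar> \<le> C0 * (r n + \<bar>empirical n X (q1 n) - inner2 (q1 n) f0\<bar> + \<bar>empirical n X (q2 n) - inner2 (q2 n) f0\<bar>)"
  shows "O_prob (sample_law f0) Y r"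
  unfolding O_prob_def
proof (intro allI impI)
  fix \<epsilon> :: real assume \<epsilon>: "\<epsilon> > 0"
  have "((\<lambda>K. 2 * exp (- K\<^sup>2 / (2 * B\<^sup>2))) \<longlongrightarrow> 0) at_top"
    using B by real_asymp
  then have "\<forall>\<^sub>F K in at_top. 2 * exp (- K\<^sup>2 / (2 * B\<^sup>2)) < \<epsilon> / 4"
    using \<epsilon> by (intro order_tendstoD(2)) auto
  then have "\<forall>\<^sub>F K in at_top. 2 * exp (- K\<^sup>2 / (2 * B\<^sup>2)) < \<epsilon> / 4 \<and> 0 \<le> K"
    using eventually_ge_at_top [of 0] by eventually_elim auto
  then obtain K where K: "2 * exp (- K\<^sup>2 / (2 * B\<^sup>2)) < \<epsilon> / 4" "0 \<le> K"
    unfolding eventually_at_top_linorder by blast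
  \<comment> \<open>The added 1 keeps the constant positive when \<open>C0 = 0\<close>.\<close>
  let ?C = "C0 * (1 + 2 * K) + 1"
  have "\<forall>\<^sub>F n in sequentially. outer_measure_of (sample_law f0 n) {X \<in> space (sample_law f0 n). bad n X} < ennreal (\<epsilon> / 2)"
    using bad \<epsilon> by (intro order_tendstoD(2)) auto
  then have "\<forall>\<^sub>F n in sequentially. outer_measure_of (sample_law f0 n) {X \<in> space (sample_law f0 n). \<bar>Y n X\<bar> > ?C * r n} \<le> ennreal \<epsilon>"
    using rate bound eventually_ge_at_top [of 1]
  proof eventually_elim
    case (elim n)
    let ?M = "sample_law f0 n"
    define E where "E = (\<lambda>g. {X \<in> space ?M. \<bar>empirical n X g - inner2 g f0\<bar> \<ge> K / sqrt (real n)})"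
    define Bad where "Bad = {X \<in> space ?M. bad n X}"
    define Out where "Out = {X \<in> space ?M. \<not> (\<forall>i\<in>{1..n}. X i \<in> {0..1})}"
    have sub: "{X \<in> space ?M. \<bar>Y n X\<bar> > ?C * r n} \<subseteq> Bad \<union> (Out \<union> (E (q1 n) \<union> E (q2 n)))"
    proof (rule subsetI, rule ccontr)
      fix X assume X: "X \<in> {X \<in> space ?M. \<bar>Y n X\<bar> > ?C * r n}" and nX: "X \<notin> Bad \<union> (Out \<union> (E (q1 n) \<union> E (q2 n)))"
      then have "\<not> bad n X" "\<forall>i\<in>{1..n}. X i \<in> {0..1}"
        by (auto simp: Bad_def Out_def)
      then have "\<bar>Y n X\<bar> \<le> C0 * (r n + \<bar>empirical n X (q1 n) - inner2 (q1 n) f0\<bar> + \<bar>empirical n X (q2 n) - inner2 (q2 n) f0\<bar>)"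
        using elim(3) by blast
      also have "\<dots> \<le> C0 * (r n + K / sqrt (real n) + K / sqrt (real n))"
        using X nX C0 by (intro mult_left_mono add_mono) (auto simp: E_def)
      also have "\<dots> \<le> C0 * (r n + K * r n + K * r n)"
        using mult_left_mono [OF elim(2) K(2)] C0 by (intro mult_left_mono add_mono) auto
      also have "\<dots> = C0 * (1 + 2 * K) * r n" by (simp add: algebra_simps)
      also have "\<dots> \<le> ?C * r n"
      proof -
        have "0 \<le> 1 / sqrt (real n)" by simp
        with elim(2) have "0 \<le> r n" by linarith
        then show ?thesis by (simp add: distrib_right)
      qed
      finally show False using X by simp
    qed
    have dev: "E g \<in> sets ?M \<and> emeasure ?M (E g) \<le> ennreal (\<epsilon> / 4)"
      if "g \<in> borel_measurable borel" "\<And>x. \<bar>g x\<bar> \<le> B" for g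
      using empirical_deviation [OF f0 f0_nonneg f0_1 that B elim(4) K(2)] K(1) unfolding E_def
      by (auto intro: order_trans [OF _ ennreal_leI])
    have out: "outer_measure_of ?M Out = 0"
    proof -
      obtain N where "N \<in> null_sets ?M" "Out \<subseteq> N"
        using AE_sample_unit [OF f0 f0_nonneg f0_1, of n] unfolding Out_def
        by (auto elim!: AE_E simp: null_sets_def)
      then have "outer_measure_of ?M Out \<le> 0"
        using outer_measure_of_mono [of Out N ?M] by (auto simp: null_sets_def)
      then show ?thesis by simp
    qed
    have sp: "Bad \<subseteq> space ?M" "Out \<subseteq> space ?M" "E g \<subseteq> space ?M" for g
      by (auto simp: Bad_def Out_def E_def)
    have "outer_measure_of ?M {X \<in> space ?M. \<bar>Y n X\<bar> > ?C * r n} \<le> outer_measure_of ?M (Bad \<union> (Out \<union> (E (q1 n) \<union> E (q2 n))))"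
      by (rule outer_measure_of_mono [OF sub])
    also have "\<dots> \<le> outer_measure_of ?M Bad + (outer_measure_of ?M Out + (outer_measure_of ?M (E (q1 n)) + outer_measure_of ?M (E (q2 n))))"
      using sp by (intro order_trans [OF outer_measure_of_Un_le] add_left_mono) auto
    also have "\<dots> \<le> ennreal (\<epsilon> / 2) + (0 + (ennreal (\<epsilon> / 4) + ennreal (\<epsilon> / 4)))"
    proof -
      have "outer_measure_of ?M Bad \<le> ennreal (\<epsilon> / 2)"
        using elim(1) by (simp add: Bad_def less_imp_le)
      then show ?thesis
        unfolding out using dev [OF q(1,3)] dev [OF q(2,4)] by (intro add_mono) auto
    qed
    also have "\<dots> = ennreal \<epsilon>"
      using \<epsilon> by (simp flip: ennreal_plus)
    finally show ?case .
  qed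
  moreover have "?C > 0" using C0 K(2) by (simp add: add_nonneg_pos)
  ultimately show "\<exists>C>0. \<forall>\<^sub>F n in sequentially. outer_measure_of (sample_law f0 n) {X \<in> space (sample_law f0 n). \<bar>Y n X\<bar> > C * r n} \<le> ennreal \<epsilon>"
    by blast
qed

text \<open>The constant is 2 + 2: the second moment and the squared mean each change by at most
  \<open>2 * A * \<epsilon>\<close>, by factoring a difference of squares.\<close>

lemma binned_variance_close:
  assumes q: "q \<ge> 1" and a: "bounded_on_unit A a" "0 \<le> A"
    and b: "\<And>\<mu>. \<mu> \<in> {1..q} \<Longrightarrow> \<bar>b \<mu>\<bar> \<le> A"
    and close: "\<And>x. x \<in> {0..1} \<Longrightarrow> \<bar>b (bin_of q x) - a x\<bar> \<le> \<epsilon>"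
  shows "\<bar>inner2 (step_fun q (\<lambda>\<mu>. (b \<mu>)\<^sup>2)) f0 - (inner2 (step_fun q b) f0)\<^sup>2 - asymp_var f0 a\<bar> \<le> 4 * A * \<epsilon>"
proof -
  have bb: "bounded_on_unit A (step_fun q b)" by (rule bounded_on_unit_step [OF q b])
  have b2: "bounded_on_unit (A\<^sup>2) (step_fun q (\<lambda>\<mu>. (b \<mu>)\<^sup>2))"
    using b by (intro bounded_on_unit_step [OF q]) (metis abs_ge_zero abs_power2 power2_abs power_mono)
  have a2: "bounded_on_unit (A\<^sup>2) (\<lambda>x. (a x)\<^sup>2)"
    using bounded_on_unit_mult [OF a(1) a(1)] by (simp add: power2_eq_square)
  have a_le: "\<bar>a x\<bar> \<le> A" if "x \<in> {0..1}" for x using a(1) that by (simp add: bounded_on_unit_def)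
  have "\<bar>inner2 (step_fun q (\<lambda>\<mu>. (b \<mu>)\<^sup>2)) f0 - inner2 (\<lambda>x. (a x)\<^sup>2) f0\<bar> \<le> 2 * A * \<epsilon>"
  proof (rule inner2_f0_close [OF f0 f0_nonneg f0_1 b2 a2])
    fix x :: real assume x: "x \<in> {0..1}"
    have "(b (bin_of q x))\<^sup>2 - (a x)\<^sup>2 = (b (bin_of q x) + a x) * (b (bin_of q x) - a x)"
      by (simp add: power2_eq_square algebra_simps)
    then have "\<bar>(b (bin_of q x))\<^sup>2 - (a x)\<^sup>2\<bar> = \<bar>b (bin_of q x) + a x\<bar> * \<bar>b (bin_of q x) - a x\<bar>"
      by (simp add: abs_mult)
    also have "\<dots> \<le> (2 * A) * \<epsilon>"
      using b [OF bin_of_range [OF q x]] a_le [OF x] close [OF x] a(2) by (intro mult_mono) auto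
    finally show "\<bar>step_fun q (\<lambda>\<mu>. (b \<mu>)\<^sup>2) x - (a x)\<^sup>2\<bar> \<le> 2 * A * \<epsilon>"
      by (simp add: step_eq [OF q x])
  qed
  moreover have "\<bar>(inner2 (step_fun q b) f0)\<^sup>2 - (inner2 a f0)\<^sup>2\<bar> \<le> 2 * A * \<epsilon>"
  proof -
    have le_A: "\<bar>inner2 g f0\<bar> \<le> A" if "bounded_on_unit A g" for g
    proof -
      have zero: "bounded_on_unit 0 (\<lambda>_. 0)" by (rule bounded_on_unit_borel) auto
      have "\<bar>inner2 g f0 - inner2 (\<lambda>_. 0) f0\<bar> \<le> A"
        by (rule inner2_f0_close [OF f0 f0_nonneg f0_1 that zero]) (use that in \<open>auto simp: bounded_on_unit_def\<close>)
      then show ?thesis by (simp add: inner2_def)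
    qed
    have diff: "\<bar>inner2 (step_fun q b) f0 - inner2 a f0\<bar> \<le> \<epsilon>"
    proof (rule inner2_f0_close [OF f0 f0_nonneg f0_1 bb a(1)])
      show "\<bar>step_fun q b x - a x\<bar> \<le> \<epsilon>" if x: "x \<in> {0..1}" for x
        unfolding step_eq [OF q x] by (rule close [OF x])
    qed
    have "(inner2 (step_fun q b) f0)\<^sup>2 - (inner2 a f0)\<^sup>2 = (inner2 (step_fun q b) f0 + inner2 a f0) * (inner2 (step_fun q b) f0 - inner2 a f0)"
      by (simp add: power2_eq_square algebra_simps)
    then have "\<bar>(inner2 (step_fun q b) f0)\<^sup>2 - (inner2 a f0)\<^sup>2\<bar> = \<bar>inner2 (step_fun q b) f0 + inner2 a f0\<bar> * \<bar>inner2 (step_fun q b) f0 - inner2 a f0\<bar>"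
      by (simp add: abs_mult)
    also have "\<dots> \<le> (2 * A) * \<epsilon>"
      using le_A [OF bb] le_A [OF a(1)] diff a(2) by (intro mult_mono) auto
    finally show ?thesis .
  qed
  moreover have "asymp_var f0 a = inner2 (\<lambda>x. (a x)\<^sup>2) f0 - (inner2 a f0)\<^sup>2"
    by (rule asymp_var_eq [OF f0 f0_nonneg f0_1 a(1)])
  ultimately show ?thesis
    by linarith
qed

text \<open>\<open>L\<close> collects what the prior contributes, \<open>G\<close> is the part of it
  that stays visible in the rate, and \<open>bad\<close> marks the data to be excluded. The power of
  \<open>p\<close> comes from the approximation of \<open>a\<close> by its bin averages in the
  variance under \<open>f0\<close>.\<close>

lemma BvM_rate:
  fixes a :: "real \<Rightarrow> real" and p :: "nat \<Rightarrow> nat" and A C \<beta> c1 c2 :: real and L G :: "nat \<Rightarrow> real"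
  assumes a: "bounded_on_unit A a" "1 \<le> A" and v: "asymp_var f0 a > 0"
    and osc: "C \<ge> 0" "\<beta> > 0" "\<And>x y. x \<in> {0..1} \<Longrightarrow> y \<in> {0..1} \<Longrightarrow> \<bar>a x - a y\<bar> \<le> C * \<bar>x - y\<bar> powr \<beta>"
    and p: "\<And>n. p n \<ge> 1" and G: "\<And>n. 0 \<le> G n" and c: "0 \<le> c1" "0 \<le> c2"
    and bad: "(\<lambda>n. outer_measure_of (sample_law f0 n) {X \<in> space (sample_law f0 n). bad n X}) \<longlonglongrightarrow> 0"
    and L: "\<forall>\<^sub>F n in sequentially. L n \<le> c1 * sqrt (real (p n) * ln (real n) / real n) + c2 * G n"
    and bound: "\<And>n X. n \<ge> 1 \<Longrightarrow> (\<And>i. i \<in> {1..n} \<Longrightarrow> X i \<in> {0..1}) \<Longrightarrow> \<not> bad n X \<Longrightarrow>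
        \<bar>Y n X\<bar> \<le> 4 / asymp_var f0 a * (L n + \<bar>empirical n X (step_fun (p n) (\<lambda>\<mu>. (bin_avg (p n) a \<mu>)\<^sup>2))
            - (empirical n X (step_fun (p n) (bin_avg (p n) a)))\<^sup>2 - asymp_var f0 a\<bar>)"
  shows "O_prob (sample_law f0) Y (\<lambda>n. real (p n) powr - \<beta> + sqrt (real (p n) * ln (real n) / real n) + G n)"
proof -
  define b where "b = (\<lambda>n. bin_avg (p n) a)"
  have A: "0 \<le> A" "A \<le> A\<^sup>2" "0 < A\<^sup>2"
    using a(2) square_le_fourth_power(1) [OF a(2)] by auto
  have b_le: "\<bar>b n \<mu>\<bar> \<le> A" if "\<mu> \<in> {1..p n}" for n \<mu>
    unfolding b_def by (rule bin_avg_le [OF p a(1) A(1) that])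
  have b2_le: "\<bar>(b n \<mu>)\<^sup>2\<bar> \<le> A\<^sup>2" if "\<mu> \<in> {1..p n}" for n \<mu>
    using b_le [OF that] by (metis abs_ge_zero abs_power2 power2_abs power_mono)
  have approx: "\<bar>b n (bin_of (p n) x) - a x\<bar> \<le> C * real (p n) powr - \<beta>" if x: "x \<in> {0..1}" for n x
    unfolding b_def
  proof (rule bin_avg_approx [OF p a(1) x])
    fix y :: real assume y: "y \<in> {0..1}" "\<bar>x - y\<bar> \<le> 1 / real (p n)"
    have "\<bar>a y - a x\<bar> \<le> C * \<bar>x - y\<bar> powr \<beta>"
      using osc(3) [OF y(1) x] by (simp add: abs_minus_commute)
    also have "\<dots> \<le> C * (1 / real (p n)) powr \<beta>"
      using y(2) osc by (intro mult_left_mono powr_mono2) auto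
    also have "(1 / real (p n)) powr \<beta> = real (p n) powr - \<beta>"
      by (simp add: powr_divide powr_minus_divide)
    finally show "\<bar>a y - a x\<bar> \<le> C * real (p n) powr - \<beta>" .
  qed
  let ?v = "asymp_var f0 a"
  let ?r = "\<lambda>n. real (p n) powr - \<beta> + sqrt (real (p n) * ln (real n) / real n) + G n"
  \<comment> \<open>A sum that dominates each coefficient separately: \<open>c1\<close> and
    \<open>c2\<close> for the prior terms, \<open>4 * A * C\<close> for the binning error,
    \<open>1 + 2 * A\<close> for the empirical deviations of the second moment and the mean.\<close>
  let ?C = "4 / ?v * (c1 + c2 + 4 * A * C + (1 + 2 * A))"
  show ?thesis
  proof (rule O_prob_if_empirical_bound [where ?q1.0 = "\<lambda>n. step_fun (p n) (b n)" and ?q2.0 = "\<lambda>n. step_fun (p n) (\<lambda>\<mu>. (b n \<mu>)\<^sup>2)"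
        and B = "A\<^sup>2" and ?C0.0 = ?C and bad = bad])
    show "\<bar>step_fun (p n) (b n) x\<bar> \<le> A\<^sup>2" for n x
      by (rule order_trans [OF step_abs_le [OF p A(1) b_le] A(2)])
    show "\<bar>step_fun (p n) (\<lambda>\<mu>. (b n \<mu>)\<^sup>2) x\<bar> \<le> A\<^sup>2" for n x
      by (rule step_abs_le [OF p _ b2_le]) simp
    show "0 \<le> ?C"
      using v c A osc by (intro mult_nonneg_nonneg add_nonneg_nonneg) auto
    \<comment> \<open>Eventually \<open>real (p n) * ln (real n)\<close> is at least 1, so the
      square root term alone dominates the parametric rate.\<close>
    show "\<forall>\<^sub>F n in sequentially. 1 / sqrt (real n) \<le> ?r n"
    proof -
      have "\<forall>\<^sub>F n in sequentially. 1 \<le> ln (real n)"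
        by real_asymp
      then show ?thesis
        using eventually_ge_at_top [of 1]
      proof eventually_elim
        case (elim n)
        have "1 * 1 \<le> real (p n) * ln (real n)"
          using p [of n] elim(1) by (intro mult_mono) auto
        then have "sqrt (1 / real n) \<le> sqrt (real (p n) * ln (real n) / real n)"
          by (intro real_sqrt_le_mono divide_right_mono) auto
        then show ?case
          using G [of n] by (simp add: real_sqrt_divide add_increasing add_increasing2)
      qed
    qed
    show "\<forall>\<^sub>F n in sequentially. \<forall>X. (\<forall>i\<in>{1..n}. X i \<in> {0..1}) \<longrightarrow> \<not> bad n X \<longrightarrow>
        \<bar>Y n X\<bar> \<le> ?C * (?r n + \<bar>empirical n X (step_fun (p n) (b n)) - inner2 (step_fun (p n) (b n)) f0\<bar>
          + \<bar>empirical n X (step_fun (p n) (\<lambda>\<mu>. (b n \<mu>)\<^sup>2)) - inner2 (step_fun (p n) (\<lambda>\<mu>. (b n \<mu>)\<^sup>2)) f0\<bar>)"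
      using L eventually_ge_at_top [of 1]
    proof eventually_elim
      case (elim n)
      show ?case
      proof (intro allI impI)
        fix X assume X: "\<forall>i\<in>{1..n}. X i \<in> {0..1}" "\<not> bad n X"
        let ?u = "empirical n X (step_fun (p n) (b n))" and ?w = "empirical n X (step_fun (p n) (\<lambda>\<mu>. (b n \<mu>)\<^sup>2))"
        let ?U = "inner2 (step_fun (p n) (b n)) f0" and ?W = "inner2 (step_fun (p n) (\<lambda>\<mu>. (b n \<mu>)\<^sup>2)) f0"
        let ?s = "sqrt (real (p n) * ln (real n) / real n)" and ?t = "real (p n) powr - \<beta>"
        have st: "0 \<le> ?s" "0 \<le> ?t"
          using elim(2) by auto
        have u_le: "\<bar>?u\<bar> \<le> A"
          using X(1) by (intro empirical_step_le [OF p elim(2) _ b_le]) auto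
        have U_le: "\<bar>?U\<bar> \<le> A"
        proof -
          have bb: "bounded_on_unit A (step_fun (p n) (b n))"
            by (rule bounded_on_unit_step [OF p b_le])
          have zero: "bounded_on_unit 0 (\<lambda>_. 0)" by (rule bounded_on_unit_borel) auto
          have "\<bar>?U - inner2 (\<lambda>_. 0) f0\<bar> \<le> A"
            by (rule inner2_f0_close [OF f0 f0_nonneg f0_1 bb zero]) (use bb in \<open>auto simp: bounded_on_unit_def\<close>)
          then show ?thesis by (simp add: inner2_def)
        qed
        have "?u\<^sup>2 - ?U\<^sup>2 = (?u + ?U) * (?u - ?U)"
          by (simp add: power2_eq_square algebra_simps)
        then have "\<bar>?u\<^sup>2 - ?U\<^sup>2\<bar> = \<bar>?u + ?U\<bar> * \<bar>?u - ?U\<bar>"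
          by (simp add: abs_mult)
        also have "\<dots> \<le> (2 * A) * \<bar>?u - ?U\<bar>"
          using u_le U_le by (intro mult_right_mono) auto
        finally have sq: "\<bar>?u\<^sup>2 - ?U\<^sup>2\<bar> \<le> 2 * A * \<bar>?u - ?U\<bar>" .
        have "\<bar>?W - ?U\<^sup>2 - ?v\<bar> \<le> 4 * A * (C * ?t)"
          by (rule binned_variance_close [OF p a(1) A(1) b_le approx])
        with sq have var: "\<bar>?w - ?u\<^sup>2 - ?v\<bar> \<le> \<bar>?w - ?W\<bar> + 2 * A * \<bar>?u - ?U\<bar> + 4 * A * C * ?t"
          unfolding mult.assoc by linarith
        define K where "K = c1 + c2 + 4 * A * C + (1 + 2 * A)"
        have AC: "0 \<le> 4 * A * C" using A osc by simp
        have K: "c1 \<le> K" "c2 \<le> K" "4 * A * C \<le> K" "2 * A \<le> K" "1 \<le> K"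
          using c A(1) AC unfolding K_def by auto
        have "\<bar>Y n X\<bar> \<le> 4 / ?v * (L n + \<bar>?w - ?u\<^sup>2 - ?v\<bar>)"
          using bound [OF elim(2) _ X(2)] X(1) by (simp only: b_def)
        also have "\<dots> \<le> 4 / ?v * (K * (?r n + \<bar>?u - ?U\<bar> + \<bar>?w - ?W\<bar>))"
        proof (rule mult_left_mono)
          have "c1 * ?s \<le> K * ?s" "c2 * G n \<le> K * G n" "4 * A * C * ?t \<le> K * ?t" "2 * A * \<bar>?u - ?U\<bar> \<le> K * \<bar>?u - ?U\<bar>"
            "1 * \<bar>?w - ?W\<bar> \<le> K * \<bar>?w - ?W\<bar>"
            by (rule mult_right_mono, rule K, rule st G abs_ge_zero)+
          then show "L n + \<bar>?w - ?u\<^sup>2 - ?v\<bar> \<le> K * (?r n + \<bar>?u - ?U\<bar> + \<bar>?w - ?W\<bar>)"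
            using elim(1) var unfolding distrib_left by linarith
        qed (use v in simp)
        finally show "\<bar>Y n X\<bar> \<le> ?C * (?r n + \<bar>?u - ?U\<bar> + \<bar>?w - ?W\<bar>)"
          by (simp only: K_def mult.assoc)
      qed
    qed
  qed (use A bad in auto)
qed

end

section \<open>Translation of the prior terms into rates\<close>

lemma ln_rate_bounds:
  fixes p n :: real
  assumes n: "n > 0" and p: "p \<ge> 1" and ln: "ln n \<ge> 1"
  shows "1 / n \<le> (sqrt (p * ln n / n))\<^sup>2" "p / n \<le> (sqrt (p * ln n / n))\<^sup>2" "1 \<le> p * ln n"
proof -
  show y: "1 \<le> p * ln n"
    using mult_mono [of 1 p 1 "ln n"] p ln by simp
  have sq: "(sqrt (p * ln n / n))\<^sup>2 = p * ln n / n"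
    using n y by (intro real_sqrt_pow2) auto
  show "1 / n \<le> (sqrt (p * ln n / n))\<^sup>2"
    unfolding sq using n y by (intro divide_right_mono) auto
  have "p * 1 \<le> p * ln n" using p ln by (intro mult_left_mono) auto
  then show "p / n \<le> (sqrt (p * ln n / n))\<^sup>2"
    unfolding sq using n by (intro divide_right_mono) auto
qed

text \<open>The hypothesis on \<open>S\<close> acts twice: it makes the shift \<open>S / n\<close>
  at most \<open>c\<close> times the rate, and it makes \<open>S\<^sup>2 / n\<close> at most c^2 p
  ln n, which after division by \<open>n\<close> under the root gives the same rate again.\<close>

lemma haar_rate_bound:
  fixes n p S c h1 h2 A E :: real
  assumes n: "n > 0" and p: "p \<ge> 1" and ln: "ln n \<ge> 1" and A: "A \<ge> 1" and h: "0 \<le> h1" "0 \<le> h2" and c: "0 \<le> c"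
    and S: "0 \<le> S" "S \<le> c * sqrt (n * p * ln n)"
  shows "h2 / n * E + (1 + 2 * A) * (h1 * A\<^sup>2 * S / n + sqrt ((A ^ 4 + h2 * A ^ 4 * S\<^sup>2 / n) / n))
    \<le> (1 + 2 * A) * (h1 * A\<^sup>2 * c + A\<^sup>2 * sqrt (1 + h2 * c\<^sup>2)) * sqrt (p * ln n / n) + h2 * (1 / n * E)"
proof -
  let ?y = "p * ln n" and ?t = "sqrt (p * ln n / n)"
  have y: "1 \<le> ?y" by (rule ln_rate_bounds(3) [OF n p ln])
  have t: "sqrt (n * p * ln n) / n = ?t"
    using n by (simp add: real_sqrt_mult real_sqrt_divide mult.assoc field_simps)
  have "S / n \<le> c * ?t"
    using divide_right_mono [OF S(2), of n] n by (simp add: t [symmetric])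
  then have 1: "h1 * A\<^sup>2 * S / n \<le> h1 * A\<^sup>2 * c * ?t"
    using mult_left_mono [of "S / n" "c * ?t" "h1 * A\<^sup>2"] h by (simp add: mult.assoc)
  have "S\<^sup>2 \<le> (c * sqrt (n * p * ln n))\<^sup>2"
    using S by (intro power_mono)
  also have "\<dots> = c\<^sup>2 * (n * ?y)"
    using n y by (simp add: power_mult_distrib mult.assoc)
  finally have "S\<^sup>2 / n \<le> c\<^sup>2 * ?y"
    using n by (simp add: field_simps)
  then have "h2 * A ^ 4 * S\<^sup>2 / n \<le> h2 * A ^ 4 * (c\<^sup>2 * ?y)"
    using mult_left_mono [of "S\<^sup>2 / n" "c\<^sup>2 * ?y" "h2 * A ^ 4"] h by simp
  moreover have "A ^ 4 * 1 \<le> A ^ 4 * ?y"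
    using y by (intro mult_left_mono) auto
  ultimately have "A ^ 4 + h2 * A ^ 4 * S\<^sup>2 / n \<le> A ^ 4 * (1 + h2 * c\<^sup>2) * ?y"
    by (simp add: algebra_simps)
  then have "sqrt ((A ^ 4 + h2 * A ^ 4 * S\<^sup>2 / n) / n) \<le> sqrt (A ^ 4 * (1 + h2 * c\<^sup>2) * ?y / n)"
    using n by (intro real_sqrt_le_mono divide_right_mono) auto
  also have "\<dots> = A\<^sup>2 * sqrt (1 + h2 * c\<^sup>2) * ?t"
  proof -
    have "sqrt (A ^ 4) = A\<^sup>2"
      using A by (intro real_sqrt_unique) (auto simp flip: power_mult)
    then show ?thesis
      by (simp only: times_divide_eq_right [symmetric] real_sqrt_mult)
  qed
  finally have "h1 * A\<^sup>2 * S / n + sqrt ((A ^ 4 + h2 * A ^ 4 * S\<^sup>2 / n) / n) \<le> (h1 * A\<^sup>2 * c + A\<^sup>2 * sqrt (1 + h2 * c\<^sup>2)) * ?t"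
    using 1 by (simp add: distrib_right)
  then have "(1 + 2 * A) * (h1 * A\<^sup>2 * S / n + sqrt ((A ^ 4 + h2 * A ^ 4 * S\<^sup>2 / n) / n))
      \<le> (1 + 2 * A) * ((h1 * A\<^sup>2 * c + A\<^sup>2 * sqrt (1 + h2 * c\<^sup>2)) * ?t)"
    using A by (intro mult_left_mono) auto
  then show ?thesis by (simp add: mult.assoc)
qed

text \<open>With t = sqrt(p ln n / n), the ratio m1/n is at most M p/n \<le> M t^2, and t \<le> 1
  lowers this to M t.\<close>

lemma dirichlet_rate_bound:
  fixes n p m1 M A :: real
  assumes n: "n > 0" and p: "p \<ge> 1" and ln: "ln n \<ge> 1" and A: "A \<ge> 1" and M: "0 \<le> M"
    and m1: "0 \<le> m1" "m1 \<le> M * p" and t: "sqrt (p * ln n / n) \<le> 1"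
  shows "m1 / n * A\<^sup>2 + (1 + 2 * A) * (2 * m1 * A\<^sup>2 / n + sqrt ((1 + m1 / n) * A ^ 4 / n))
    \<le> (M * A\<^sup>2 + (1 + 2 * A) * (2 * M * A\<^sup>2 + A\<^sup>2 * sqrt (1 + M))) * sqrt (p * ln n / n)"
proof -
  let ?t = "sqrt (p * ln n / n)"
  have "0 \<le> p * ln n / n"
    using n ln_rate_bounds(3) [OF n p ln] by (intro divide_nonneg_pos) auto
  then have t0: "0 \<le> ?t" by simp
  have t2: "?t\<^sup>2 \<le> ?t"
    using mult_left_le [OF t t0] by (simp only: power2_eq_square)
  have "m1 / n \<le> M * (p / n)"
    using divide_right_mono [OF m1(2), of n] n by simp
  also have "\<dots> \<le> M * ?t"
    using ln_rate_bounds(2) [OF n p ln] t2 M by (intro mult_left_mono) auto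
  finally have mt: "m1 / n \<le> M * ?t" .
  also have "\<dots> \<le> M" using t M by (simp add: mult_left_le)
  finally have mM: "m1 / n \<le> M" .
  have "(1 + m1 / n) * A ^ 4 / n = A ^ 4 * ((1 + m1 / n) * (1 / n))" by simp
  also have "\<dots> \<le> A ^ 4 * ((1 + M) * ?t\<^sup>2)"
    using ln_rate_bounds(1) [OF n p ln] mM m1(1) n M by (intro mult_left_mono mult_mono) auto
  finally have "sqrt ((1 + m1 / n) * A ^ 4 / n) \<le> sqrt (A ^ 4 * ((1 + M) * ?t\<^sup>2))"
    by (rule real_sqrt_le_mono)
  also have "\<dots> = A\<^sup>2 * (sqrt (1 + M) * ?t)"
  proof -
    have "sqrt (A ^ 4) = A\<^sup>2"
      using A by (intro real_sqrt_unique) (auto simp flip: power_mult)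
    moreover have "sqrt (?t\<^sup>2) = ?t" using t0 by (rule real_sqrt_unique [OF refl])
    ultimately show ?thesis by (simp only: real_sqrt_mult)
  qed
  finally have 1: "sqrt ((1 + m1 / n) * A ^ 4 / n) \<le> A\<^sup>2 * (sqrt (1 + M) * ?t)" .
  have 2: "m1 / n * A\<^sup>2 \<le> M * ?t * A\<^sup>2" using mt by (intro mult_right_mono) auto
  have "2 * m1 * A\<^sup>2 / n = 2 * (m1 / n * A\<^sup>2)" by simp
  also have "\<dots> \<le> 2 * (M * ?t * A\<^sup>2)" using 2 by simp
  finally have 3: "2 * m1 * A\<^sup>2 / n \<le> 2 * M * A\<^sup>2 * ?t" by (simp only: mult_ac)
  have "(1 + 2 * A) * (2 * m1 * A\<^sup>2 / n + sqrt ((1 + m1 / n) * A ^ 4 / n))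
      \<le> (1 + 2 * A) * (2 * M * A\<^sup>2 * ?t + A\<^sup>2 * (sqrt (1 + M) * ?t))"
    using 1 3 A by (intro mult_left_mono add_mono) auto
  with 2 show ?thesis by (simp add: algebra_simps)
qed

theorem corollary3:
  fixes f0 a H H' H'' :: "real \<Rightarrow> real"
    and s \<gamma> c c_lo c_hi :: real
    and J p :: "nat \<Rightarrow> nat"
    and \<sigma> m :: "nat \<Rightarrow> nat \<Rightarrow> real"
  assumes s: "0 < s" "s \<le> 1"
    and f0_holder: "f0 \<in> holder_space s"
    and f0_density: "(LINT x:{0..1}|lborel. f0 x) = 1"
    and f0_bounds: "0 < c_lo" "0 < c_hi" "\<forall>x\<in>{0..1}. c_lo \<le> f0 x \<and> f0 x \<le> c_hi"
    and a_holder: "0 < \<gamma>" "a \<in> holder_space \<gamma>"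
    and var_pos: "asymp_var f0 a > 0"
    and p_def: "\<forall>n. p n = 2 ^ (J n + 1)"
    and p_lower: "(\<lambda>n. real n powr (1 / (2 * (\<gamma> + s)))) \<in> o(\<lambda>n. real (p n))"
  shows
    "((\<forall>n. \<forall>j\<le>J n. 0 < \<sigma> n j)
      \<and> (\<lambda>n. real (p n)) \<in> o(\<lambda>n. real n / ln (real n))
      \<and> (\<forall>x. (H has_real_derivative H' x) (at x))
      \<and> (\<forall>x. (H' has_real_derivative H'' x) (at x))
      \<and> bounded (range H') \<and> bounded (range H'')
      \<and> (\<lambda>n. haar_energy (J n) (\<sigma> n) a) \<in> o(\<lambda>n. real n)
      \<and> 0 < c
      \<and> (\<forall>\<^sub>F n in sequentially.
           (\<Sum>j=0..J n. 1 / \<sigma> n j * 2 powr (real j / 2))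
             \<le> c * sqrt (real n * real (p n) * ln (real n)))
      \<and> posterior_wd (sample_law f0) (\<lambda>n. haar_prior (J n) (\<sigma> n) H) (\<lambda>n. haar_density (J n))
      \<longrightarrow>
        O_prob (sample_law f0)
          (BvM_dist (\<lambda>n. haar_prior (J n) (\<sigma> n) H) (\<lambda>n. haar_density (J n))
             (\<lambda>n. haar_functional (J n) (\<sigma> n) H' a n) (\<lambda>n. centring (p n) a n) (asymp_var f0 a))
          (\<lambda>n. real (p n) powr (- min \<gamma> s) + sqrt (real (p n) * ln (real n) / real n)
               + 1 / real n * haar_energy (J n) (\<sigma> n) a)
      \<and> o_prob_1 (sample_law f0)
          (BvM_dist (\<lambda>n. haar_prior (J n) (\<sigma> n) H) (\<lambda>n. haar_density (J n))
             (\<lambda>n. haar_functional (J n) (\<sigma> n) H' a n) (\<lambda>n. centring (p n) a n) (asymp_var f0 a))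
      \<and> (\<gamma> + s > 1 / 2 \<longrightarrow>
          BvM (sample_law f0) (\<lambda>n. haar_prior (J n) (\<sigma> n) H) (\<lambda>n. haar_density (J n))
            (\<lambda>n. haar_functional (J n) (\<sigma> n) H' a n) (\<lambda>n. centring (p n) a n) (asymp_var f0 a)))
    \<and>
     ((\<forall>n. \<forall>\<mu>\<in>{1..p n}. 0 < m n \<mu>)
      \<and> (\<lambda>n. real (p n)) \<in> o(\<lambda>n. real n / ln (real n))
      \<and> (\<lambda>n. MAX \<mu>\<in>{1..p n}. \<bar>m n \<mu>\<bar>) \<in> O(\<lambda>_. 1)
      \<longrightarrow>
        O_prob (sample_law f0)
          (BvM_dist (\<lambda>n. dirichlet_prior (p n) (m n)) (\<lambda>n. dirichlet_density (p n))
             (\<lambda>n. dirichlet_functional (p n) (m n) a n) (\<lambda>n. centring (p n) a n) (asymp_var f0 a))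
          (\<lambda>n. real (p n) powr (- min \<gamma> s) + sqrt (real (p n) * ln (real n) / real n))
      \<and> o_prob_1 (sample_law f0)
          (BvM_dist (\<lambda>n. dirichlet_prior (p n) (m n)) (\<lambda>n. dirichlet_density (p n))
             (\<lambda>n. dirichlet_functional (p n) (m n) a n) (\<lambda>n. centring (p n) a n) (asymp_var f0 a))
      \<and> (\<gamma> + s > 1 / 2 \<longrightarrow>
          BvM (sample_law f0) (\<lambda>n. dirichlet_prior (p n) (m n)) (\<lambda>n. dirichlet_density (p n))
            (\<lambda>n. dirichlet_functional (p n) (m n) a n) (\<lambda>n. centring (p n) a n) (asymp_var f0 a)))"
proof -
  define \<beta> where "\<beta> = min \<gamma> s"
  define t where "t = (\<lambda>n. sqrt (real (p n) * ln (real n) / real n))"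
  have \<beta>: "\<beta> > 0" using a_holder(1) s(1) by (simp add: \<beta>_def)
  obtain C where C: "C \<ge> 0" "\<And>x y. x \<in> {0..1} \<Longrightarrow> y \<in> {0..1} \<Longrightarrow> \<bar>a x - a y\<bar> \<le> C * \<bar>x - y\<bar> powr \<beta>"
    using holder_spaceD [OF a_holder(2,1) s] unfolding \<beta>_def by metis
  \<comment> \<open>Hoelder continuity supplies the measurability of \<open>f0\<close> on the unit
    interval.\<close>
  obtain C' where "\<And>x y. x \<in> {0..1} \<Longrightarrow> y \<in> {0..1} \<Longrightarrow> \<bar>f0 x - f0 y\<bar> \<le> C' * \<bar>x - y\<bar> powr min s s"
    using holder_spaceD [OF f0_holder s(1) s] by metis
  then have "continuous_on {0..1} f0"
    using s(1) by (intro continuous_on_holder [of "min s s" _ _ C']) auto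
  then have f0: "bounded_on_unit c_hi f0"
    by (rule bounded_on_unit_continuous) (use f0_bounds in force)
  have f0_nonneg: "0 \<le> f0 x" if "x \<in> {0..1}" for x
    using f0_bounds(1) f0_bounds(3) [rule_format, OF that] by linarith
  \<comment> \<open>\<open>\<bar>a 0\<bar> + C\<close> bounds \<open>a\<close> on the unit interval
    by the Hoelder condition at 0; the maximum with 1 gives the monotonicity of powers
    \<open>A \<le> A\<^sup>2 \<le> A ^ 4\<close>.\<close>
  define A where "A = max 1 (\<bar>a 0\<bar> + C)"
  have A: "1 \<le> A" by (simp add: A_def)
  have a: "bounded_on_unit A a"
  proof (rule bounded_on_unit_continuous)
    show "continuous_on {0..1} a"
      using C(2) by (intro continuous_on_holder [OF \<beta>])
    fix x :: real assume x: "x \<in> {0..1}"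
    have "\<bar>a x - a 0\<bar> \<le> C * \<bar>x - 0\<bar> powr \<beta>"
      using x by (intro C(2)) auto
    also have "\<dots> \<le> C * 1"
      using x C(1) \<beta> by (intro mult_left_mono) (auto intro: powr_le1)
    finally show "\<bar>a x\<bar> \<le> A" by (simp add: A_def)
  qed
  have p1: "p n \<ge> 1" for n using p_def by simp
  have ln1: "\<forall>\<^sub>F n in sequentially. ln (real n) \<ge> 1" by real_asymp
  \<comment> \<open>The lower bound on \<open>p\<close> is a positive power of \<open>n\<close>;
    divergence of \<open>p\<close> makes the binning error vanish.\<close>
  have p_top: "filterlim (\<lambda>n. real (p n)) at_top sequentially"
  proof (rule filterlim_at_top_mono)
    show "filterlim (\<lambda>n. real n powr (1 / (2 * (\<gamma> + s)))) at_top sequentially"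
    proof -
      have "0 < 1 / (2 * (\<gamma> + s))" using a_holder(1) s(1) by simp
      then show ?thesis by real_asymp
    qed
    show "\<forall>\<^sub>F n in sequentially. real n powr (1 / (2 * (\<gamma> + s))) \<le> real (p n)"
      using landau_o.smallD [OF p_lower, of 1] by simp
  qed
  have p_pow: "(\<lambda>n. real (p n) powr - \<beta>) \<longlonglongrightarrow> 0"
    using \<beta> by (intro tendsto_neg_powr p_top) auto
  \<comment> \<open>Under the root stands the quotient of \<open>p\<close> by n/ln n.\<close>
  have t_lim: "t \<longlonglongrightarrow> 0" if "(\<lambda>n. real (p n)) \<in> o(\<lambda>n. real n / ln (real n))"
  proof -
    have "(\<lambda>n. real (p n) * ln (real n) / real n) \<longlonglongrightarrow> 0"
      using smalloD_tendsto [OF that] by simp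
    then show ?thesis
      unfolding t_def using tendsto_real_sqrt by fastforce
  qed
  have BvM_if: "O_prob (sample_law f0) Y r \<and> o_prob_1 (sample_law f0) Y" if "O_prob (sample_law f0) Y r" "r \<longlonglongrightarrow> 0" for Y r
    using o_prob_1_if_O_prob that by blast
  show ?thesis
  proof (intro conjI [of "_ \<longrightarrow> _" "_ \<longrightarrow> _"] impI, goal_cases)
    case asm: 1
    have \<sigma>: "0 < \<sigma> n j" if "j \<le> J n" for n j using asm that by blast
    have p_upper: "(\<lambda>n. real (p n)) \<in> o(\<lambda>n. real n / ln (real n))" using asm by blast
    have H: "(H has_real_derivative H' x) (at x)" "(H' has_real_derivative H'' x) (at x)" for x using asm by blast+
    have energy: "(\<lambda>n. haar_energy (J n) (\<sigma> n) a) \<in> o(\<lambda>n. real n)" using asm by blast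
    have c: "0 \<le> c" using asm by simp
    define S where "S = (\<lambda>n. \<Sum>j=0..J n. 1 / \<sigma> n j * 2 powr (real j / 2))"
    have S: "\<forall>\<^sub>F n in sequentially. S n \<le> c * sqrt (real n * real (p n) * ln (real n))"
      using asm unfolding S_def by blast
    have wd: "posterior_wd (sample_law f0) (\<lambda>n. haar_prior (J n) (\<sigma> n) H) (\<lambda>n. haar_density (J n))"
      using asm by blast
    have "bounded (range H')" "bounded (range H'')" using asm by blast+
    then obtain h1 h2 where "\<forall>x. \<bar>H' x\<bar> \<le> h1" "\<forall>x. \<bar>H'' x\<bar> \<le> h2"
      unfolding bounded_iff by auto
    then have H_bound: "\<bar>H' x\<bar> \<le> h1" "\<bar>H'' x\<bar> \<le> h2" for x by blast+
    have h: "0 \<le> h1" "0 \<le> h2" using H_bound [of 0] by auto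
    let ?D = "BvM_dist (\<lambda>n. haar_prior (J n) (\<sigma> n) H) (\<lambda>n. haar_density (J n))
             (\<lambda>n. haar_functional (J n) (\<sigma> n) H' a n) (\<lambda>n. centring (p n) a n) (asymp_var f0 a)"
    let ?G = "\<lambda>n. 1 / real n * haar_energy (J n) (\<sigma> n) a"
    let ?r = "\<lambda>n. real (p n) powr - \<beta> + sqrt (real (p n) * ln (real n) / real n) + ?G n"
    have "O_prob (sample_law f0) ?D ?r"
    proof (rule BvM_rate [OF f0 f0_nonneg f0_density a A var_pos C(1) \<beta> C(2) p1])
      show "0 \<le> ?G n" for n
        unfolding haar_energy_def by (intro mult_nonneg_nonneg sum_nonneg) auto
      show "0 \<le> (1 + 2 * A) * (h1 * A\<^sup>2 * c + A\<^sup>2 * sqrt (1 + h2 * c\<^sup>2))" "0 \<le> h2"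
        using A h c by (auto intro!: mult_nonneg_nonneg add_nonneg_nonneg)
      show "(\<lambda>n. outer_measure_of (sample_law f0 n) {X \<in> space (sample_law f0 n).
          norm_const (haar_prior (J n) (\<sigma> n) H) (haar_density (J n)) n X = \<infinity>}) \<longlonglongrightarrow> 0"
        using wd by (simp add: posterior_wd_def)
      show "\<forall>\<^sub>F n in sequentially. h2 / real n * haar_energy (J n) (\<sigma> n) a
          + (1 + 2 * A) * (h1 * A\<^sup>2 * S n / real n + sqrt ((A ^ 4 + h2 * A ^ 4 * (S n)\<^sup>2 / real n) / real n))
          \<le> (1 + 2 * A) * (h1 * A\<^sup>2 * c + A\<^sup>2 * sqrt (1 + h2 * c\<^sup>2)) * sqrt (real (p n) * ln (real n) / real n) + h2 * ?G n"
        using S ln1 eventually_gt_at_top [of 0]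
      proof eventually_elim
        case (elim n)
        have "0 \<le> S n" unfolding S_def using \<sigma> by (intro sum_nonneg) (auto simp: less_imp_le)
        then show ?case
          using elim p1 [of n] A h c by (intro haar_rate_bound) auto
      qed
      fix n :: nat and X :: "nat \<Rightarrow> real"
      assume n: "n \<ge> 1" and X: "\<And>i. i \<in> {1..n} \<Longrightarrow> X i \<in> {0..1}"
        and fin: "norm_const (haar_prior (J n) (\<sigma> n) H) (haar_density (J n)) n X \<noteq> \<infinity>"
      have pn: "p n = 2 ^ (J n + 1)" using p_def by blast
      show "\<bar>?D n X\<bar> \<le> 4 / asymp_var f0 a * (h2 / real n * haar_energy (J n) (\<sigma> n) a
          + (1 + 2 * A) * (h1 * A\<^sup>2 * S n / real n + sqrt ((A ^ 4 + h2 * A ^ 4 * (S n)\<^sup>2 / real n) / real n))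
          + \<bar>empirical n X (step_fun (p n) (\<lambda>\<mu>. (bin_avg (p n) a \<mu>)\<^sup>2))
            - (empirical n X (step_fun (p n) (bin_avg (p n) a)))\<^sup>2 - asymp_var f0 a\<bar>)"
        unfolding BvM_dist_def S_def pn
        by (rule haar_BvM_bound) (fact \<sigma> H H_bound n X a A var_pos fin)+
    qed
    moreover have "?r \<longlonglongrightarrow> 0"
    proof -
      have "?G \<longlonglongrightarrow> 0"
        using smalloD_tendsto [OF energy] by simp
      then show ?thesis
        using tendsto_add [OF tendsto_add [OF p_pow t_lim [OF p_upper]]] by (simp add: t_def)
    qed
    \<comment> \<open>\<open>BvM\<close> is \<open>o_prob_1\<close> of the same distance, so the
      last claim is the second one in other notation.\<close>
    ultimately show ?case
      using BvM_if [of ?D ?r] unfolding BvM_def \<beta>_def by blast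
  next
    case asm: 2
    have m: "0 < m n \<mu>" if "\<mu> \<in> {1..p n}" for n \<mu> using asm that by blast
    have p_upper: "(\<lambda>n. real (p n)) \<in> o(\<lambda>n. real n / ln (real n))" using asm by blast
    have "(\<lambda>n. MAX \<mu>\<in>{1..p n}. \<bar>m n \<mu>\<bar>) \<in> O(\<lambda>_. 1)" using asm by blast
    then obtain M where M: "M > 0" "\<forall>\<^sub>F n in sequentially. norm (MAX \<mu>\<in>{1..p n}. \<bar>m n \<mu>\<bar>) \<le> M * norm (1::real)"
      by (rule landau_o.bigE)
    define m1 where "m1 = (\<lambda>n. \<Sum>\<mu>=1..p n. m n \<mu>)"
    have m1_nonneg: "0 \<le> m1 n" for n
      unfolding m1_def using m by (intro sum_nonneg) (auto simp: less_imp_le)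
    have m1: "\<forall>\<^sub>F n in sequentially. m1 n \<le> M * real (p n)"
      using M(2)
    proof eventually_elim
      case (elim n)
      have "m n \<mu> \<le> M" if "\<mu> \<in> {1..p n}" for \<mu>
      proof -
        have "\<bar>m n \<mu>\<bar> \<le> (MAX \<mu>\<in>{1..p n}. \<bar>m n \<mu>\<bar>)"
          using that by (intro Max_ge) auto
        then show ?thesis using elim by simp
      qed
      then have "m1 n \<le> (\<Sum>\<mu>=1..p n. M)"
        unfolding m1_def by (intro sum_mono)
      then show ?case by (simp add: mult.commute)
    qed
    let ?D = "BvM_dist (\<lambda>n. dirichlet_prior (p n) (m n)) (\<lambda>n. dirichlet_density (p n))
             (\<lambda>n. dirichlet_functional (p n) (m n) a n) (\<lambda>n. centring (p n) a n) (asymp_var f0 a)"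
    let ?r = "\<lambda>n. real (p n) powr - \<beta> + sqrt (real (p n) * ln (real n) / real n)"
    \<comment> \<open>The Dirichlet posterior is normalisable for all data in the unit interval, so
      no data are excluded; with no energy term, \<open>G\<close> is zero.\<close>
    have "O_prob (sample_law f0) ?D (\<lambda>n. ?r n + 0)"
    proof (rule BvM_rate [OF f0 f0_nonneg f0_density a A var_pos C(1) \<beta> C(2) p1, where bad = "\<lambda>_ _. False" and G = "\<lambda>_. 0"])
      show "0 \<le> M * A\<^sup>2 + (1 + 2 * A) * (2 * M * A\<^sup>2 + A\<^sup>2 * sqrt (1 + M))" "0 \<le> (0::real)"
        using A M by auto
      show "(\<lambda>n. outer_measure_of (sample_law f0 n) {X \<in> space (sample_law f0 n). False}) \<longlonglongrightarrow> 0"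
        by simp
      \<comment> \<open>Eventually the rate is below 1, as \<open>dirichlet_rate_bound\<close>
        requires.\<close>
      have "\<forall>\<^sub>F n in sequentially. t n < 1"
        using t_lim [OF p_upper] by (rule order_tendstoD(2)) simp
      then show "\<forall>\<^sub>F n in sequentially. m1 n / real n * A\<^sup>2
          + (1 + 2 * A) * (2 * m1 n * A\<^sup>2 / real n + sqrt ((1 + m1 n / real n) * A ^ 4 / real n))
          \<le> (M * A\<^sup>2 + (1 + 2 * A) * (2 * M * A\<^sup>2 + A\<^sup>2 * sqrt (1 + M))) * sqrt (real (p n) * ln (real n) / real n) + 0 * 0"
        using m1 ln1 eventually_gt_at_top [of 0]
      proof eventually_elim
        case (elim n)
        then have "m1 n / real n * A\<^sup>2
          + (1 + 2 * A) * (2 * m1 n * A\<^sup>2 / real n + sqrt ((1 + m1 n / real n) * A ^ 4 / real n))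
          \<le> (M * A\<^sup>2 + (1 + 2 * A) * (2 * M * A\<^sup>2 + A\<^sup>2 * sqrt (1 + M))) * sqrt (real (p n) * ln (real n) / real n)"
          using p1 [of n] A M(1) m1_nonneg [of n] unfolding t_def by (intro dirichlet_rate_bound) auto
        then show ?case by simp
      qed
      fix n :: nat and X :: "nat \<Rightarrow> real"
      assume n: "n \<ge> 1" and X: "\<And>i. i \<in> {1..n} \<Longrightarrow> X i \<in> {0..1}"
      show "\<bar>?D n X\<bar> \<le> 4 / asymp_var f0 a * (m1 n / real n * A\<^sup>2
          + (1 + 2 * A) * (2 * m1 n * A\<^sup>2 / real n + sqrt ((1 + m1 n / real n) * A ^ 4 / real n))
          + \<bar>empirical n X (step_fun (p n) (\<lambda>\<mu>. (bin_avg (p n) a \<mu>)\<^sup>2))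
            - (empirical n X (step_fun (p n) (bin_avg (p n) a)))\<^sup>2 - asymp_var f0 a\<bar>)"
        unfolding BvM_dist_def m1_def
        by (rule dirichlet_BvM_bound) (fact p1 m n X a A var_pos)+
    qed simp_all
    then have "O_prob (sample_law f0) ?D ?r" by simp
    moreover have "?r \<longlonglongrightarrow> 0"
      using tendsto_add [OF p_pow t_lim [OF p_upper]] by (simp add: t_def)
    ultimately show ?case
      using BvM_if [of ?D ?r] unfolding BvM_def \<beta>_def by blast
  qed
qed

end
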